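(* Consider a discrete memoryless channel with noiseless, delay-free, infinite-capacity feedback, with capacity $C$, and let $R$ be a rate below capacity. For $\gamma=0$ and every $K\in\mathbb{N}$, the optimal reliability of almost-fixed-length feedback codes satisfies $$\mathcal{E}_{\mathrm{AFLF}}(R,0,K)\ \ge\ \min\left\{C_1\left(1-\frac{R}{C}\right),\ (K-1)\,E_{\mathrm r}\!\left(\frac{R}{K-1}\right)\right\}.$$ Furthermore, for all $K\in\mathbb{N}$ with $K\ge K^{\ast}:=1+\frac{C_1}{E_{\mathrm r}(0)}$, $$\mathcal{E}_{\mathrm{AFLF}}(R,0,K)=C_1\left(1-\frac{R}{C}\right).$$
   Context: Channel: finite input alphabet $\mathcal X$, finite output alphabet $\mathcal Y$, transition law $P_{Y|X}$, with $P(Y_n=y_n\mid X_1^n=x_1^n,Y_1^{n-1}=y_1^{n-1})=P_{Y|X}(y_n|x_n)$ for all $n$. The transmitter observes $Y_1,\dots,Y_{n-1}$ before sending $X_n$. All logarithms are base 2. $C$ is the capacity and $$C_1:=\max_{x,x'\in\mathcal X}D\big(P_{Y|X}(\cdot|x)\,\big\|\,P_{Y|X}(\cdot|x')\big),$$ where $D$ is the Kullback–Leibler divergence. Random coding exponent (Gallager): $E_{\mathrm r}(R)=\max_{0\le\rho\le1}\max_{Q}\{E_0(\rho,Q)-\rho R\}$, where $Q$ ranges over distributions on $\mathcal X$ and $E_0(\rho,Q)=-\log_2\sum_{y}\big(\sum_xQ(x)P_{Y|X}(y|x)^{1/(1+\rho)}\big)^{1+\rho}$. For $K=1$ the expression $(K-1)E_{\mathrm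 r}(R/(K-1))$ is read as $0$. AFLF code: for $\ell,M,K\in\mathbb N$, $\gamma\ge0$, $\epsilon\in(0,1)$, an $(\ell,M,\gamma,K,\epsilon)$ almost-fixed-length feedback (AFLF) code consists of (i) common randomness $U\sim P_U$ on a set $\mathcal U$, known to encoder and decoder before transmission; (ii) encoders $f_n:\mathcal U\times\{1,\dots,M\}\times\mathcal Y^{n-1}\to\mathcal X$, $n\in\mathbb N$, with $X_n=f_n(U,W,Y^{n-1})$, where the message $W$ is uniform on $\{1,\dots,M\}$; (iii) decoders $g_n:\mathcal U\times\mathcal Y^n\to\{1,\dots,M\}$, $n\in\mathbb N$; (iv) a random stopping time $\tau\in\mathbb N$ (determined by $U$ and the channel outputs observed so far) with $P(\tau>\ell)\le2^{-\gamma\ell}$ and $\tau\le K\ell$ almost surely, such that the final estimate $\hat W_\tau:=g_\tau(U,Y^\tau)$ satisfies $P(\hat W_\tau\ne W)\le\epsilon$. Achievability: $(R,E)$ is achievable in a $(\gamma,K)$-almost-fixed-length manner with feedback if for every $\delta>0$ there is $\ell(\delta)\in\mathbb N$ such that for all $\ell\ge\ell(\delta)$ there is an $(\ell,M_\ell,\gamma,K,\epsilon_\ell)$ AFLF code with $M_\ell\ge2^{\ell R}$, $\epsilon_\ell\le2^{-\ell(E-\delta)}$, and $P(\tau>\ell)\le\delta$ (the last requirement says that the stopping time is at most $\ell$ with high probability; it is automatic for large $\ell$ when $\gamma>0$). $\mathcal{E}_{\mathrm{AFLF}}(R,\gamma,K)$ is the largest (supremum) $E$ such that $(R,E)$ is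 achievable in this sense.
   Formalization: The equality for K ≥ K* is stated only for R > 0: at R = 0 a code with a single message (M = 1) has error zero, so every exponent is achievable and the equality with the finite value C_1 fails. The lower bound is kept for all 0 ≤ R < C. *)

theory Defs
  imports "HOL-Probability.Probability"
begin


text \<open>
  A channel is a map \<open>P :: 'x \<Rightarrow> 'y pmf\<close>, where \<open>P x\<close> is the output law for the input \<open>x\<close>.
  All logarithms are to base 2.
\<close>

text \<open>
  \<open>KL_divergence b N M\<close> of the library is the divergence of \<open>M\<close> from \<open>N\<close> (the arguments are in
  reversed order), and it is meaningful only if \<open>M\<close> is absolutely continuous with respect to \<open>N\<close>.
  Otherwise the divergence is infinite.
\<close>

definition kl_div :: "'a pmf \<Rightarrow> 'a pmf \<Rightarrow> ereal" where
  "kl_div p q =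
     (if absolutely_continuous (measure_pmf q) (measure_pmf p)
      then ereal (KL_divergence 2 (measure_pmf q) (measure_pmf p)) else \<infinity>)"

lemma absolutely_continuous_pmf_iff:
  "absolutely_continuous (measure_pmf q) (measure_pmf p) \<longleftrightarrow> set_pmf p \<subseteq> set_pmf q"
proof -
  have null: "null_sets (measure_pmf r) = {A. A \<inter> set_pmf r = {}}" for r :: "'a pmf"
    by (auto simp: null_sets_def measure_pmf.emeasure_eq_measure
        measure_pmf_zero_iff)
  show ?thesis
    unfolding absolutely_continuous_def null by blast
qed

lemma kl_div_eq_sum:
  fixes p q :: "'a :: finite pmf"
  shows "kl_div p q =
    (if set_pmf p \<subseteq> set_pmf q
     then ereal (\<Sum>a\<in>UNIV. pmf p a * log 2 (pmf p a / pmf q a)) else \<infinity>)"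
proof -
  have "KL_divergence 2 (measure_pmf q) (measure_pmf p) =
      (\<Sum>a\<in>UNIV. pmf p a * log 2 (pmf p a / pmf q a))" if "set_pmf p \<subseteq> set_pmf q"
  proof -
    interpret sigma_finite_measure "count_space (UNIV :: 'a set)"
      by (rule sigma_finite_measure_count_space_finite) simp
    have "KL_divergence 2 (density (count_space UNIV) (\<lambda>a. ennreal (pmf q a)))
            (density (count_space UNIV) (\<lambda>a. ennreal (pmf p a))) =
          (\<integral>a. pmf p a * log 2 (pmf p a / pmf q a) \<partial>count_space UNIV)"
      using that by (intro KL_density_density) (auto simp: AE_count_space set_pmf_iff)
    then show ?thesis
      by (simp add: measure_pmf_eq_density[symmetric] lebesgue_integral_count_space_finite)
  qed
  then show ?thesis
    by (simp add: kl_div_def absolutely_continuous_pmf_iff)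
qed

definition C1 :: "('x::finite \<Rightarrow> 'y::finite pmf) \<Rightarrow> ereal" where
  "C1 P = (MAX (x, x')\<in>UNIV. kl_div (P x) (P x'))"

definition joint_pmf :: "'x pmf \<Rightarrow> ('x \<Rightarrow> 'y pmf) \<Rightarrow> ('x \<times> 'y) pmf" where
  "joint_pmf Q P = bind_pmf Q (\<lambda>x. map_pmf (Pair x) (P x))"

definition capacity :: "('x::finite \<Rightarrow> 'y::finite pmf) \<Rightarrow> real" where
  "capacity P =
     (SUP Q. prob_space.mutual_information (measure_pmf (joint_pmf Q P)) 2
               (count_space UNIV) (count_space UNIV) fst snd)"

definition E0 :: "('x::finite \<Rightarrow> 'y::finite pmf) \<Rightarrow> real \<Rightarrow> 'x pmf \<Rightarrow> real" where
  "E0 P \<rho> Q =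
     - log 2 (\<Sum>y\<in>UNIV. (\<Sum>x\<in>UNIV. pmf Q x * pmf (P x) y powr (1 / (1 + \<rho>))) powr (1 + \<rho>))"

definition Er :: "('x::finite \<Rightarrow> 'y::finite pmf) \<Rightarrow> real \<Rightarrow> real" where
  "Er P R = (SUP \<rho>\<in>{0..1}. SUP Q. E0 P \<rho> Q - \<rho> * R)"



text \<open>
  Outcomes are triples \<open>(u, w, y)\<close> of the common randomness, the message and the infinite sequence
  of channel outputs. Output sequences are indexed from 0, so \<open>y n\<close> is $Y_{n+1}$ and
  \<open>past y n\<close> is $(Y_1, \dots, Y_n)$.
  Encoders and decoders of all times are bundled into one function of the list of past outputs,
  whose length determines the time: \<open>f u w ys\<close> is the channel input at time \<open>length ys + 1\<close>, and
  \<open>g u ys\<close> is the estimate at time \<open>length ys\<close>.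
\<close>

type_synonym ('u, 'y) outcome = "'u \<times> nat \<times> (nat \<Rightarrow> 'y)"

definition past :: "(nat \<Rightarrow> 'y) \<Rightarrow> nat \<Rightarrow> 'y list" where
  "past y n = map y [0..<n]"

definition outcome_algebra :: "'u measure \<Rightarrow> nat \<Rightarrow> ('u, 'y) outcome measure" where
  "outcome_algebra PU M =
     PU \<Otimes>\<^sub>M (count_space {1..M} \<Otimes>\<^sub>M (\<Pi>\<^sub>M i\<in>UNIV. count_space UNIV))"

text \<open>The \<open>\<sigma>\<close>-algebra generated by $U$, $W$ and $Y^n$, and the one generated by $U$ and $Y^n$.\<close>

definition sender_info ::
  "'u measure \<Rightarrow> nat \<Rightarrow> ('u, 'y) outcome measure \<Rightarrow> nat \<Rightarrow> ('u, 'y) outcome measure" where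
  "sender_info PU M \<Omega> n =
     vimage_algebra (space \<Omega>) (\<lambda>(u, w, y). (u, w, past y n))
       (PU \<Otimes>\<^sub>M (count_space {1..M} \<Otimes>\<^sub>M count_space UNIV))"

definition receiver_info ::
  "'u measure \<Rightarrow> ('u, 'y) outcome measure \<Rightarrow> nat \<Rightarrow> ('u, 'y) outcome measure" where
  "receiver_info PU \<Omega> n =
     vimage_algebra (space \<Omega>) (\<lambda>(u, w, y). (u, past y n)) (PU \<Otimes>\<^sub>M count_space UNIV)"

text \<open>
  \<open>\<Omega>\<close> is the joint law of $(U, W, Y_1, Y_2, \dots)$ when the encoder \<open>f\<close> is used over the channel
  \<open>P\<close>: $W$ is uniform and independent of $U \sim P_U$, and given $U$, $W$ and the past outputs
  (which determine the past and present inputs), the next output is distributed according to the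
  channel law at the present input.
\<close>

definition transmission_law ::
  "('x \<Rightarrow> 'y pmf) \<Rightarrow> 'u measure \<Rightarrow> nat \<Rightarrow> ('u \<Rightarrow> nat \<Rightarrow> 'y list \<Rightarrow> 'x) \<Rightarrow>
     ('u, 'y) outcome measure \<Rightarrow> bool" where
  "transmission_law P PU M f \<Omega> \<longleftrightarrow>
     prob_space \<Omega> \<and>
     sets \<Omega> = sets (outcome_algebra PU M) \<and>
     distr \<Omega> (PU \<Otimes>\<^sub>M count_space {1..M}) (\<lambda>(u, w, y). (u, w)) =
       PU \<Otimes>\<^sub>M uniform_count_measure {1..M} \<and>
     (\<forall>n b. AE (u, w, y) in \<Omega>.
        real_cond_exp \<Omega> (sender_info PU M \<Omega> n)
          (indicator {(u', w', y'). y' n = b}) (u, w, y) = pmf (P (f u w (past y n))) b)"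

definition aflf_code ::
  "('x \<Rightarrow> 'y pmf) \<Rightarrow> nat \<Rightarrow> nat \<Rightarrow> real \<Rightarrow> nat \<Rightarrow> real \<Rightarrow>
     'u measure \<Rightarrow> ('u \<Rightarrow> nat \<Rightarrow> 'y list \<Rightarrow> 'x) \<Rightarrow> ('u \<Rightarrow> 'y list \<Rightarrow> nat) \<Rightarrow>
     ('u, 'y) outcome measure \<Rightarrow> (('u, 'y) outcome \<Rightarrow> nat) \<Rightarrow> bool" where
  "aflf_code P l M \<gamma> K \<epsilon> PU f g \<Omega> \<tau> \<longleftrightarrow>
     1 \<le> l \<and> 1 \<le> M \<and> 1 \<le> K \<and> 0 \<le> \<gamma> \<and> 0 < \<epsilon> \<and> \<epsilon> < 1 \<and>
     prob_space PU \<and>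
     (\<forall>w\<in>{1..M}. \<forall>ys. (\<lambda>u. f u w ys) \<in> measurable PU (count_space UNIV)) \<and>
     (\<forall>ys. (\<lambda>u. g u ys) \<in> measurable PU (count_space {1..M})) \<and>
     transmission_law P PU M f \<Omega> \<and>
     stopping_time (receiver_info PU \<Omega>) \<tau> \<and>
     (\<forall>\<omega>\<in>space \<Omega>. 1 \<le> \<tau> \<omega>) \<and>
     \<P>(\<omega> in \<Omega>. \<tau> \<omega> > l) \<le> 2 powr (- \<gamma> * real l) \<and>
     (AE \<omega> in \<Omega>. \<tau> \<omega> \<le> K * l) \<and>
     \<P>(\<omega> in \<Omega>. case \<omega> of (u, w, y) \<Rightarrow> g u (past y (\<tau> \<omega>)) \<noteq> w) \<le> \<epsilon>"

text \<open>
  The common randomness takes values in a set of elements of the type \<open>'u\<close>, which has to be an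
  explicit parameter because types cannot be quantified inside a formula. The law \<open>PU\<close> and its
  \<open>\<sigma>\<close>-algebra may depend on the code.
\<close>

definition achievable ::
  "'u itself \<Rightarrow> ('x \<Rightarrow> 'y pmf) \<Rightarrow> real \<Rightarrow> real \<Rightarrow> nat \<Rightarrow> real \<Rightarrow> bool" where
  "achievable TYPE('u) P R \<gamma> K E \<longleftrightarrow>
     (\<forall>\<delta>>0. \<exists>l0. \<forall>l\<ge>l0. \<exists>M \<epsilon> (PU :: 'u measure) f g \<Omega> \<tau>.
        aflf_code P l M \<gamma> K \<epsilon> PU f g \<Omega> \<tau> \<and>
        real M \<ge> 2 powr (real l * R) \<and>
        \<epsilon> \<le> 2 powr (- real l * (E - \<delta>)) \<and>
        \<P>(\<omega> in \<Omega>. \<tau> \<omega> > l) \<le> \<delta>)"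

definition aflf_exponent ::
  "'u itself \<Rightarrow> ('x \<Rightarrow> 'y pmf) \<Rightarrow> real \<Rightarrow> real \<Rightarrow> nat \<Rightarrow> ereal" where
  "aflf_exponent TYPE('u) P R \<gamma> K =
     Sup {ereal E | E. achievable TYPE('u) P R \<gamma> K E}"

end

theory Submission
  imports Defs
begin

text \<open>
  Achievability is the Yamamoto--Itoh scheme with a fallback. A block code of rate below capacity
  occupies a fraction slightly above \<open>R / C\<close> of the first \<open>l\<close> channel uses; the sender sees the
  tentative decision through the feedback and spends the remaining uses on repeating one of two
  inputs attaining \<open>C1\<close>, to confirm or to reject it. If the receiver detects a rejection, a fresh block
  code of length \<open>(K - 1) * l\<close> sends the message again. An error needs an undetected rejection or an
  error of the last block.

  For the converse, fix the common randomness and follow the posterior law of the message. Its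
  entropy decreases by at most \<open>C\<close> per use on average, which accounts for about \<open>log M / C\<close> uses
  until some message has posterior probability \<open>1 - \<delta>\<close>. From then on the logarithm of the inverse of
  the residual probability grows by at most \<open>C1\<close> per use on average, which accounts for about
  \<open>log (1 / \<epsilon>) / C1\<close> further uses. Both are combined in one potential with drift at most 1, stopped
  at \<open>\<tau>\<close>.

  The threshold on \<open>K\<close> suffices because \<open>Er\<close> has slope at least \<open>-1\<close> and \<open>C \<le> C1\<close>.
\<close>

section \<open>Output words and their probabilities\<close>

text \<open>A code is described by conditional expectations on infinite output sequences, although
  almost surely only the first \<open>K * l\<close> outputs matter. Both directions are therefore
  carried out with finite sums over output words weighted by \<open>path_prob\<close>, and measure
  theory is confined to the passage between the two descriptions. Since the common randomness is
  averaged out last, the converse for one value of it has to be affine in the error probability and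
  expected length that belong to this value. The obstacle of the converse is that the message that
  becomes nearly certain need not be the one finally decoded. It is kept fixed so that its log odds
  have a clean drift bound, and the chance that it is wrong is controlled separately by
  \<open>doubt\<close>, whose mean stays at most \<open>\<delta>\<close>. With \<gamma> = 0, late
  stopping is merely unlikely; as \<open>\<tau> \<le> K * l\<close>, it adds at most
  \<open>K * l * \<delta>\<close> to the expected length, which disappears when
  \<open>\<delta>\<close> tends to 0 after \<open>l\<close> has grown. The equality asks for
  \<open>0 < R\<close> because at rate 0 a single message is allowed, and a single message is
  decoded without error.\<close>

definition words :: "nat \<Rightarrow> 'y list set" where
  "words n = {ys. length ys = n}"

text \<open>The law of the next output may depend on the whole past. One definition thus covers
  feedback encoders (\<open>\<lambda>zs. P (f w zs)\<close>), block codes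
  (\<open>\<lambda>zs. P (c w (length zs))\<close>) and a repeated input
  (\<open>\<lambda>_. P x\<close>).\<close>

definition path_prob :: "('y list \<Rightarrow> 'y pmf) \<Rightarrow> 'y list \<Rightarrow> real" where
  "path_prob k ys = (\<Prod>i<length ys. pmf (k (take i ys)) (ys ! i))"

lemma in_words_iff [simp]: "ys \<in> words n \<longleftrightarrow> length ys = n"
  by (simp add: words_def)

lemma words_0 [simp]: "words 0 = {[]}"
  by (auto simp: words_def)

lemma finite_words [simp]: "finite (words n :: 'y::finite list set)"
  using finite_lists_length_eq[of "UNIV :: 'y set" n] by (simp add: words_def)

lemma sum_words_add:
  fixes F :: "'y::finite list \<Rightarrow> 'b::comm_monoid_add"
  shows "(\<Sum>ys\<in>words (a + b). F ys) = (\<Sum>us\<in>words a. \<Sum>vs\<in>words b. F (us @ vs))"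
proof -
  have "(\<Sum>us\<in>words a. \<Sum>vs\<in>words b. F (us @ vs)) =
      (\<Sum>(us, vs)\<in>words a \<times> words b. F (us @ vs))"
    by (simp add: sum.cartesian_product)
  also have "\<dots> = (\<Sum>ys\<in>words (a + b). F ys)"
    by (rule sum.reindex_bij_witness[where i = "\<lambda>ys. (take a ys, drop a ys)" and j = "\<lambda>(us, vs). us @ vs"])
      auto
  finally show ?thesis by simp
qed

lemma sum_words_1:
  fixes F :: "'y::finite list \<Rightarrow> 'b::comm_monoid_add"
  shows "(\<Sum>ys\<in>words (Suc 0). F ys) = (\<Sum>y\<in>UNIV. F [y])"
  by (rule sum.reindex_bij_witness[where i = "\<lambda>y. [y]" and j = hd]) (auto simp: length_Suc_conv)

lemma sum_words_Suc:
  fixes F :: "'y::finite list \<Rightarrow> 'b::comm_monoid_add"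
  shows "(\<Sum>ys\<in>words (Suc n). F ys) = (\<Sum>ys\<in>words n. \<Sum>y\<in>UNIV. F (ys @ [y]))"
  using sum_words_add[of F n "Suc 0"] by (simp add: sum_words_1)

lemma path_prob_Nil [simp]: "path_prob k [] = 1"
  by (simp add: path_prob_def)

lemma path_prob_nonneg [simp]: "0 \<le> path_prob k ys"
  by (simp add: path_prob_def prod_nonneg)

lemma path_prob_snoc: "path_prob k (ys @ [y]) = path_prob k ys * pmf (k ys) y"
proof -
  have "(\<Prod>i<length ys. pmf (k (take i (ys @ [y]))) ((ys @ [y]) ! i)) = path_prob k ys"
    unfolding path_prob_def by (intro prod.cong) (auto simp: nth_append)
  then show ?thesis
    by (simp add: path_prob_def)
qed

lemma path_prob_append:
  "path_prob k (us @ vs) = path_prob k us * path_prob (\<lambda>zs. k (us @ zs)) vs"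
proof (induction vs rule: rev_induct)
  case (snoc v vs)
  have "path_prob k (us @ vs @ [v]) = path_prob k (us @ vs) * pmf (k (us @ vs)) v"
    using path_prob_snoc[of k "us @ vs" v] by simp
  then show ?case
    by (simp add: snoc path_prob_snoc)
qed simp

lemma path_prob_cong:
  assumes "\<And>zs. length zs < length ys \<Longrightarrow> k zs = k' zs"
  shows "path_prob k ys = path_prob k' ys"
  unfolding path_prob_def using assms by (intro prod.cong) auto

lemma sum_pmf_UNIV [simp]: "(\<Sum>y\<in>UNIV. pmf p y) = (1 :: real)" for p :: "'y::finite pmf"
  by (rule sum_pmf_eq_1) auto

lemma sum_path_prob [simp]:
  fixes k :: "'y::finite list \<Rightarrow> 'y pmf"
  shows "(\<Sum>ys\<in>words n. path_prob k ys) = 1"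
proof (induction n)
  case (Suc n)
  then show ?case
    by (simp add: sum_words_Suc path_prob_snoc flip: sum_distrib_left)
qed simp

text \<open>The memoryless factorisation that turns the word sums of the Gallager and Chernoff
  bounds into n-th powers of single-letter sums.\<close>

lemma sum_words_prod:
  fixes h :: "nat \<Rightarrow> 'y::finite \<Rightarrow> real"
  shows "(\<Sum>ys\<in>words n. \<Prod>i<n. h i (ys ! i)) = (\<Prod>i<n. \<Sum>y\<in>UNIV. h i y)"
proof (induction n)
  case (Suc n)
  have "(\<Sum>ys\<in>words (Suc n). \<Prod>i<Suc n. h i (ys ! i)) =
      (\<Sum>ys\<in>words n. \<Sum>y\<in>UNIV. (\<Prod>i<n. h i (ys ! i)) * h n y)"
    unfolding sum_words_Suc
  proof (intro sum.cong refl)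
    fix ys :: "'y list" and y :: 'y assume "ys \<in> words n"
    then have "(\<Prod>i<n. h i ((ys @ [y]) ! i)) = (\<Prod>i<n. h i (ys ! i))"
      by (intro prod.cong) (auto simp: nth_append)
    with \<open>ys \<in> words n\<close> show "(\<Prod>i<Suc n. h i ((ys @ [y]) ! i)) = (\<Prod>i<n. h i (ys ! i)) * h n y"
      by (simp add: nth_append)
  qed
  also have "\<dots> = (\<Prod>i<Suc n. \<Sum>y\<in>UNIV. h i y)"
    by (simp add: Suc flip: sum_product sum_distrib_left sum_distrib_right)
  finally show ?case .
qed simp

section \<open>Random coding\<close>

text \<open>With \<open>e\<close> the mean of \<open>X\<close>, Young's inequality gives \<open>X a
  powr \<rho> * e powr (1 - \<rho>) \<le> \<rho> * X a + (1 - \<rho>) * e\<close>; the right-hand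
  side has mean \<open>e\<close>, and dividing by \<open>e powr (1 - \<rho>)\<close>
  finishes.\<close>

lemma powr_Jensen_pmf:
  fixes X :: "'a \<Rightarrow> real"
  assumes fin: "finite (set_pmf p)" and X: "\<And>a. 0 \<le> X a" and \<rho>: "0 \<le> \<rho>" "\<rho> \<le> 1"
    and pos: "0 < measure_pmf.expectation p X"
  shows "measure_pmf.expectation p (\<lambda>a. X a powr \<rho>) \<le> measure_pmf.expectation p X powr \<rho>"
proof -
  define e where "e = measure_pmf.expectation p X"
  have e: "0 < e" using pos by (simp add: e_def)
  have int: "integrable (measure_pmf p) f" for f :: "'a \<Rightarrow> real"
    by (rule integrable_measure_pmf_finite[OF fin])
  have "X a powr \<rho> * e powr (1 - \<rho>) \<le> \<rho> * X a + (1 - \<rho>) * e" for a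
  proof (cases "X a = 0")
    case False
    then show ?thesis
      using Youngs_inequality_0[of \<rho> "1 - \<rho>" "X a" e] \<rho> X[of a] e by simp
  qed (use e \<rho> in simp)
  then have "measure_pmf.expectation p (\<lambda>a. X a powr \<rho> * e powr (1 - \<rho>)) \<le>
      measure_pmf.expectation p (\<lambda>a. \<rho> * X a + (1 - \<rho>) * e)"
    by (intro integral_mono int) auto
  also have "\<dots> = e"
    by (simp add: int e_def[symmetric] algebra_simps)
  finally have "measure_pmf.expectation p (\<lambda>a. X a powr \<rho>) * e powr (1 - \<rho>) \<le> e powr \<rho> * e powr (1 - \<rho>)"
    using e by (simp flip: powr_add)
  then show ?thesis
    using e by (simp add: e_def[symmetric])
qed

lemma pmf_exists_le_expectation:
  fixes F :: "'a \<Rightarrow> real"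
  assumes "finite (set_pmf p)"
  shows "\<exists>a. F a \<le> measure_pmf.expectation p F"
proof (rule ccontr)
  assume *: "\<nexists>a. F a \<le> measure_pmf.expectation p F"
  have "measure_pmf.expectation p F = (\<Sum>a\<in>set_pmf p. pmf p a * F a)"
    using integral_measure_pmf[OF assms, of p F] by simp
  moreover have "(\<Sum>a\<in>set_pmf p. pmf p a * measure_pmf.expectation p F) < (\<Sum>a\<in>set_pmf p. pmf p a * F a)"
    using * assms by (intro sum_strict_mono) (auto simp: not_le set_pmf_not_empty pmf_positive)
  moreover have "(\<Sum>a\<in>set_pmf p. pmf p a * measure_pmf.expectation p F) = measure_pmf.expectation p F"
    using sum_pmf_eq_1[OF assms order_refl] by (simp flip: sum_distrib_right)
  ultimately show False by simp
qed

text \<open>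
  Gallager's bound. A maximum likelihood decoder errs on \<open>w\<close> only if some other codeword is at least
  as likely, so with \<open>s = 1 / (1 + \<rho>)\<close> the indicator of an error is at most
  \<open>(\<Sum>w' \<noteq> w. (p (c w') z / p (c w) z) powr s) powr \<rho>\<close>; the average over independent codewords
  factors, and Jensen's inequality moves the expectation inside the concave power.
\<close>
lemma random_coding_bound:
  fixes p :: "'c \<Rightarrow> 'o \<Rightarrow> real" and q :: "'c pmf"
  assumes q: "finite (set_pmf q)" and S: "finite S" and p: "\<And>c z. 0 \<le> p c z"
    and M: "1 \<le> (M :: nat)" and \<rho>: "0 \<le> \<rho>" "\<rho> \<le> 1"
  shows "\<exists>c d. (\<forall>z. d z \<in> {1..M}) \<and>
      (\<Sum>w=1..M. \<Sum>z\<in>S. if d z \<noteq> w then p (c w) z else 0) \<le>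
      real M * (real (M - 1) powr \<rho> *
        (\<Sum>z\<in>S. measure_pmf.expectation q (\<lambda>x. p x z powr (1 / (1 + \<rho>))) powr (1 + \<rho>)))"
proof -
  define s where "s = 1 / (1 + \<rho>)"
  have s: "0 < s" "s + s * \<rho> = 1" using \<rho> by (auto simp: s_def field_simps)
  define g where "g z = measure_pmf.expectation q (\<lambda>x. p x z powr s)" for z
  have g0: "0 \<le> g z" for z unfolding g_def by (rule Bochner_Integration.integral_nonneg) simp
  have "\<exists>w\<in>{1..M}. \<forall>w'\<in>{1..M}. p (c w') z \<le> p (c w) z" for c :: "nat \<Rightarrow> 'c" and z
  proof -
    have "Max ((\<lambda>w. p (c w) z) ` {1..M}) \<in> (\<lambda>w. p (c w) z) ` {1..M}"
      using M by (intro Max_in) auto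
    then obtain w where w: "w \<in> {1..M}" "Max ((\<lambda>w. p (c w) z) ` {1..M}) = p (c w) z" by auto
    then have "p (c w') z \<le> p (c w) z" if "w' \<in> {1..M}" for w'
      using that by (metis Max_ge finite_atLeastAtMost finite_imageI imageI)
    with w show ?thesis by blast
  qed
  then obtain d :: "(nat \<Rightarrow> 'c) \<Rightarrow> 'o \<Rightarrow> nat" where dM: "\<And>c z. d c z \<in> {1..M}"
    and dmax: "\<And>c w z. w \<in> {1..M} \<Longrightarrow> p (c w) z \<le> p (c (d c z)) z"
    by metis
  define T where "T c w z = (\<Sum>w'\<in>{1..M} - {w}. p (c w') z powr s)" for c :: "nat \<Rightarrow> 'c" and w z
  have T0: "0 \<le> T c w z" for c w z unfolding T_def by (intro sum_nonneg) auto
  have err: "(if d c z \<noteq> w then p (c w) z else 0) \<le> p (c w) z powr s * T c w z powr \<rho>"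
    if w: "w \<in> {1..M}" for c w z
  proof (cases "d c z \<noteq> w \<and> p (c w) z \<noteq> 0")
    case True
    then have "p (c w) z powr s \<le> p (c (d c z)) z powr s"
      using dmax[OF w] p s by (intro powr_mono2) auto
    also have "\<dots> \<le> T c w z"
      unfolding T_def using True dM[of c z] by (intro member_le_sum) auto
    finally have "(p (c w) z powr s) powr \<rho> \<le> T c w z powr \<rho>"
      using \<rho> by (intro powr_mono2) auto
    moreover have "p (c w) z = p (c w) z powr s * (p (c w) z powr s) powr \<rho>"
      using s p[of "c w" z] True by (simp add: powr_powr flip: powr_add)
    ultimately show ?thesis
      using True by (smt (verit, best) mult_left_mono powr_ge_zero)
  qed (use p in auto)
  \<comment> \<open>The random codebook of independent codewords; in the end it is fixed at a
    codebook that is no worse than the average.\<close>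
  define B where "B = Pi_pmf {1..M} undefined (\<lambda>_. q)"
  have setB: "finite (set_pmf B)"
    unfolding B_def by (subst set_Pi_pmf) (auto intro!: finite_PiE_dflt q)
  have int: "integrable (measure_pmf B) f" for f :: "_ \<Rightarrow> real"
    by (rule integrable_measure_pmf_finite[OF setB])
  have ET: "measure_pmf.expectation B (\<lambda>c. p (c w) z powr s * T c w z powr \<rho>) \<le>
      real (M - 1) powr \<rho> * g z powr (1 + \<rho>)" if w: "w \<in> {1..M}" for w z
  proof -
    \<comment> \<open>The codeword of \<open>w\<close> is split off from the others:
      \<open>T c w z\<close> depends only on the latter, so the expectation of the product
      factors.\<close>
    define A where "A = {1..M} - {w}"
    define B' where "B' = Pi_pmf A undefined (\<lambda>_. q)"
    have setB': "finite (set_pmf B')"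
      unfolding B'_def A_def by (subst set_Pi_pmf) (auto intro!: finite_PiE_dflt q)
    have A: "finite A" "w \<notin> A" "{1..M} = insert w A" "card A = M - 1" using w by (auto simp: A_def)
    have "measure_pmf.expectation B (\<lambda>c. p (c w) z powr s * T c w z powr \<rho>) =
        measure_pmf.expectation (map_pmf (\<lambda>(x, c). c(w := x)) (pair_pmf q B'))
          (\<lambda>c. p (c w) z powr s * T c w z powr \<rho>)"
      unfolding B_def B'_def A(3) by (subst Pi_pmf_insert[OF A(1,2)]) simp
    also have "\<dots> = measure_pmf.expectation (pair_pmf q B') (\<lambda>(x, c). p x z powr s * T c w z powr \<rho>)"
      unfolding integral_map_pmf
      by (intro Bochner_Integration.integral_cong)
        (auto simp: T_def intro!: arg_cong2[where f = "(powr)"] arg_cong2[where f = "(*)"] sum.cong)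
    also have "\<dots> = g z * measure_pmf.expectation B' (\<lambda>c. T c w z powr \<rho>)"
      using q setB' by (subst integral_measure_pmf[where A = "set_pmf q \<times> set_pmf B'"])
       (auto simp:
        integral_measure_pmf[where A = "set_pmf q"] integral_measure_pmf[where A = "set_pmf B'"]
        g_def sum_product sum.cartesian_product pmf_pair ac_simps intro!: sum.cong)
    \<comment> \<open>Jensen's inequality is applied with mean \<open>real (M - 1) * g z\<close>,
      which has to be positive; hence the separate treatment of \<open>g z = 0\<close> and
      \<open>M = 1\<close>.\<close>
    also have "measure_pmf.expectation B' (\<lambda>c. T c w z powr \<rho>) \<le> (real (M - 1) * g z) powr \<rho>" if "g z \<noteq> 0"
    proof (cases "M = 1")
      case True
      then have "A = {}" using w by (auto simp: A_def)
      then have "T c w z = 0" for c unfolding T_def A_def[symmetric] by simp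
      with True show ?thesis by simp
    next
      case False
      have comp: "measure_pmf.expectation B' (\<lambda>c. p (c w') z powr s) = g z" if "w' \<in> A" for w'
      proof -
        have "measure_pmf.expectation B' (\<lambda>c. p (c w') z powr s) =
            measure_pmf.expectation (map_pmf (\<lambda>c. c w') B') (\<lambda>x. p x z powr s)"
          by simp
        then show ?thesis
          unfolding B'_def g_def using that A by (simp only: Pi_pmf_component if_True)
      qed
      have "measure_pmf.expectation B' (\<lambda>c. T c w z) = (\<Sum>w'\<in>A. measure_pmf.expectation B' (\<lambda>c. p (c w') z powr s))"
        unfolding T_def A_def[symmetric]
        by (intro Bochner_Integration.integral_sum integrable_measure_pmf_finite[OF setB'])
      also have "\<dots> = real (M - 1) * g z" using A comp by simp
      finally have *: "measure_pmf.expectation B' (\<lambda>c. T c w z) = real (M - 1) * g z" .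
      then show ?thesis
        using powr_Jensen_pmf[OF setB', of "\<lambda>c. T c w z" \<rho>] \<rho> T0 that g0[of z] False M by simp
    qed
    then have "g z * measure_pmf.expectation B' (\<lambda>c. T c w z powr \<rho>) \<le> g z * (real (M - 1) * g z) powr \<rho>"
      using g0[of z] by (cases "g z = 0") (auto intro: mult_left_mono)
    also have "\<dots> = real (M - 1) powr \<rho> * g z powr (1 + \<rho>)"
      using g0[of z] by (cases "g z = 0") (auto simp: powr_mult powr_add)
    finally show ?thesis .
  qed
  define F where "F c = (\<Sum>w=1..M. \<Sum>z\<in>S. if d c z \<noteq> w then p (c w) z else 0)" for c
  have "measure_pmf.expectation B F \<le>
      measure_pmf.expectation B (\<lambda>c. \<Sum>w=1..M. \<Sum>z\<in>S. p (c w) z powr s * T c w z powr \<rho>)"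
    unfolding F_def using err by (intro integral_mono int sum_mono) auto
  also have "\<dots> = (\<Sum>w=1..M. \<Sum>z\<in>S. measure_pmf.expectation B (\<lambda>c. p (c w) z powr s * T c w z powr \<rho>))"
    by (subst Bochner_Integration.integral_sum[OF int])+ simp
  also have "\<dots> \<le> (\<Sum>w=1..M. \<Sum>z\<in>S. real (M - 1) powr \<rho> * g z powr (1 + \<rho>))"
    using ET by (intro sum_mono) auto
  also have "\<dots> = real M * (real (M - 1) powr \<rho> * (\<Sum>z\<in>S. g z powr (1 + \<rho>)))"
    using M by (simp add: sum_distrib_left of_nat_diff)
  finally have bnd: "measure_pmf.expectation B F \<le> \<dots>" .
  from pmf_exists_le_expectation[OF setB, of F] obtain c where "F c \<le> measure_pmf.expectation B F" by blast
  with bnd have "F c \<le> real M * (real (M - 1) powr \<rho> * (\<Sum>z\<in>S. g z powr (1 + \<rho>)))" by linarith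
  then show ?thesis
    unfolding F_def g_def s_def using dM by (intro exI[of _ c] exI[of _ "d c"]) blast
qed

lemma E0_sum_pos:
  fixes P :: "'x::finite \<Rightarrow> 'y::finite pmf"
  shows "0 < (\<Sum>y\<in>UNIV. (\<Sum>x\<in>UNIV. pmf Q x * pmf (P x) y powr s) powr t)"
proof -
  obtain x where x: "x \<in> set_pmf Q" using set_pmf_not_empty by fast
  obtain y where y: "y \<in> set_pmf (P x)" using set_pmf_not_empty by fast
  have "0 < pmf Q x * pmf (P x) y powr s"
    using x y by (simp add: pmf_positive_iff[symmetric])
  also have "\<dots> \<le> (\<Sum>x\<in>UNIV. pmf Q x * pmf (P x) y powr s)"
    by (intro member_le_sum) auto
  finally have "0 < (\<Sum>x\<in>UNIV. pmf Q x * pmf (P x) y powr s) powr t" by simp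
  also have "\<dots> \<le> (\<Sum>y\<in>UNIV. (\<Sum>x\<in>UNIV. pmf Q x * pmf (P x) y powr s) powr t)"
    by (intro member_le_sum) auto
  finally show ?thesis .
qed

text \<open>Codewords with independent letters of law \<open>Q\<close> make Gallager's sum over
  words the n-th power of the sum inside \<open>E0\<close>. Only the error summed over all messages
  is bounded, which suits a uniform message.\<close>

lemma block_code_exists:
  fixes P :: "'x::finite \<Rightarrow> 'y::finite pmf"
  assumes M: "1 \<le> (M :: nat)" and \<rho>: "0 \<le> \<rho>" "\<rho> \<le> 1"
  shows "\<exists>c d. (\<forall>ys. d ys \<in> {1..M}) \<and>
      (\<Sum>w=1..M. \<Sum>ys\<in>words n. if d ys \<noteq> w then path_prob (\<lambda>zs. P (c w (length zs))) ys else 0) \<le>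
      real M * (real (M - 1) powr \<rho> * 2 powr (- real n * E0 P \<rho> Q))"
proof -
  define s where "s = 1 / (1 + \<rho>)"
  define q where "q = Pi_pmf {..<n} undefined (\<lambda>_. Q)"
  define p :: "(nat \<Rightarrow> 'x) \<Rightarrow> 'y list \<Rightarrow> real"
    where "p c ys = path_prob (\<lambda>zs. P (c (length zs))) ys" for c ys
  define h where "h y = (\<Sum>x\<in>UNIV. pmf Q x * pmf (P x) y powr s)" for y
  have h0: "0 \<le> h y" for y unfolding h_def by (intro sum_nonneg) auto
  have q: "finite (set_pmf q)"
    unfolding q_def by (subst set_Pi_pmf) (auto intro!: finite_PiE_dflt)
  have E: "measure_pmf.expectation q (\<lambda>c. p c ys powr s) = (\<Prod>i<n. h (ys ! i))" if "ys \<in> words n" for ys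
  proof -
    have "p c ys powr s = (\<Prod>i<n. pmf (P (c i)) (ys ! i) powr s)" for c
      using that by (auto simp: p_def path_prob_def prod_powr_distrib intro!: prod.cong)
    then have "measure_pmf.expectation q (\<lambda>c. p c ys powr s) =
        (\<Prod>i<n. measure_pmf.expectation Q (\<lambda>x. pmf (P x) (ys ! i) powr s))"
      unfolding q_def
      using expectation_prod_Pi_pmf[of "{..<n}" "\<lambda>_. Q" "\<lambda>i x. pmf (P x) (ys ! i) powr s" undefined]
      by (simp add: integrable_measure_pmf_finite)
    also have "\<dots> = (\<Prod>i<n. h (ys ! i))"
      unfolding h_def by (intro prod.cong refl) (subst integral_measure_pmf[of UNIV], auto)
    finally show ?thesis .
  qed
  have "(\<Sum>ys\<in>words n. measure_pmf.expectation q (\<lambda>c. p c ys powr s) powr (1 + \<rho>)) =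
      (\<Sum>ys\<in>words n. \<Prod>i<n. h (ys ! i) powr (1 + \<rho>))"
    by (intro sum.cong refl) (simp add: E prod_powr_distrib h0)
  also have "\<dots> = (\<Sum>y\<in>UNIV. h y powr (1 + \<rho>)) ^ n"
    by (simp add: sum_words_prod[of "\<lambda>_ y. h y powr (1 + \<rho>)"])
  also have "(\<Sum>y\<in>UNIV. h y powr (1 + \<rho>)) = 2 powr (- E0 P \<rho> Q)"
    using E0_sum_pos[of Q P s "1 + \<rho>"] by (simp add: E0_def h_def s_def)
  also have "\<dots> ^ n = 2 powr (- real n * E0 P \<rho> Q)"
    by (simp add: powr_powr powr_realpow[symmetric] mult.commute)
  finally show ?thesis
    using random_coding_bound[OF q finite_words[of n] _ M \<rho>, of p] unfolding s_def p_def
    by simp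
qed

section \<open>Mutual information and divergence\<close>

definition mutual_info :: "'x::finite pmf \<Rightarrow> ('x \<Rightarrow> 'y::finite pmf) \<Rightarrow> real" where
  "mutual_info Q P =
     (\<Sum>x\<in>UNIV. \<Sum>y\<in>UNIV. pmf Q x * pmf (P x) y * log 2 (pmf (P x) y / (\<Sum>x'\<in>UNIV. pmf Q x' * pmf (P x') y)))"

lemma pmf_joint_pmf: "pmf (joint_pmf Q P) (x, y) = pmf Q x * pmf (P x) y"
  for Q :: "'x::finite pmf"
proof -
  have "pmf (map_pmf (Pair x') (P x')) (x, y) = (if x' = x then pmf (P x) y else 0)" for x'
    using pmf_map_inj'[of "Pair x" "P x" y]
    by (auto simp: inj_on_def pmf_eq_0_set_pmf)
  then show ?thesis
    unfolding joint_pmf_def pmf_bind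
    by (subst integral_measure_pmf[of UNIV]) (auto simp: if_distrib[of "\<lambda>t. _ * t"] cong: if_cong)
qed

lemma mutual_information_joint_pmf:
  fixes Q :: "'x::finite pmf" and P :: "'x \<Rightarrow> 'y::finite pmf"
  shows "prob_space.mutual_information (measure_pmf (joint_pmf Q P)) 2
           (count_space UNIV) (count_space UNIV) fst snd = mutual_info Q P"
proof -
  let ?J = "joint_pmf Q P"
  interpret information_space "measure_pmf ?J" 2
    by standard simp
  define q where "q y = (\<Sum>x'\<in>UNIV. pmf Q x' * pmf (P x') y)" for y
  have prob: "measure_pmf.prob ?J A = (\<Sum>z\<in>A. pmf ?J z)" for A
    using measure_measure_pmf_finite[of A ?J] by simp
  have X: "simple_distributed (measure_pmf ?J) fst (pmf Q)"
  proof (intro measure_pmf.simple_distributedI)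
    fix x assume "x \<in> fst ` space (measure_pmf ?J)"
    have "fst -` {x} = Pair x ` (UNIV :: 'y set)" by auto
    then show "pmf Q x = measure_pmf.prob ?J (fst -` {x} \<inter> space (measure_pmf ?J))"
      by (simp add: prob sum.reindex inj_on_def pmf_joint_pmf flip: sum_distrib_left)
  qed (auto simp: simple_function_def)
  have Y: "simple_distributed (measure_pmf ?J) snd q"
  proof (intro measure_pmf.simple_distributedI)
    fix y assume "y \<in> snd ` space (measure_pmf ?J)"
    have "snd -` {y} = (\<lambda>x. (x, y)) ` (UNIV :: 'x set)" by auto
    then show "q y = measure_pmf.prob ?J (snd -` {y} \<inter> space (measure_pmf ?J))"
      by (simp add: prob sum.reindex inj_on_def pmf_joint_pmf q_def)
  qed (auto simp: simple_function_def q_def intro!: sum_nonneg)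
  have XY: "simple_distributed (measure_pmf ?J) (\<lambda>z. (fst z, snd z)) (pmf ?J)"
  proof (intro measure_pmf.simple_distributedI)
    fix z :: "'x \<times> 'y"
    have "(\<lambda>z. (fst z, snd z)) -` {z} = {z}" by auto
    then show "pmf ?J z = measure_pmf.prob ?J ((\<lambda>z. (fst z, snd z)) -` {z} \<inter> space (measure_pmf ?J))"
      by (simp add: measure_pmf_single)
  qed (auto simp: simple_function_def)
  have "prob_space.mutual_information (measure_pmf ?J) 2 (count_space (fst ` space (measure_pmf ?J)))
      (count_space (snd ` space (measure_pmf ?J))) fst snd =
    (\<Sum>(x, y)\<in>UNIV. pmf ?J (x, y) * log 2 (pmf ?J (x, y) / (pmf Q x * q y)))"
    using mutual_information_simple_distributed[OF X Y XY] by simp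
  also have "\<dots> = (\<Sum>(x, y)\<in>UNIV. pmf Q x * pmf (P x) y * log 2 (pmf (P x) y / q y))"
    by (intro sum.cong) (auto simp: pmf_joint_pmf)
  also have "\<dots> = mutual_info Q P"
    by (simp add: mutual_info_def q_def sum.cartesian_product)
  finally show ?thesis
    by simp
qed

lemma capacity_eq_SUP: "capacity P = (SUP Q. mutual_info Q P)"
  by (simp add: capacity_def mutual_information_joint_pmf)

lemma pmf_mixture_pos:
  fixes Q :: "'x::finite pmf"
  assumes "pmf Q x * pmf (P x) y \<noteq> 0"
  shows "0 < (\<Sum>x'\<in>UNIV. pmf Q x' * pmf (P x') y)"
proof -
  have "0 < pmf Q x * pmf (P x) y"
    using assms by (metis less_eq_real_def mult_nonneg_nonneg pmf_nonneg)
  also have "\<dots> \<le> (\<Sum>x'\<in>UNIV. pmf Q x' * pmf (P x') y)"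
    by (intro member_le_sum) auto
  finally show ?thesis .
qed

lemma sum_mixture [simp]:
  fixes Q :: "'x::finite pmf" and P :: "'x \<Rightarrow> 'y::finite pmf"
  shows "(\<Sum>y\<in>UNIV. \<Sum>x\<in>UNIV. pmf Q x * pmf (P x) y) = 1"
  by (subst sum.swap) (simp flip: sum_distrib_left)

text \<open>A crude bound from \<open>ln z \<le> z - 1\<close> and
  \<open>pmf (P x) y \<le> 1\<close>. It serves to show that the real supremum in
  \<open>capacity\<close> is taken over a bounded set.\<close>

lemma mutual_info_le:
  fixes Q :: "'x::finite pmf" and P :: "'x \<Rightarrow> 'y::finite pmf"
  shows "mutual_info Q P \<le> real CARD('y) / ln 2"
proof -
  define q where "q y = (\<Sum>x'\<in>UNIV. pmf Q x' * pmf (P x') y)" for y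
  have "pmf Q x * pmf (P x) y * log 2 (pmf (P x) y / q y) \<le> pmf Q x * pmf (P x) y / q y / ln 2"
    (is "?l \<le> ?r") for x y
  proof (cases "pmf Q x * pmf (P x) y = 0")
    case False
    then have pos: "0 < pmf Q x" "0 < pmf (P x) y" "0 < q y"
      using pmf_mixture_pos[of Q x P y] by (auto simp: pmf_positive_iff set_pmf_iff q_def)
    have "ln (pmf (P x) y / q y) \<le> pmf (P x) y / q y - 1"
      using pos by (intro ln_le_minus_one) simp
    also have "\<dots> \<le> pmf (P x) y / q y" by simp
    also have "\<dots> \<le> 1 / q y" using pos pmf_le_1[of "P x" y] by (intro divide_right_mono) auto
    finally have "log 2 (pmf (P x) y / q y) \<le> 1 / q y / ln 2"
      by (simp add: log_def field_simps)
    then have "(pmf Q x * pmf (P x) y) * log 2 (pmf (P x) y / q y) \<le> (pmf Q x * pmf (P x) y) * (1 / q y / ln 2)"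
      using pos by (intro mult_left_mono) auto
    then show ?thesis by simp
  qed auto
  then have "mutual_info Q P \<le> (\<Sum>x\<in>UNIV. \<Sum>y\<in>UNIV. pmf Q x * pmf (P x) y / q y / ln 2)"
    unfolding mutual_info_def q_def[symmetric] by (intro sum_mono) auto
  also have "\<dots> = (\<Sum>y\<in>UNIV. q y / q y / ln 2)"
    unfolding q_def sum_divide_distrib by (subst sum.swap) simp
  also have "\<dots> \<le> (\<Sum>y\<in>(UNIV :: 'y set). 1 / ln 2)"
    by (intro sum_mono) auto
  finally show ?thesis by simp
qed

lemma mutual_info_le_capacity: "mutual_info Q P \<le> capacity P"
  for P :: "'x::finite \<Rightarrow> 'y::finite pmf"
  unfolding capacity_eq_SUP
  by (intro cSUP_upper bdd_aboveI2[of _ _ "real CARD('y) / ln 2"] mutual_info_le) auto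

lemma kl_div_le_C1: "kl_div (P x) (P x') \<le> C1 P"
  unfolding C1_def by (intro Max_ge) (auto intro!: image_eqI[of _ _ "(x, x')"])

lemma C1_attained: "\<exists>x x'. C1 P = kl_div (P x) (P x')"
proof -
  have "C1 P \<in> (\<lambda>(x, x'). kl_div (P x) (P x')) ` UNIV"
    unfolding C1_def by (intro Max_in) auto
  then show ?thesis by auto
qed

lemma set_pmf_eq_of_finite_C1:
  fixes P :: "'x::finite \<Rightarrow> 'y::finite pmf"
  assumes "C1 P = ereal c"
  shows "set_pmf (P x) = set_pmf (P x')"
proof -
  have "set_pmf (P x) \<subseteq> set_pmf (P x')" for x x'
    using kl_div_le_C1[of P x x'] assms by (auto simp: kl_div_eq_sum split: if_splits)
  then show ?thesis by blast
qed

lemma kl_div_sum_le_C1: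
  fixes P :: "'x::finite \<Rightarrow> 'y::finite pmf"
  assumes "C1 P = ereal c"
  shows "(\<Sum>y\<in>UNIV. pmf (P x) y * log 2 (pmf (P x) y / pmf (P x') y)) \<le> c"
  using kl_div_le_C1[of P x x'] set_pmf_eq_of_finite_C1[OF assms, of x x'] assms
  by (simp add: kl_div_eq_sum)

text \<open>
  Joint convexity of the divergence: the difference of the two sides is an average of
  \<open>- log (P_j p / (P_i q))\<close>, to which \<open>- ln z \<ge> 1 - z\<close> applies.
\<close>
lemma mixture_divergence_le_C1:
  fixes P :: "'x::finite \<Rightarrow> 'y::finite pmf" and a b :: "'i \<Rightarrow> real" and X :: "'i \<Rightarrow> 'x"
  assumes C1: "C1 P = ereal c" and I: "finite I" and J: "finite J"
    and a: "\<And>i. i \<in> I \<Longrightarrow> 0 \<le> a i" "(\<Sum>i\<in>I. a i) = 1"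
    and b: "\<And>j. j \<in> J \<Longrightarrow> 0 \<le> b j" "(\<Sum>j\<in>J. b j) = 1"
  defines "p \<equiv> \<lambda>y. \<Sum>i\<in>I. a i * pmf (P (X i)) y" and "q \<equiv> \<lambda>y. \<Sum>j\<in>J. b j * pmf (P (X j)) y"
  shows "(\<Sum>y\<in>UNIV. p y * log 2 (p y / q y)) \<le> c"
proof -
  let ?f = "\<lambda>i. pmf (P (X i))"
  define S where "S = set_pmf (P undefined)"
  \<comment> \<open>A finite \<open>C1\<close> forces a common support on all output laws, so every
    ratio below has positive numerator and denominator on \<open>S\<close>.\<close>
  have S: "set_pmf (P x) = S" for x unfolding S_def by (rule set_pmf_eq_of_finite_C1[OF C1])
  have Ppos: "0 < pmf (P x) y" if "y \<in> S" for x y using that S[of x] by (simp add: pmf_positive_iff)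
  have P0: "pmf (P x) y = 0" if "y \<notin> S" for x y using that S[of x] by (simp add: pmf_eq_0_set_pmf)
  have pos: "0 < (\<Sum>i\<in>I. a i * ?f i y)"
    if asm: "y \<in> S" "finite I" "\<And>i. i \<in> I \<Longrightarrow> 0 \<le> a i" "(\<Sum>i\<in>I. a i) = 1" for y I and a :: "'i \<Rightarrow> real"
  proof -
    obtain i where i: "i \<in> I" "a i \<noteq> 0" using asm(4) by (metis sum.neutral zero_neq_one)
    have "0 < a i * ?f i y" using i asm(3)[of i] Ppos[OF asm(1)] by simp
    also have "\<dots> \<le> (\<Sum>i\<in>I. a i * ?f i y)"
      using asm i by (intro member_le_sum) auto
    finally show ?thesis .
  qed
  have p: "0 < p y" if "y \<in> S" for y unfolding p_def using that I a by (intro pos) auto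
  have q: "0 < q y" if "y \<in> S" for y unfolding q_def using that J b by (intro pos) auto
  have sump: "(\<Sum>y\<in>S. p y) = 1"
  proof -
    have "(\<Sum>y\<in>S. p y) = (\<Sum>y\<in>UNIV. p y)"
      by (intro sum.mono_neutral_left) (auto simp: p_def P0)
    also have "\<dots> = 1"
      unfolding p_def by (subst sum.swap) (simp add: a flip: sum_distrib_left)
    finally show ?thesis .
  qed
  let ?D = "\<lambda>i j y. ?f i y * log 2 (?f i y / ?f j y)"
  have key: "?f i y - p y * ?f j y / q y \<le>
      ln 2 * (?D i j y - ?f i y * log 2 (p y / q y))" if y: "y \<in> S" for i j y
  proof -
    note pp = Ppos[OF y, of "X i"] Ppos[OF y, of "X j"] p[OF y] q[OF y]
    let ?z = "(?f j y * p y) / (?f i y * q y)"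
    have "ln ?z \<le> ?z - 1" using pp by (intro ln_le_minus_one) simp
    then have "?f i y * ln ?z \<le> ?f i y * (?z - 1)"
      using pp by (intro mult_left_mono) auto
    moreover have "?f i y * (?z - 1) = p y * ?f j y / q y - ?f i y"
      using pp by (simp add: field_simps)
    moreover have "ln ?z = - ln 2 * (log 2 (?f i y / ?f j y) - log 2 (p y / q y))"
      using pp by (simp add: log_def ln_div ln_mult field_simps)
    ultimately have "?f i y * (- ln 2 * (log 2 (?f i y / ?f j y) - log 2 (p y / q y)))
        \<le> p y * ?f j y / q y - ?f i y" by simp
    then show ?thesis by (simp add: right_diff_distrib mult.left_commute)
  qed
  have ab: "(\<Sum>i\<in>I. \<Sum>j\<in>J. a i * b j * t) = t" for t :: real
    using a(2) b(2) by (simp flip: sum_distrib_left sum_distrib_right sum_product)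
  \<comment> \<open>Averaged with weights \<open>a i * b j\<close>, the left-hand sides of
    \<open>key\<close> cancel: the first terms average to \<open>p y\<close>, the second ones to
    \<open>p y * q y / q y\<close>.\<close>
  have "0 = (\<Sum>y\<in>S. p y - p y * q y / q y)"
    using q by (intro sum.neutral[symmetric]) force
  also have "\<dots> = (\<Sum>y\<in>S. \<Sum>i\<in>I. \<Sum>j\<in>J. a i * b j * (?f i y - p y * ?f j y / q y))"
  proof (intro sum.cong refl)
    fix y assume "y \<in> S"
    have py: "(\<Sum>i\<in>I. \<Sum>j\<in>J. a i * b j * ?f i y) = p y"
    proof -
      have "(\<Sum>i\<in>I. \<Sum>j\<in>J. a i * b j * ?f i y) = (\<Sum>i\<in>I. a i * ?f i y * (\<Sum>j\<in>J. b j))"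
        unfolding sum_distrib_left by (intro sum.cong refl) simp
      then show ?thesis by (simp add: p_def b(2))
    qed
    have qy: "q y = (\<Sum>j\<in>J. b j * ?f j y)" by (simp add: q_def)
    have "(\<Sum>i\<in>I. \<Sum>j\<in>J. a i * b j * (p y * ?f j y / q y)) =
        (\<Sum>i\<in>I. a i * (\<Sum>j\<in>J. b j * ?f j y) * (p y / q y))"
      by (simp add: sum_distrib_left sum_distrib_right ac_simps)
    then have "(\<Sum>i\<in>I. \<Sum>j\<in>J. a i * b j * (p y * ?f j y / q y)) = (\<Sum>i\<in>I. a i) * q y * (p y / q y)"
      unfolding sum_distrib_right qy[symmetric] .
    then have "(\<Sum>i\<in>I. \<Sum>j\<in>J. a i * b j * (p y * ?f j y / q y)) = p y * q y / q y"
      by (simp add: a(2))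
    with py show "p y - p y * q y / q y =
        (\<Sum>i\<in>I. \<Sum>j\<in>J. a i * b j * (?f i y - p y * ?f j y / q y))"
      by (simp add: right_diff_distrib sum_subtractf)
  qed
  also have "\<dots> \<le> (\<Sum>y\<in>S. \<Sum>i\<in>I. \<Sum>j\<in>J. a i * b j * (ln 2 * (?D i j y - ?f i y * log 2 (p y / q y))))"
    using key a(1) b(1) by (intro sum_mono mult_left_mono) auto
  also have "\<dots> = ln 2 * ((\<Sum>y\<in>S. \<Sum>i\<in>I. \<Sum>j\<in>J. a i * b j * ?D i j y) - (\<Sum>y\<in>S. p y * log 2 (p y / q y)))"
  proof -
    have "(\<Sum>i\<in>I. \<Sum>j\<in>J. a i * b j * (ln 2 * (?D i j y - ?f i y * log 2 (p y / q y)))) =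
      ln 2 * ((\<Sum>i\<in>I. \<Sum>j\<in>J. a i * b j * ?D i j y) - p y * log 2 (p y / q y))" for y
    proof -
      have "(\<Sum>i\<in>I. \<Sum>j\<in>J. a i * b j * (?f i y * log 2 (p y / q y))) =
          (\<Sum>i\<in>I. a i * ?f i y * (\<Sum>j\<in>J. b j) * log 2 (p y / q y))"
        by (simp add: sum_distrib_left sum_distrib_right ac_simps)
      also have "\<dots> = p y * log 2 (p y / q y)"
        by (simp add: b(2) p_def sum_distrib_right)
      finally have *: "(\<Sum>i\<in>I. \<Sum>j\<in>J. a i * b j * (?f i y * log 2 (p y / q y))) = p y * log 2 (p y / q y)" .
      have "(\<Sum>i\<in>I. \<Sum>j\<in>J. a i * b j * (ln 2 * (?D i j y - ?f i y * log 2 (p y / q y)))) =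
        ln 2 * (\<Sum>i\<in>I. \<Sum>j\<in>J. a i * b j * (?D i j y - ?f i y * log 2 (p y / q y)))"
        by (simp add: sum_distrib_left ac_simps)
      also have "(\<Sum>i\<in>I. \<Sum>j\<in>J. a i * b j * (?D i j y - ?f i y * log 2 (p y / q y))) =
        (\<Sum>i\<in>I. \<Sum>j\<in>J. a i * b j * ?D i j y) - p y * log 2 (p y / q y)"
        by (simp only: right_diff_distrib sum_subtractf *)
      finally show ?thesis .
    qed
    then show ?thesis by (simp add: sum_subtractf flip: sum_distrib_left)
  qed
  finally have "(\<Sum>y\<in>S. p y * log 2 (p y / q y)) \<le> (\<Sum>y\<in>S. \<Sum>i\<in>I. \<Sum>j\<in>J. a i * b j * ?D i j y)"
    by (simp add: zero_le_mult_iff)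
  also have "\<dots> = (\<Sum>i\<in>I. \<Sum>j\<in>J. a i * b j * (\<Sum>y\<in>S. ?D i j y))"
    by (simp add: sum_distrib_left sum.swap[of _ _ S])
  also have "\<dots> \<le> (\<Sum>i\<in>I. \<Sum>j\<in>J. a i * b j * c)"
  proof (intro sum_mono mult_left_mono)
    fix i j
    have "(\<Sum>y\<in>S. ?D i j y) = (\<Sum>y\<in>UNIV. ?D i j y)"
      by (intro sum.mono_neutral_left) (auto simp: P0)
    also have "\<dots> \<le> c" by (rule kl_div_sum_le_C1[OF C1])
    finally show "(\<Sum>y\<in>S. ?D i j y) \<le> c" .
  qed (use a(1) b(1) in auto)
  also have "\<dots> = c" by (rule ab)
  also have "(\<Sum>y\<in>S. p y * log 2 (p y / q y)) = (\<Sum>y\<in>UNIV. p y * log 2 (p y / q y))"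
    by (intro sum.mono_neutral_left) (auto simp: p_def P0)
  finally show ?thesis .
qed

text \<open>Mutual information is the average over inputs of the divergence of \<open>P x\<close>
  from the output mixture, and each such divergence is covered by the mixture bound with a
  one-element first index set.\<close>

lemma capacity_le_C1:
  fixes P :: "'x::finite \<Rightarrow> 'y::finite pmf"
  assumes "C1 P = ereal c"
  shows "capacity P \<le> c"
  unfolding capacity_eq_SUP
proof (intro cSUP_least)
  fix Q :: "'x pmf"
  have "mutual_info Q P = (\<Sum>x\<in>UNIV. pmf Q x * (\<Sum>y\<in>UNIV. pmf (P x) y * log 2 (pmf (P x) y / (\<Sum>x'\<in>UNIV. pmf Q x' * pmf (P x') y))))"
    by (simp add: mutual_info_def sum_distrib_left mult.assoc)
  also have "\<dots> \<le> (\<Sum>x\<in>UNIV. pmf Q x * c)"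
  proof (intro sum_mono mult_left_mono)
    fix x :: 'x
    show "(\<Sum>y\<in>UNIV. pmf (P x) y * log 2 (pmf (P x) y / (\<Sum>x'\<in>UNIV. pmf Q x' * pmf (P x') y))) \<le> c"
      using mixture_divergence_le_C1[OF assms, of "{x}" UNIV "\<lambda>_. 1" "pmf Q" "\<lambda>x. x"] by simp
  qed simp
  also have "\<dots> = c" by (simp flip: sum_distrib_right)
  finally show "mutual_info Q P \<le> c" .
qed simp

section \<open>Gallager's function\<close>

text \<open>The summand of \<open>y\<close> has derivative \<open>q y * ln (q y) + h' y\<close>,
  with \<open>q\<close> the output law, and the sum of these is conditional minus output entropy, in
  natural units. Letters of probability zero are handled apart, because the power rule needs a
  positive base.\<close>

lemma E0_sum_has_derivative:
  fixes P :: "'x::finite \<Rightarrow> 'y::finite pmf"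
  shows "((\<lambda>\<rho>. \<Sum>y\<in>UNIV. (\<Sum>x\<in>UNIV. pmf Q x * pmf (P x) y powr (1 / (1 + \<rho>))) powr (1 + \<rho>))
           has_real_derivative - ln 2 * mutual_info Q P) (at 0)"
proof -
  define q where "q y = (\<Sum>x\<in>UNIV. pmf Q x * pmf (P x) y)" for y
  define h where "h y \<rho> = (\<Sum>x\<in>UNIV. pmf Q x * pmf (P x) y powr (1 / (1 + \<rho>)))" for y \<rho>
  define h' where "h' y = - (\<Sum>x\<in>UNIV. pmf Q x * pmf (P x) y * ln (pmf (P x) y))" for y
  have h0: "h y 0 = q y" for y by (simp add: h_def q_def)
  have dx: "((\<lambda>\<rho>. pmf Q x * pmf (P x) y powr (1 / (1 + \<rho>))) has_real_derivative
      - (pmf Q x * pmf (P x) y * ln (pmf (P x) y))) (at 0)" for x y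
  proof (cases "pmf (P x) y = 0")
    case False
    then have "0 < pmf (P x) y" by (simp add: pmf_positive_iff set_pmf_iff)
    moreover have "((\<lambda>\<rho>. 1 / (1 + \<rho>)) has_real_derivative - 1) (at (0 :: real))"
      by (auto intro!: derivative_eq_intros)
    ultimately have "((\<lambda>\<rho>. pmf (P x) y powr (1 / (1 + \<rho>))) has_real_derivative
        pmf (P x) y powr (1 / (1 + 0)) * (- 1 * ln (pmf (P x) y) + 0 * (1 / (1 + 0)) / pmf (P x) y)) (at 0)"
      by (intro DERIV_powr) auto
    from DERIV_cmult[OF this, of "pmf Q x"] show ?thesis by (simp add: mult.assoc)
  qed simp
  have dh: "(h y has_real_derivative h' y) (at 0)" for y
    unfolding h_def h'_def sum_negf[symmetric] by (intro DERIV_sum dx)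
  have "((\<lambda>\<rho>. h y \<rho> powr (1 + \<rho>)) has_real_derivative q y * ln (q y) + h' y) (at 0)" for y
  proof (cases "q y = 0")
    case True
    then have "pmf Q x * pmf (P x) y = 0" for x
      using sum_nonneg_eq_0_iff[of UNIV "\<lambda>x. pmf Q x * pmf (P x) y"] by (simp add: q_def)
    then have z: "pmf Q x = 0 \<or> pmf (P x) y = 0" for x by simp
    have "h y \<rho> = 0" for \<rho> unfolding h_def using z by (intro sum.neutral) fastforce
    moreover have "h' y = 0" unfolding h'_def using z by (simp add: sum.neutral)
    ultimately show ?thesis using True by simp
  next
    case False
    then have q: "0 < q y" by (simp add: q_def order.strict_iff_order sum_nonneg)
    have "((\<lambda>\<rho>. h y \<rho> powr (1 + \<rho>)) has_real_derivative
        h y 0 powr (1 + 0) * (1 * ln (h y 0) + h' y * (1 + 0) / h y 0)) (at 0)"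
      by (rule DERIV_powr) (use q in \<open>auto simp: h0 intro!: dh derivative_eq_intros\<close>)
    then show ?thesis using q by (simp add: h0 distrib_left)
  qed
  then have "((\<lambda>\<rho>. \<Sum>y\<in>UNIV. h y \<rho> powr (1 + \<rho>)) has_real_derivative (\<Sum>y\<in>UNIV. q y * ln (q y) + h' y)) (at 0)"
    by (intro DERIV_sum)
  moreover have "(\<Sum>y\<in>UNIV. q y * ln (q y) + h' y) = - ln 2 * mutual_info Q P"
  proof -
    have "ln 2 * mutual_info Q P = (\<Sum>y\<in>UNIV. \<Sum>x\<in>UNIV. pmf Q x * pmf (P x) y * (ln (pmf (P x) y) - ln (q y)))"
      unfolding mutual_info_def q_def[symmetric] sum_distrib_left
    proof (subst sum.swap, intro sum.cong refl)
      fix x y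
      show "ln 2 * (pmf Q x * pmf (P x) y * log 2 (pmf (P x) y / q y)) =
          pmf Q x * pmf (P x) y * (ln (pmf (P x) y) - ln (q y))"
      proof (cases "pmf Q x * pmf (P x) y = 0")
        case False
        then show ?thesis
          using pmf_mixture_pos[of Q x P y]
          by (simp add: q_def log_def ln_div pmf_positive_iff set_pmf_iff)
      qed auto
    qed
    also have "\<dots> = (\<Sum>y\<in>UNIV. - (q y * ln (q y) + h' y))"
      by (simp add: q_def h'_def right_diff_distrib sum_subtractf sum_distrib_right)
    finally show ?thesis unfolding sum_negf by simp
  qed
  ultimately show ?thesis
    by (simp add: h_def)
qed

lemma E0_0 [simp]: "E0 P 0 Q = 0" for P :: "'x::finite \<Rightarrow> 'y::finite pmf"
  by (simp add: E0_def sum_nonneg)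

lemma E0_has_derivative:
  fixes P :: "'x::finite \<Rightarrow> 'y::finite pmf"
  shows "((\<lambda>\<rho>. E0 P \<rho> Q) has_real_derivative mutual_info Q P) (at 0)"
proof -
  let ?F = "\<lambda>\<rho>. \<Sum>y\<in>UNIV. (\<Sum>x\<in>UNIV. pmf Q x * pmf (P x) y powr (1 / (1 + \<rho>))) powr (1 + \<rho>)"
  have F0: "?F 0 = 1" by (simp add: sum_nonneg)
  have "((\<lambda>\<rho>. log 2 (?F \<rho>)) has_real_derivative 1 / (ln 2 * ?F 0) * (- ln 2 * mutual_info Q P)) (at 0)"
    by (rule DERIV_chain2[OF DERIV_log E0_sum_has_derivative]) (rule E0_sum_pos)
  from DERIV_minus[OF this] show ?thesis
    unfolding F0 by (simp add: E0_def)
qed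

text \<open>Here capacity meets Gallager's function: it vanishes at \<rho> = 0 with slope
  \<open>mutual_info Q P\<close>, so for \<open>Q\<close> with mutual information above
  \<open>R\<close> a small positive \<open>\<rho>\<close> works.\<close>

lemma E0_exceeds:
  fixes P :: "'x::finite \<Rightarrow> 'y::finite pmf"
  assumes "R < capacity P"
  shows "\<exists>\<rho> Q. 0 \<le> \<rho> \<and> \<rho> \<le> 1 \<and> \<rho> * R < E0 P \<rho> Q"
proof -
  have "bdd_above (range (\<lambda>Q. mutual_info Q P))"
    by (intro bdd_aboveI2[of _ _ "capacity P"] mutual_info_le_capacity)
  then obtain Q where "R < mutual_info Q P"
    using assms less_cSUP_iff[of "UNIV :: 'x pmf set" "\<lambda>Q. mutual_info Q P" R]
    by (auto simp: capacity_eq_SUP)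
  moreover have "((\<lambda>\<rho>. E0 P \<rho> Q - \<rho> * R) has_real_derivative mutual_info Q P - R) (at 0)"
    by (auto intro!: derivative_eq_intros E0_has_derivative)
  ultimately obtain d where d: "0 < d" "\<And>h. 0 < h \<Longrightarrow> h < d \<Longrightarrow> 0 < E0 P h Q - h * R"
    using DERIV_pos_inc_right[of "\<lambda>\<rho>. E0 P \<rho> Q - \<rho> * R" "mutual_info Q P - R" 0] by auto
  then have "0 < E0 P (min (d / 2) 1) Q - min (d / 2) 1 * R"
    by (intro d) auto
  with d show ?thesis by (intro exI[of _ "min (d / 2) 1"] exI[of _ Q]) auto
qed

text \<open>Some output letter has probability at least \<open>1 / CARD('y)\<close>. Raising the
  channel probabilities to a power at most 1 only increases them, and the outer exponent is at most
  2. The bound makes the suprema in \<open>Er\<close> meaningful.\<close>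

lemma E0_le:
  fixes P :: "'x::finite \<Rightarrow> 'y::finite pmf"
  assumes "0 \<le> \<rho>" "\<rho> \<le> 1"
  shows "E0 P \<rho> Q \<le> 2 * log 2 (real CARD('y))"
proof -
  let ?q = "\<lambda>y. \<Sum>x\<in>UNIV. pmf Q x * pmf (P x) y"
  define s where "s = 1 / (1 + \<rho>)"
  have s: "s \<le> 1" using assms by (simp add: s_def)
  obtain y where y: "1 / real CARD('y) \<le> ?q y"
  proof (rule ccontr)
    assume "\<not> thesis"
    then have "?q y < 1 / real CARD('y)" for y using that[of y] by force
    then have "(\<Sum>y\<in>UNIV. ?q y) < (\<Sum>y\<in>(UNIV :: 'y set). 1 / real CARD('y))"
      by (intro sum_strict_mono) auto
    then show False by simp
  qed
  have card: "0 < real CARD('y)" by simp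
  have q1: "?q y \<le> 1"
    using sum_mono[of UNIV "\<lambda>x. pmf Q x * pmf (P x) y" "pmf Q"] by (simp add: mult_left_le pmf_le_1)
  have "real CARD('y) powr - 2 = (1 / real CARD('y)) powr 2"
    by (simp add: powr_minus_divide powr_divide)
  also have "\<dots> \<le> ?q y powr 2" using y by (intro powr_mono2) auto
  also have "\<dots> \<le> ?q y powr (1 + \<rho>)"
    using y q1 assms card by (intro powr_mono') (auto intro: order_trans[OF _ y])
  also have "\<dots> \<le> (\<Sum>x\<in>UNIV. pmf Q x * pmf (P x) y powr s) powr (1 + \<rho>)"
  proof (intro powr_mono2 sum_mono mult_left_mono)
    fix x show "pmf (P x) y \<le> pmf (P x) y powr s"
      using powr_mono'[OF s, of "pmf (P x) y"] by (simp add: pmf_le_1)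
  qed (use assms in \<open>auto intro: sum_nonneg\<close>)
  also have "\<dots> \<le> (\<Sum>y\<in>UNIV. (\<Sum>x\<in>UNIV. pmf Q x * pmf (P x) y powr s) powr (1 + \<rho>))"
    by (intro member_le_sum) auto
  finally have "log 2 (real CARD('y) powr - 2) \<le> log 2 \<dots>"
    by (subst log_le_cancel_iff) (auto intro: E0_sum_pos)
  then show ?thesis by (simp add: E0_def s_def log_powr)
qed

text \<open>The two sides of the nested real suprema in \<open>Er\<close>, in the form of an upper
  bound for every pair and a witness pair for every smaller value. With them, attainment of the
  maximum never has to be shown.\<close>

lemma Er_bounds:
  fixes P :: "'x::finite \<Rightarrow> 'y::finite pmf"
  shows E0_le_Er: "0 \<le> \<rho> \<Longrightarrow> \<rho> \<le> 1 \<Longrightarrow> E0 P \<rho> Q - \<rho> * R \<le> Er P R"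
    and less_Er: "v < Er P R \<Longrightarrow> \<exists>\<rho> Q. 0 \<le> \<rho> \<and> \<rho> \<le> 1 \<and> v < E0 P \<rho> Q - \<rho> * R"
proof -
  let ?B = "2 * log 2 (real CARD('y)) + \<bar>R\<bar>"
  have le: "E0 P \<rho> Q - \<rho> * R \<le> ?B" if "\<rho> \<in> {0..1}" for \<rho> Q
  proof -
    have "\<bar>\<rho> * R\<bar> \<le> 1 * \<bar>R\<bar>" unfolding abs_mult using that by (intro mult_right_mono) auto
    then show ?thesis using E0_le[of \<rho> P Q] that by auto
  qed
  have bddQ: "bdd_above (range (\<lambda>Q. E0 P \<rho> Q - \<rho> * R))" if "\<rho> \<in> {0..1}" for \<rho>
    using le[OF that] by (intro bdd_aboveI2)
  have bdd: "bdd_above ((\<lambda>\<rho>. SUP Q. E0 P \<rho> Q - \<rho> * R) ` {0..1})"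
    using le by (intro bdd_aboveI2[of _ _ ?B] cSUP_least) auto
  show "E0 P \<rho> Q - \<rho> * R \<le> Er P R" if "0 \<le> \<rho>" "\<rho> \<le> 1"
  proof -
    have "E0 P \<rho> Q - \<rho> * R \<le> (SUP Q. E0 P \<rho> Q - \<rho> * R)"
      using that by (intro cSUP_upper bddQ) auto
    also have "\<dots> \<le> Er P R" unfolding Er_def using that by (intro cSUP_upper bdd) auto
    finally show ?thesis .
  qed
  assume "v < Er P R"
  then obtain \<rho> where \<rho>: "\<rho> \<in> {0..1}" "v < (SUP Q. E0 P \<rho> Q - \<rho> * R)"
    unfolding Er_def using bdd by (subst (asm) less_cSUP_iff) auto
  then obtain Q where "v < E0 P \<rho> Q - \<rho> * R"
    using bddQ[OF \<rho>(1)] by (subst (asm) less_cSUP_iff) auto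
  with \<rho> show "\<exists>\<rho> Q. 0 \<le> \<rho> \<and> \<rho> \<le> 1 \<and> v < E0 P \<rho> Q - \<rho> * R" by auto
qed

text \<open>Each of the functions \<open>E0 P \<rho> Q - \<rho> * R\<close> decreases in
  \<open>R\<close> at rate \<open>\<rho> \<le> 1\<close>, and this passes to their supremum.\<close>

lemma Er_lower_line:
  fixes P :: "'x::finite \<Rightarrow> 'y::finite pmf"
  assumes "0 \<le> R"
  shows "Er P 0 - R \<le> Er P R"
proof (rule ccontr)
  assume "\<not> ?thesis"
  then have "Er P R + R < Er P 0" by simp
  from less_Er[OF this] obtain \<rho> Q where *: "0 \<le> \<rho>" "\<rho> \<le> 1" "Er P R + R < E0 P \<rho> Q" by auto
  have "\<rho> * R \<le> R" using * assms by (simp add: mult_left_le_one_le)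
  with E0_le_Er[OF *(1,2), of P Q R] * show False by simp
qed

section \<open>Testing two inputs\<close>

text \<open>As a function of \<open>t\<close>, the sum equals at 0 the mass that \<open>p\<close>
  gives to the common support. If this is below 1 (infinite divergence), continuity suffices. If it
  is 1, the derivative at 0 is \<open>ln 2\<close> times \<open>c\<close> minus the divergence,
  which is negative.\<close>

lemma chernoff_exponent:
  fixes p q :: "'y::finite pmf"
  assumes "ereal c < kl_div p q"
  shows "\<exists>t. 0 < t \<and> t < 1 \<and> (\<Sum>y\<in>set_pmf p \<inter> set_pmf q. pmf p y powr (1 - t) * (2 powr c * pmf q y) powr t) < 1"
proof -
  define S where "S = set_pmf p \<inter> set_pmf q"
  define \<psi> where "\<psi> t = (\<Sum>y\<in>S. pmf p y powr (1 - t) * (2 powr c * pmf q y) powr t)" for t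
  define D where "D = (\<Sum>y\<in>S. pmf p y * (ln (2 powr c * pmf q y) - ln (pmf p y)))"
  have pos: "0 < pmf p y" "0 < pmf q y" if "y \<in> S" for y
    using that by (auto simp: S_def pmf_positive_iff)
  have d: "(\<psi> has_real_derivative D) (at 0)"
    unfolding \<psi>_def D_def
  proof (intro DERIV_sum)
    fix y assume "y \<in> S"
    then show "((\<lambda>t. pmf p y powr (1 - t) * (2 powr c * pmf q y) powr t) has_real_derivative
        pmf p y * (ln (2 powr c * pmf q y) - ln (pmf p y))) (at 0)"
      using pos[of y] by (auto intro!: derivative_eq_intros simp: algebra_simps)
  qed
  have psi0: "\<psi> 0 = (\<Sum>y\<in>S. pmf p y)"
    unfolding \<psi>_def by (intro sum.cong) (use pos in force)+
  have "\<psi> 0 \<le> (\<Sum>y\<in>UNIV. pmf p y)" unfolding psi0 by (intro sum_mono2) auto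
  then consider "\<psi> 0 < 1" | "\<psi> 0 = 1" by fastforce
  then have "\<exists>d>0. \<forall>t. 0 < t \<and> t < d \<longrightarrow> \<psi> t < 1"
  proof cases
    case 1
    have "isCont \<psi> 0" using d by (rule DERIV_isCont)
    then have "(\<psi> \<longlongrightarrow> \<psi> 0) (at 0)" by (simp add: isCont_def)
    then have "eventually (\<lambda>t. \<psi> t < 1) (at 0)" using 1 by (rule order_tendstoD)
    then show ?thesis
      unfolding eventually_at by (auto simp: dist_real_def)
  next
    case 2
    have sub: "set_pmf p \<subseteq> set_pmf q"
    proof (rule ccontr)
      assume "\<not> set_pmf p \<subseteq> set_pmf q"
      then obtain y where y: "y \<in> set_pmf p" "y \<notin> S" by (auto simp: S_def)
      have "(\<Sum>y\<in>S. pmf p y) < (\<Sum>y\<in>UNIV. pmf p y)"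
        using y by (intro sum_strict_mono2[of _ _ y]) (auto simp: pmf_positive_iff)
      with 2 show False by (simp add: psi0)
    qed
    then have S: "S = set_pmf p" by (auto simp: S_def)
    have "c < (\<Sum>a\<in>UNIV. pmf p a * log 2 (pmf p a / pmf q a))"
      using assms sub by (simp add: kl_div_eq_sum)
    also have "\<dots> = (\<Sum>a\<in>S. pmf p a * log 2 (pmf p a / pmf q a))"
      by (intro sum.mono_neutral_right) (auto simp: S pmf_eq_0_set_pmf)
    also have "\<dots> = (\<Sum>a\<in>S. pmf p a * (c - (ln (2 powr c * pmf q a) - ln (pmf p a)) / ln 2))"
    proof (intro sum.cong refl)
      fix a assume "a \<in> S"
      then show "pmf p a * log 2 (pmf p a / pmf q a) =
          pmf p a * (c - (ln (2 powr c * pmf q a) - ln (pmf p a)) / ln 2)"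
        using pos[of a] by (simp add: log_def ln_div ln_mult ln_powr field_simps)
    qed
    also have "\<dots> = c * (\<Sum>a\<in>S. pmf p a) - D / ln 2"
      by (simp add: D_def right_diff_distrib sum_subtractf sum_divide_distrib sum_distrib_left diff_divide_distrib ac_simps)
    finally have "D < 0" using 2 by (simp add: psi0 divide_less_0_iff)
    then obtain e where "0 < e" "\<And>h. 0 < h \<Longrightarrow> h < e \<Longrightarrow> \<psi> h < \<psi> 0"
      using DERIV_neg_dec_right[OF d] by auto
    then show ?thesis using 2 by auto
  qed
  then obtain d where "0 < d" "\<And>t. 0 < t \<Longrightarrow> t < d \<Longrightarrow> \<psi> t < 1" by blast
  then show ?thesis
    unfolding \<psi>_def S_def by (intro exI[of _ "min (d / 2) (1 / 2)"]) auto
qed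

text \<open>A likelihood ratio test with threshold \<open>2 powr (real n * c)\<close>. Acceptance
  under \<open>x'\<close> is bounded by a change of measure, rejection under \<open>x\<close> by the
  Chernoff sum, which is why \<open>c\<close> can be any real below \<open>C1 P\<close>, even if
  \<open>C1 P\<close> is infinite. The asymmetry is intended: rejections under \<open>x\<close> only
  have to become rare.\<close>

lemma stein_test:
  fixes P :: "'x::finite \<Rightarrow> 'y::finite pmf"
  assumes "ereal c < C1 P"
  shows "\<exists>x x' \<beta>. 0 \<le> \<beta> \<and> \<beta> < 1 \<and> (\<forall>n. \<exists>A.
      (\<Sum>ys\<in>words n - A. path_prob (\<lambda>_. P x) ys) \<le> \<beta> ^ n \<and>
      (\<Sum>ys\<in>words n \<inter> A. path_prob (\<lambda>_. P x') ys) \<le> 2 powr (- real n * c))"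
proof -
  obtain x x' where xx: "C1 P = kl_div (P x) (P x')" using C1_attained by blast
  let ?S = "set_pmf (P x) \<inter> set_pmf (P x')"
  from chernoff_exponent[OF assms[unfolded xx]] obtain t where t: "0 < t" "t < 1"
    and lt: "(\<Sum>y\<in>?S. pmf (P x) y powr (1 - t) * (2 powr c * pmf (P x') y) powr t) < 1" by blast
  define g where "g y = pmf (P x) y powr (1 - t) * (2 powr c * pmf (P x') y) powr t" for y
  define \<beta> where "\<beta> = (\<Sum>y\<in>UNIV. g y)"
  have \<beta>: "0 \<le> \<beta>" unfolding \<beta>_def by (intro sum_nonneg) (simp add: g_def)
  have "\<beta> = (\<Sum>y\<in>?S. g y)"
    unfolding \<beta>_def by (intro sum.mono_neutral_right) (auto simp: g_def set_pmf_iff)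
  then have \<beta>1: "\<beta> < 1" using lt by (simp add: g_def)
  let ?p = "path_prob (\<lambda>_. P x)" and ?q = "path_prob (\<lambda>_. P x')"
  have "\<exists>A. (\<Sum>ys\<in>words n - A. ?p ys) \<le> \<beta> ^ n \<and> (\<Sum>ys\<in>words n \<inter> A. ?q ys) \<le> 2 powr (- real n * c)" for n
  proof (intro exI conjI)
    let ?A = "{ys. 2 powr (real n * c) * ?q ys \<le> ?p ys}"
    have "?p ys \<le> (\<Prod>i<n. g (ys ! i))" if "ys \<in> words n - ?A" for ys
    proof -
      let ?r = "2 powr (real n * c) * ?q ys"
      have le: "?p ys \<le> ?r" and len: "length ys = n" using that by auto
      have "?p ys = ?p ys powr (1 - t) * ?p ys powr t"
        by (cases "?p ys = 0") (auto simp flip: powr_add)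
      also have "\<dots> \<le> ?p ys powr (1 - t) * ?r powr t"
        using le t by (intro mult_left_mono powr_mono2) auto
      also have "?r = (\<Prod>i<n. 2 powr c * pmf (P x') (ys ! i))"
        using len by (simp add: path_prob_def prod.distrib powr_powr mult.commute flip: powr_realpow)
      also have "?p ys powr (1 - t) * \<dots> powr t =
          (\<Prod>i<n. pmf (P x) (ys ! i) powr (1 - t)) * (\<Prod>i<n. (2 powr c * pmf (P x') (ys ! i)) powr t)"
        using len by (simp only: path_prob_def prod_powr_distrib)
      also have "\<dots> = (\<Prod>i<n. g (ys ! i))"
        by (simp only: g_def prod.distrib)
      finally show ?thesis .
    qed
    then have "(\<Sum>ys\<in>words n - ?A. ?p ys) \<le> (\<Sum>ys\<in>words n - ?A. \<Prod>i<n. g (ys ! i))"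
      by (intro sum_mono)
    also have "\<dots> \<le> (\<Sum>ys\<in>words n. \<Prod>i<n. g (ys ! i))"
      by (intro sum_mono2) (auto intro!: prod_nonneg simp: g_def)
    also have "\<dots> = \<beta> ^ n" by (simp add: sum_words_prod[of "\<lambda>_. g"] \<beta>_def)
    finally show "(\<Sum>ys\<in>words n - ?A. ?p ys) \<le> \<beta> ^ n" .
    have "(\<Sum>ys\<in>words n \<inter> ?A. ?q ys) \<le> (\<Sum>ys\<in>words n \<inter> ?A. 2 powr (- real n * c) * ?p ys)"
    proof (intro sum_mono)
      fix ys assume "ys \<in> words n \<inter> ?A"
      then have "2 powr (- real n * c) * (2 powr (real n * c) * ?q ys) \<le> 2 powr (- real n * c) * ?p ys"
        by (intro mult_left_mono) auto
      then show "?q ys \<le> 2 powr (- real n * c) * ?p ys"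
        by (simp flip: mult.assoc powr_add)
    qed
    also have "\<dots> \<le> (\<Sum>ys\<in>words n. 2 powr (- real n * c) * ?p ys)"
      by (intro sum_mono2) auto
    also have "\<dots> = 2 powr (- real n * c)" by (simp flip: sum_distrib_left)
    finally show "(\<Sum>ys\<in>words n \<inter> ?A. ?q ys) \<le> 2 powr (- real n * c)" .
  qed
  with \<beta> \<beta>1 show ?thesis by blast
qed

section \<open>The law of a transmission\<close>

lemma countable_UNIV_list: "countable (UNIV :: 'y::finite list set)"
  using countable_lists[of "UNIV :: 'y set"] by (simp add: countable_finite)

lemma length_past [simp]: "length (past y n) = n"
  by (simp add: past_def)

lemma nth_past [simp]: "i < n \<Longrightarrow> past y n ! i = y i"
  by (simp add: past_def)

lemma past_Suc: "past y (Suc n) = past y n @ [y n]"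
  by (simp add: past_def)

lemma past_eq_iff: "past y n = ys \<longleftrightarrow> length ys = n \<and> (\<forall>i<n. y i = ys ! i)"
  by (auto simp: past_def list_eq_iff_nth_eq)

lemma take_past: "m \<le> n \<Longrightarrow> take m (past y n) = past y m"
  by (simp add: past_def take_map)

lemma measurable_past [measurable]:
  "(\<lambda>y :: nat \<Rightarrow> 'y::finite. past y n) \<in> measurable (\<Pi>\<^sub>M i\<in>UNIV. count_space UNIV) (count_space UNIV)"
proof -
  have "{y \<in> space (\<Pi>\<^sub>M i\<in>UNIV. count_space (UNIV :: 'y set)). length ys = n \<and> (\<forall>i\<in>{..<n}. y i = ys ! i)}
      \<in> sets (\<Pi>\<^sub>M i\<in>UNIV. count_space UNIV)" for ys
    by measurable
  moreover have "(\<lambda>y. past y n) -` {ys} \<inter> space (\<Pi>\<^sub>M i\<in>UNIV. count_space (UNIV :: 'y set)) =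
      {y \<in> space (\<Pi>\<^sub>M i\<in>UNIV. count_space (UNIV :: 'y set)). length ys = n \<and> (\<forall>i\<in>{..<n}. y i = ys ! i)}" for ys
    by (auto simp: past_eq_iff)
  ultimately show ?thesis
    by (subst measurable_count_space_eq2_countable) (auto simp: countable_UNIV_list)
qed

lemma space_outcome_algebra: "space (outcome_algebra PU M) = space PU \<times> {1..M} \<times> UNIV"
  by (simp add: outcome_algebra_def space_pair_measure space_PiM)

lemma measurable_sender:
  "(\<lambda>(u, w, y). (u, w, past y n)) \<in>
     measurable (outcome_algebra PU M) (PU \<Otimes>\<^sub>M (count_space {1..M} \<Otimes>\<^sub>M count_space (UNIV :: 'y::finite list set)))"
  unfolding outcome_algebra_def by measurable

lemma measurable_receiver:
  "(\<lambda>(u, w, y). (u, past y n)) \<in>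
     measurable (outcome_algebra PU M) (PU \<Otimes>\<^sub>M count_space (UNIV :: 'y::finite list set))"
  unfolding outcome_algebra_def by measurable

lemma subalgebra_sender_info:
  fixes \<Omega> :: "('u, 'y::finite) outcome measure"
  assumes "sets \<Omega> = sets (outcome_algebra PU M)"
  shows "subalgebra \<Omega> (sender_info PU M \<Omega> n)"
proof -
  have "(\<lambda>(u, w, y). (u, w, past y n)) \<in>
     measurable \<Omega> (PU \<Otimes>\<^sub>M (count_space {1..M} \<Otimes>\<^sub>M count_space (UNIV :: 'y list set)))"
    using measurable_sender measurable_cong_sets[OF assms refl] by blast
  then show ?thesis
    unfolding subalgebra_def sender_info_def
    by (auto intro: sets_image_in_sets[THEN subsetD])
qed

lemma integrable_bounded_prob:
  fixes h :: "'a \<Rightarrow> real"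
  assumes "prob_space N" "h \<in> borel_measurable N" "\<And>x. x \<in> space N \<Longrightarrow> \<bar>h x\<bar> \<le> B"
  shows "integrable N h"
proof -
  interpret prob_space N by fact
  show ?thesis by (rule integrable_const_bound[of _ B]) (use assms in auto)
qed

lemma measurable_path_prob:
  assumes "\<And>ys. (\<lambda>u. k u ys) \<in> measurable N (count_space UNIV)"
  shows "(\<lambda>u. path_prob (\<lambda>zs. P (k u zs)) ys) \<in> borel_measurable N"
proof -
  have "(\<lambda>u. pmf (P (k u zs)) b) \<in> borel_measurable N" for zs b
    by (rule measurable_compose[OF assms[of zs], of "\<lambda>x. pmf (P x) b"]) simp
  then show ?thesis unfolding path_prob_def by (intro borel_measurable_prod) auto
qed

lemma path_prob_le_1: "path_prob k ys \<le> 1"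
  unfolding path_prob_def by (intro prod_le_1) (auto simp: pmf_le_1)

text \<open>Induction on the word from its end: conditioning on the information of the sender
  replaces the indicator of the last letter by its channel probability. For fixed \<open>w\<close>
  and past this is a function of \<open>u\<close> alone and is absorbed into the weight
  \<open>h\<close>, which is why an arbitrary bounded \<open>h\<close> is carried along.\<close>

lemma transmission_law_cylinder:
  fixes \<Omega> :: "('u, 'y::finite) outcome measure"
  assumes law: "transmission_law P PU M f \<Omega>" and PU: "prob_space PU"
    and f: "\<And>ys. (\<lambda>u. f u w ys) \<in> measurable PU (count_space UNIV)"
    and w: "w \<in> {1..M}" and h: "h \<in> borel_measurable PU" "\<And>u. \<bar>h u\<bar> \<le> B"
  shows "(\<integral>\<omega>. (case \<omega> of (u, w', y) \<Rightarrow> h u * of_bool (w' = w \<and> past y (length ys) = ys)) \<partial>\<Omega>) =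
    (\<integral>u. h u * (path_prob (\<lambda>zs. P (f u w zs)) ys / real M) \<partial>PU)"
  using h
proof (induction ys arbitrary: h B rule: rev_induct)
  case Nil
  have M: "1 \<le> M" using w by simp
  have sets: "sets \<Omega> = sets (outcome_algebra PU M)" using law by (simp add: transmission_law_def)
  interpret U: prob_space "uniform_count_measure {1..M}"
    using M by (intro prob_space_uniform_count_measure) auto
  interpret PU: prob_space PU by fact
  interpret pair_sigma_finite PU "uniform_count_measure {1..M}" ..
  interpret pair_prob_space PU "uniform_count_measure {1..M}" ..
  note [measurable] = Nil(1)
  have m: "(\<lambda>(u, w, y). (u, w)) \<in> measurable \<Omega> (PU \<Otimes>\<^sub>M count_space {1..M})"
    unfolding measurable_cong_sets[OF sets refl] outcome_algebra_def by measurable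
  have g: "(\<lambda>(u, w'). h u * of_bool (w' = w)) \<in> borel_measurable (PU \<Otimes>\<^sub>M count_space {1..M})"
    by measurable
  have "(\<integral>\<omega>. (case \<omega> of (u, w', y) \<Rightarrow> h u * of_bool (w' = w \<and> past y (length []) = [])) \<partial>\<Omega>) =
      (\<integral>\<omega>. (\<lambda>(u, w'). h u * of_bool (w' = w)) ((\<lambda>(u, w, y). (u, w)) \<omega>) \<partial>\<Omega>)"
    by (intro Bochner_Integration.integral_cong) (auto simp: past_def)
  also have "\<dots> = (\<integral>p. (\<lambda>(u, w'). h u * of_bool (w' = w)) p \<partial>distr \<Omega> (PU \<Otimes>\<^sub>M count_space {1..M}) (\<lambda>(u, w, y). (u, w)))"
    by (rule integral_distr[symmetric, OF m g])
  also have "\<dots> = (\<integral>p. (\<lambda>(u, w'). h u * of_bool (w' = w)) p \<partial>(PU \<Otimes>\<^sub>M uniform_count_measure {1..M}))"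
    using law by (simp add: transmission_law_def)
  also have "\<dots> = (\<integral>u. (\<integral>w'. h u * of_bool (w' = w) \<partial>uniform_count_measure {1..M}) \<partial>PU)"
  proof -
    have "sets (uniform_count_measure {1..M}) = sets (count_space {1..M})"
      by (simp add: sets_uniform_count_measure)
    then have "sets (PU \<Otimes>\<^sub>M uniform_count_measure {1..M}) = sets (PU \<Otimes>\<^sub>M count_space {1..M})"
      by (intro sets_pair_measure_cong) auto
    from measurable_cong_sets[OF this refl] have "(\<lambda>(u, w'). h u * of_bool (w' = w)) \<in> borel_measurable (PU \<Otimes>\<^sub>M uniform_count_measure {1..M})"
      using g by blast
    then have "integrable (PU \<Otimes>\<^sub>M uniform_count_measure {1..M}) (\<lambda>(u, w'). h u * of_bool (w' = w))"
      using Nil(2) order_trans[OF abs_ge_zero Nil(2)]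
      by (intro integrable_bounded_prob[of _ _ B] prob_space_axioms) (auto simp: abs_mult)
    from integral_fst'[OF this] show ?thesis by simp
  qed
  also have "\<dots> = (\<integral>u. h u * (1 / real M) \<partial>PU)"
  proof (intro Bochner_Integration.integral_cong refl)
    fix u
    have "(\<integral>w'. h u * of_bool (w' = w) \<partial>uniform_count_measure {1..M}) =
        (\<Sum>w'\<in>{1..M}. h u * of_bool (w' = w)) / real M"
      unfolding uniform_count_measure_def
      by (subst lebesgue_integral_point_measure_finite) (auto simp: sum_divide_distrib simp del: sum_of_bool_mult_eq sum_mult_of_bool_eq)
    also have "(\<Sum>w'\<in>{1..M}. h u * of_bool (w' = w)) = (\<Sum>w'\<in>{1..M}. if w' = w then h u else 0)"
      by (intro sum.cong) auto
    also have "\<dots> = h u" using w by simp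
    finally show "(\<integral>w'. h u * of_bool (w' = w) \<partial>uniform_count_measure {1..M}) = h u * (1 / real M)"
      by simp
  qed
  finally show ?case by simp
next
  case (snoc b ys)
  let ?n = "length ys"
  let ?F = "sender_info PU M \<Omega> ?n"
  have sets: "sets \<Omega> = sets (outcome_algebra PU M)" using law by (simp add: transmission_law_def)
  interpret \<Omega>: prob_space \<Omega> using law by (simp add: transmission_law_def)
  interpret finite_measure_subalgebra \<Omega> ?F
    by standard (rule subalgebra_sender_info[OF sets])
  note [measurable] = snoc(2)
  let ?c = "\<lambda>(u, w', y). h u * of_bool (w' = w \<and> past y ?n = ys)"
  let ?b = "indicator {(u' :: 'u, w' :: nat, y'). y' ?n = b} :: _ \<Rightarrow> real"
  have mF: "?c \<in> borel_measurable ?F"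
  proof -
    have "(\<lambda>(u, w', zs). h u * of_bool (w' = w \<and> zs = ys)) \<in>
        borel_measurable (PU \<Otimes>\<^sub>M (count_space {1..M} \<Otimes>\<^sub>M count_space UNIV))"
      by measurable
    moreover have "(\<lambda>(u, w, y). (u, w, past y ?n)) \<in> measurable ?F (PU \<Otimes>\<^sub>M (count_space {1..M} \<Otimes>\<^sub>M count_space UNIV))"
      unfolding sender_info_def
      by (rule measurable_vimage_algebra1)
       (use sets_eq_imp_space_eq[OF sets] in \<open>auto simp: space_outcome_algebra space_pair_measure\<close>)
    ultimately have "(\<lambda>(u, w', zs). h u * of_bool (w' = w \<and> zs = ys)) \<circ> (\<lambda>(u, w, y). (u, w, past y ?n)) \<in> borel_measurable ?F"
      by (rule measurable_comp[rotated])
    moreover have "(\<lambda>(u, w', zs). h u * of_bool (w' = w \<and> zs = ys)) \<circ> (\<lambda>(u, w, y). (u, w, past y ?n)) = ?c"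
      by (auto simp: fun_eq_iff)
    ultimately show ?thesis by simp
  qed
  have mb: "?b \<in> borel_measurable \<Omega>"
  proof -
    have "(\<lambda>(u, w, y). of_bool (y ?n = b) :: real) \<in> borel_measurable (outcome_algebra PU M)"
      unfolding outcome_algebra_def by measurable
    moreover have "(\<lambda>(u, w, y). of_bool (y ?n = b) :: real) = ?b"
      by (auto simp: fun_eq_iff indicator_def)
    ultimately show ?thesis unfolding measurable_cong_sets[OF sets refl] by simp
  qed
  have mc: "?c \<in> borel_measurable \<Omega>" by (rule measurable_from_subalg[OF subalg mF])
  have le: "\<bar>?c \<omega> * ?b \<omega>\<bar> \<le> B" for \<omega>
    using snoc(3) by (auto simp: indicator_def split: prod.split intro: order_trans[OF abs_ge_zero])
  have int: "integrable \<Omega> (\<lambda>\<omega>. ?c \<omega> * ?b \<omega>)"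
    using mc mb le by (intro integrable_bounded_prob[OF \<Omega>.prob_space_axioms]) auto
  have AE: "AE \<omega> in \<Omega>. real_cond_exp \<Omega> ?F ?b \<omega> = (case \<omega> of (u, w', y) \<Rightarrow> pmf (P (f u w' (past y ?n))) b)"
    using law by (auto simp: transmission_law_def case_prod_beta')
  have ci: "(\<integral>\<omega>. ?c \<omega> * ?b \<omega> \<partial>\<Omega>) = (\<integral>\<omega>. ?c \<omega> * real_cond_exp \<Omega> ?F ?b \<omega> \<partial>\<Omega>)"
    by (rule real_cond_exp_intg(2)[symmetric, OF int mF mb])
  let ?h' = "\<lambda>u. h u * pmf (P (f u w ys)) b"
  have pm [measurable]: "(\<lambda>u. pmf (P (f u w ys)) b) \<in> borel_measurable PU"
    by (rule measurable_compose[OF f, of "\<lambda>x. pmf (P x) b"]) simp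
  have "(\<integral>\<omega>. (case \<omega> of (u, w', y) \<Rightarrow> h u * of_bool (w' = w \<and> past y (length (ys @ [b])) = ys @ [b])) \<partial>\<Omega>) =
      (\<integral>\<omega>. ?c \<omega> * ?b \<omega> \<partial>\<Omega>)"
    by (intro Bochner_Integration.integral_cong) (auto simp: past_Suc indicator_def)
  also have "\<dots> = (\<integral>\<omega>. (case \<omega> of (u, w', y) \<Rightarrow> ?h' u * of_bool (w' = w \<and> past y ?n = ys)) \<partial>\<Omega>)"
    unfolding ci
  proof (rule integral_cong_AE)
    show "(\<lambda>\<omega>. ?c \<omega> * real_cond_exp \<Omega> ?F ?b \<omega>) \<in> borel_measurable \<Omega>"
      using mc by measurable
    show "(\<lambda>(u, w', y). ?h' u * of_bool (w' = w \<and> past y ?n = ys)) \<in> borel_measurable \<Omega>"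
      unfolding measurable_cong_sets[OF sets refl] outcome_algebra_def by measurable
    show "AE \<omega> in \<Omega>. ?c \<omega> * real_cond_exp \<Omega> ?F ?b \<omega> =
        (case \<omega> of (u, w', y) \<Rightarrow> ?h' u * of_bool (w' = w \<and> past y ?n = ys))"
      using AE by eventually_elim (auto split: prod.splits)
  qed
  also have "\<dots> = (\<integral>u. ?h' u * (path_prob (\<lambda>zs. P (f u w zs)) ys / real M) \<partial>PU)"
  proof (rule snoc.IH[of _ B])
    show "\<bar>?h' u\<bar> \<le> B" for u
    proof -
      have "\<bar>h u\<bar> * pmf (P (f u w ys)) b \<le> B * 1"
        using snoc(3)[of u] pmf_le_1 by (intro mult_mono) auto
      then show ?thesis by (simp add: abs_mult)
    qed
  qed measurable
  also have "\<dots> = (\<integral>u. h u * (path_prob (\<lambda>zs. P (f u w zs)) (ys @ [b]) / real M) \<partial>PU)"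
    by (simp add: path_prob_snoc mult.commute mult.left_commute)
  finally show ?case .
qed

text \<open>The bridge from the conditional description of \<open>\<Omega>\<close> to finite sums,
  applied to error events and truncated stopping times alike.\<close>

lemma transmission_law_expectation:
  fixes \<Omega> :: "('u, 'y::finite) outcome measure" and F :: "'u \<Rightarrow> nat \<Rightarrow> 'y list \<Rightarrow> real"
  assumes law: "transmission_law P PU M f \<Omega>" and PU: "prob_space PU"
    and f: "\<And>w ys. w \<in> {1..M} \<Longrightarrow> (\<lambda>u. f u w ys) \<in> measurable PU (count_space UNIV)"
    and F: "\<And>w ys. w \<in> {1..M} \<Longrightarrow> length ys = n \<Longrightarrow> (\<lambda>u. F u w ys) \<in> borel_measurable PU"
    and B: "\<And>u w ys. \<bar>F u w ys\<bar> \<le> B"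
  shows "(\<integral>\<omega>. (case \<omega> of (u, w, y) \<Rightarrow> F u w (past y n)) \<partial>\<Omega>) =
    (\<integral>u. (\<Sum>w=1..M. \<Sum>ys\<in>words n. F u w ys * path_prob (\<lambda>zs. P (f u w zs)) ys) / real M \<partial>PU)"
proof -
  have sets: "sets \<Omega> = sets (outcome_algebra PU M)" using law by (simp add: transmission_law_def)
  have sp: "space \<Omega> = space PU \<times> {1..M} \<times> UNIV"
    using sets_eq_imp_space_eq[OF sets] by (simp add: space_outcome_algebra)
  interpret \<Omega>: prob_space \<Omega> using law by (simp add: transmission_law_def)
  interpret PU: prob_space PU by fact
  let ?i = "\<lambda>w ys (u, w', y). F u w ys * of_bool (w' = w \<and> past y (length ys) = ys)"
  have "(\<integral>\<omega>. (case \<omega> of (u, w, y) \<Rightarrow> F u w (past y n)) \<partial>\<Omega>) =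
      (\<integral>\<omega>. (\<Sum>w=1..M. \<Sum>ys\<in>words n. ?i w ys \<omega>) \<partial>\<Omega>)"
  proof (intro Bochner_Integration.integral_cong refl)
    fix \<omega> assume "\<omega> \<in> space \<Omega>"
    then obtain u w y where \<omega>: "\<omega> = (u, w, y)" "w \<in> {1..M}" by (auto simp: sp)
    have "(\<Sum>w'=1..M. \<Sum>ys\<in>words n. ?i w' ys \<omega>) =
        (\<Sum>w'=1..M. \<Sum>ys\<in>words n. if ys = past y n then (if w' = w then F u w (past y n) else 0) else 0)"
      using \<omega> by (intro sum.cong refl) auto
    also have "\<dots> = F u w (past y n)" using \<omega>(2) by simp
    finally show "(case \<omega> of (u, w, y) \<Rightarrow> F u w (past y n)) = (\<Sum>w'=1..M. \<Sum>ys\<in>words n. ?i w' ys \<omega>)"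
      by (simp add: \<omega>)
  qed
  also have "\<dots> = (\<Sum>w=1..M. \<Sum>ys\<in>words n. \<integral>\<omega>. ?i w ys \<omega> \<partial>\<Omega>)"
  proof -
    have "integrable \<Omega> (?i w ys)" if "w \<in> {1..M}" "ys \<in> words n" for w ys
    proof (rule integrable_bounded_prob[OF \<Omega>.prob_space_axioms, of _ B])
      have [measurable]: "(\<lambda>u. F u w ys) \<in> borel_measurable PU" using F that by simp
      show "?i w ys \<in> borel_measurable \<Omega>"
        unfolding measurable_cong_sets[OF sets refl] outcome_algebra_def using that by measurable
      show "\<bar>?i w ys \<omega>\<bar> \<le> B" for \<omega>
        using B by (auto split: prod.split intro: order_trans[OF abs_ge_zero])
    qed
    note int = this
    have "(\<integral>\<omega>. (\<Sum>w=1..M. \<Sum>ys\<in>words n. ?i w ys \<omega>) \<partial>\<Omega>) =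
        (\<Sum>w=1..M. \<integral>\<omega>. (\<Sum>ys\<in>words n. ?i w ys \<omega>) \<partial>\<Omega>)"
      by (rule Bochner_Integration.integral_sum) (rule Bochner_Integration.integrable_sum, rule int)
    also have "\<dots> = (\<Sum>w=1..M. \<Sum>ys\<in>words n. \<integral>\<omega>. ?i w ys \<omega> \<partial>\<Omega>)"
      by (intro sum.cong refl Bochner_Integration.integral_sum int)
    finally show ?thesis .
  qed
  also have "\<dots> = (\<Sum>w=1..M. \<Sum>ys\<in>words n. \<integral>u. F u w ys * (path_prob (\<lambda>zs. P (f u w zs)) ys / real M) \<partial>PU)"
    by (intro sum.cong refl transmission_law_cylinder[OF law PU f _ F B]) auto
  also have "\<dots> = (\<integral>u. (\<Sum>w=1..M. \<Sum>ys\<in>words n. F u w ys * (path_prob (\<lambda>zs. P (f u w zs)) ys / real M)) \<partial>PU)"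
  proof -
    have "integrable PU (\<lambda>u. F u w ys * (path_prob (\<lambda>zs. P (f u w zs)) ys / real M))"
      if "w \<in> {1..M}" "ys \<in> words n" for w ys
    proof (rule integrable_bounded_prob[OF PU, of _ B])
      have [measurable]: "(\<lambda>u. F u w ys) \<in> borel_measurable PU" using F that by simp
      note [measurable] = measurable_path_prob[OF f[OF that(1)], where P = P and ys = ys]
      show "(\<lambda>u. F u w ys * (path_prob (\<lambda>zs. P (f u w zs)) ys / real M)) \<in> borel_measurable PU"
        using that by measurable
      fix u
      have "\<bar>F u w ys\<bar> * (path_prob (\<lambda>zs. P (f u w zs)) ys / real M) \<le> B * 1"
      proof (intro mult_mono B)
        show "path_prob (\<lambda>zs. P (f u w zs)) ys / real M \<le> 1"
          using that by (simp add: divide_le_eq_1 order_trans[OF path_prob_le_1])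
      qed (use B[of u w ys] in auto)
      then show "\<bar>F u w ys * (path_prob (\<lambda>zs. P (f u w zs)) ys / real M)\<bar> \<le> B"
        by (simp add: abs_mult)
    qed
    note int = this
    let ?j = "\<lambda>w ys u. F u w ys * (path_prob (\<lambda>zs. P (f u w zs)) ys / real M)"
    have "(\<integral>u. (\<Sum>w=1..M. \<Sum>ys\<in>words n. ?j w ys u) \<partial>PU) =
        (\<Sum>w=1..M. \<integral>u. (\<Sum>ys\<in>words n. ?j w ys u) \<partial>PU)"
      by (rule Bochner_Integration.integral_sum) (rule Bochner_Integration.integrable_sum, rule int)
    also have "\<dots> = (\<Sum>w=1..M. \<Sum>ys\<in>words n. \<integral>u. ?j w ys u \<partial>PU)"
      by (intro sum.cong refl Bochner_Integration.integral_sum int)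
    finally show ?thesis by simp
  qed
  finally show ?thesis by (simp add: sum_divide_distrib)
qed

text \<open>
  Outputs driven by independent noise: \<open>z n x\<close> is the output that the channel would produce at
  time \<open>n\<close> for the input \<open>x\<close>, and \<open>e\<close> computes the input from the past outputs.
\<close>
primrec outputs :: "('y list \<Rightarrow> 'x) \<Rightarrow> (nat \<Rightarrow> 'x \<Rightarrow> 'y) \<Rightarrow> nat \<Rightarrow> 'y list" where
  "outputs e z 0 = []"
| "outputs e z (Suc n) = outputs e z n @ [z n (e (outputs e z n))]"

lemma length_outputs [simp]: "length (outputs e z n) = n"
  by (induction n) auto

lemma past_outputs: "past (\<lambda>n. z n (e (outputs e z n))) n = outputs e z n"
  by (induction n) (auto simp: past_def)

text \<open>Once the output word is prescribed, all inputs are known, so the recursively defined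
  event is a cylinder with one constraint on the noise at each time. Its probability is then a
  product.\<close>

lemma outputs_eq_iff: "outputs e z (length ys) = ys \<longleftrightarrow> (\<forall>i<length ys. z i (e (take i ys)) = ys ! i)"
proof (induction ys rule: rev_induct)
  case (snoc y ys)
  have "(\<forall>i<length (ys @ [y]). z i (e (take i (ys @ [y]))) = (ys @ [y]) ! i) \<longleftrightarrow>
      (\<forall>i<length ys. z i (e (take i ys)) = ys ! i) \<and> z (length ys) (e ys) = y"
    by (auto simp: less_Suc_eq nth_append)
  also have "\<dots> \<longleftrightarrow> outputs e z (length ys) = ys \<and> z (length ys) (e ys) = y"
    using snoc by simp
  also have "\<dots> \<longleftrightarrow> outputs e z (length (ys @ [y])) = ys @ [y]" by auto
  finally show ?case by blast
qed simp

lemma outputs_cong: "(\<And>i. i < n \<Longrightarrow> z i = z' i) \<Longrightarrow> outputs e z n = outputs e z' n"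
  by (induction n) auto

text \<open>One channel use as a random function from inputs to outputs. Drawing the response to
  every input in advance makes the noise independent of the encoder and i.i.d. over time.\<close>

definition noise_pmf :: "('x::finite \<Rightarrow> 'y pmf) \<Rightarrow> ('x \<Rightarrow> 'y) pmf" where
  "noise_pmf P = Pi_pmf UNIV undefined P"

lemma prob_noise_pmf: "measure (measure_pmf (noise_pmf P)) {z. z x = y} = pmf (P x) y"
proof -
  have "map_pmf (\<lambda>z. z x) (noise_pmf P) = P x"
    unfolding noise_pmf_def by (subst Pi_pmf_component) auto
  then have "pmf (P x) y = pmf (map_pmf (\<lambda>z. z x) (noise_pmf P)) y" by simp
  then show ?thesis by (simp add: pmf_map vimage_def)
qed

abbreviation noise_space :: "('x::finite \<Rightarrow> 'y pmf) \<Rightarrow> (nat \<Rightarrow> 'x \<Rightarrow> 'y) measure" where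
  "noise_space P \<equiv> \<Pi>\<^sub>M i\<in>UNIV. measure_pmf (noise_pmf P)"

lemma measure_noise_outputs:
  fixes P :: "'x::finite \<Rightarrow> 'y::finite pmf"
  shows "emeasure (noise_space P) {z. outputs e z (length ys) = ys} = ennreal (path_prob (\<lambda>zs. P (e zs)) ys)"
proof -
  let ?X = "\<lambda>i. {z. z (e (take i ys)) = ys ! i}"
  have "{z. outputs e z (length ys) = ys} =
      prod_emb UNIV (\<lambda>_. measure_pmf (noise_pmf P)) {..<length ys} (Pi\<^sub>E {..<length ys} ?X)"
    unfolding outputs_eq_iff by (subst prod_emb_PiE) (auto simp: PiE_UNIV_domain Pi_iff if_split_mem2)
  then have "emeasure (noise_space P) {z. outputs e z (length ys) = ys} =
      (\<Prod>i<length ys. emeasure (measure_pmf (noise_pmf P)) (?X i))"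
    by (simp add: emeasure_PiM_emb measure_pmf.prob_space_axioms)
  also have "\<dots> = ennreal (path_prob (\<lambda>zs. P (e zs)) ys)"
    by (simp add: path_prob_def measure_pmf.emeasure_eq_measure prob_noise_pmf prod_ennreal)
  finally show ?thesis .
qed

lemma measurable_outputs:
  fixes P :: "'x::finite \<Rightarrow> 'y::finite pmf" and e :: "nat \<Rightarrow> 'y list \<Rightarrow> 'x"
  shows "(\<lambda>(w, z). outputs (e w) z n) \<in>
    measurable (count_space {1..M} \<Otimes>\<^sub>M noise_space P) (count_space UNIV)"
proof -
  have "sets (noise_space P) = sets (\<Pi>\<^sub>M i\<in>UNIV. count_space (UNIV :: ('x \<Rightarrow> 'y) set))"
    by (intro sets_PiM_cong) auto
  then have s: "sets (count_space {1..M} \<Otimes>\<^sub>M noise_space P) =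
      sets (count_space {1..M} \<Otimes>\<^sub>M (\<Pi>\<^sub>M i\<in>UNIV. count_space (UNIV :: ('x \<Rightarrow> 'y) set)))"
    by (intro sets_pair_measure_cong) auto
  have "(\<lambda>(w, z). (w, past z n)) \<in> measurable (count_space {1..M} \<Otimes>\<^sub>M noise_space P)
      (count_space {1..M} \<Otimes>\<^sub>M count_space (UNIV :: ('x \<Rightarrow> 'y) list set))"
    unfolding measurable_cong_sets[OF s refl] by measurable
  also have "count_space {1..M} \<Otimes>\<^sub>M count_space (UNIV :: ('x \<Rightarrow> 'y) list set) = count_space ({1..M} \<times> UNIV)"
    by (intro pair_measure_countable countable_UNIV_list) (simp add: countable_finite)
  finally have m: "(\<lambda>(w, z). (w, past z n)) \<in> measurable (count_space {1..M} \<Otimes>\<^sub>M noise_space P) (count_space ({1..M} \<times> UNIV))" .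
  have "(\<lambda>p. (\<lambda>(w, zs). outputs (e w) (\<lambda>i. zs ! i) n) ((\<lambda>(w, z). (w, past z n)) p)) \<in>
      measurable (count_space {1..M} \<Otimes>\<^sub>M noise_space P) (count_space UNIV)"
    by (rule measurable_compose[OF m]) simp
  moreover have "(\<lambda>p. (\<lambda>(w, zs). outputs (e w) (\<lambda>i. zs ! i) n) ((\<lambda>(w, z). (w, past z n)) p)) = (\<lambda>(w, z). outputs (e w) z n)"
    by (auto intro!: outputs_cong)
  ultimately show ?thesis by simp
qed

lemma noise_expectation:
  fixes P :: "'x::finite \<Rightarrow> 'y::finite pmf" and e :: "nat \<Rightarrow> 'y list \<Rightarrow> 'x" and F :: "nat \<Rightarrow> 'y list \<Rightarrow> real"
  assumes M: "1 \<le> M"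
  defines "D \<equiv> uniform_count_measure {1..M} \<Otimes>\<^sub>M noise_space P"
  shows "(\<integral>\<omega>. (case \<omega> of (w, z) \<Rightarrow> F w (outputs (e w) z n)) \<partial>D) =
    (\<Sum>w=1..M. \<Sum>ys\<in>words n. F w ys * path_prob (\<lambda>zs. P (e w zs)) ys) / real M"
proof -
  interpret U: prob_space "uniform_count_measure {1..M}"
    using M by (intro prob_space_uniform_count_measure) auto
  interpret Z: prob_space "noise_space P"
    by (intro prob_space_PiM measure_pmf.prob_space_axioms)
  interpret pair_sigma_finite "uniform_count_measure {1..M}" "noise_space P" ..
  interpret pair_prob_space "uniform_count_measure {1..M}" "noise_space P" ..
  have sets: "sets D = sets (count_space {1..M} \<Otimes>\<^sub>M noise_space P)"
    unfolding D_def by (intro sets_pair_measure_cong) (auto simp: sets_uniform_count_measure)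
  have sp: "space D = {1..M} \<times> UNIV"
    by (simp add: D_def space_pair_measure space_uniform_count_measure space_PiM)
  have m: "(\<lambda>(w, z). outputs (e w) z n) \<in> measurable D (count_space UNIV)"
    unfolding measurable_cong_sets[OF sets refl] by (rule measurable_outputs)
  have set: "{w} \<times> {z. outputs (e w) z n = ys} \<in> sets D" "measure D ({w} \<times> {z. outputs (e w) z n = ys}) = path_prob (\<lambda>zs. P (e w zs)) ys / real M"
    if w: "w \<in> {1..M}" and ys: "ys \<in> words n" for w ys
  proof -
    have m1: "(\<lambda>z. outputs (e w) z n) \<in> measurable (noise_space P) (count_space UNIV)"
      using measurable_compose[OF measurable_Pair1'[of w "count_space {1..M}" "noise_space P"] measurable_outputs[of e n M P]] w
      by simp
    then have s1: "{z. outputs (e w) z n = ys} \<in> sets (noise_space P)"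
      using measurable_sets[OF m1, of "{ys}"] by (simp add: vimage_def space_PiM)
    show "{w} \<times> {z. outputs (e w) z n = ys} \<in> sets D"
      unfolding sets using s1 w by (intro pair_measureI) auto
    have "emeasure D ({w} \<times> {z. outputs (e w) z n = ys}) =
        emeasure (uniform_count_measure {1..M}) {w} * emeasure (noise_space P) {z. outputs (e w) z n = ys}"
      unfolding D_def using s1 w by (intro Z.emeasure_pair_measure_Times) (auto simp: sets_uniform_count_measure)
    also have "\<dots> = ennreal (1 / real M) * ennreal (path_prob (\<lambda>zs. P (e w zs)) ys)"
      using w ys measure_noise_outputs[of P "e w" ys] M
      by (subst emeasure_uniform_count_measure) (auto simp: divide_ennreal)
    also have "\<dots> = ennreal (path_prob (\<lambda>zs. P (e w zs)) ys / real M)"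
      by (simp flip: ennreal_mult)
    finally show "measure D ({w} \<times> {z. outputs (e w) z n = ys}) = path_prob (\<lambda>zs. P (e w zs)) ys / real M"
      by (simp add: measure_def)
  qed
  let ?i = "\<lambda>w ys. indicator ({w} \<times> {z. outputs (e w) z n = ys}) :: _ \<Rightarrow> real"
  have "(\<integral>\<omega>. (case \<omega> of (w, z) \<Rightarrow> F w (outputs (e w) z n)) \<partial>D) =
      (\<integral>\<omega>. (\<Sum>w=1..M. \<Sum>ys\<in>words n. F w ys * ?i w ys \<omega>) \<partial>D)"
  proof (intro Bochner_Integration.integral_cong refl)
    fix \<omega> assume "\<omega> \<in> space D"
    then obtain w z where \<omega>: "\<omega> = (w, z)" "w \<in> {1..M}" by (auto simp: sp)
    have "(\<Sum>w'=1..M. \<Sum>ys\<in>words n. F w' ys * ?i w' ys \<omega>) =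
        (\<Sum>w'=1..M. \<Sum>ys\<in>words n. if ys = outputs (e w) z n then (if w' = w then F w (outputs (e w) z n) else 0) else 0)"
      using \<omega> by (intro sum.cong refl) (auto simp: indicator_def)
    also have "\<dots> = F w (outputs (e w) z n)" using \<omega>(2) by simp
    finally show "(case \<omega> of (w, z) \<Rightarrow> F w (outputs (e w) z n)) = (\<Sum>w'=1..M. \<Sum>ys\<in>words n. F w' ys * ?i w' ys \<omega>)"
      by (simp add: \<omega>)
  qed
  also have "\<dots> = (\<Sum>w=1..M. \<Sum>ys\<in>words n. \<integral>\<omega>. F w ys * ?i w ys \<omega> \<partial>D)"
  proof -
    have int: "integrable D (\<lambda>\<omega>. F w ys * ?i w ys \<omega>)" if "w \<in> {1..M}" "ys \<in> words n" for w ys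
      using set(1)[OF that] emeasure_finite unfolding D_def
      by (intro integrable_mult_right integrable_real_indicator) (auto simp: less_top[symmetric])
    have "(\<integral>\<omega>. (\<Sum>w=1..M. \<Sum>ys\<in>words n. F w ys * ?i w ys \<omega>) \<partial>D) =
        (\<Sum>w=1..M. \<integral>\<omega>. (\<Sum>ys\<in>words n. F w ys * ?i w ys \<omega>) \<partial>D)"
      by (rule Bochner_Integration.integral_sum) (rule Bochner_Integration.integrable_sum, rule int)
    also have "\<dots> = (\<Sum>w=1..M. \<Sum>ys\<in>words n. \<integral>\<omega>. F w ys * ?i w ys \<omega> \<partial>D)"
      by (intro sum.cong refl Bochner_Integration.integral_sum int)
    finally show ?thesis .
  qed
  also have "\<dots> = (\<Sum>w=1..M. \<Sum>ys\<in>words n. F w ys * (path_prob (\<lambda>zs. P (e w zs)) ys / real M))"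
  proof (intro sum.cong refl)
    fix w and ys :: "'y list" assume "w \<in> {1..M}" "ys \<in> words n"
    note s = set[OF this]
    have "(\<integral>\<omega>. F w ys * ?i w ys \<omega> \<partial>D) = F w ys * measure D ({w} \<times> {z. outputs (e w) z n = ys} \<inter> space D)"
      by simp
    also have "{w} \<times> {z. outputs (e w) z n = ys} \<inter> space D = {w} \<times> {z. outputs (e w) z n = ys}"
      using \<open>w \<in> {1..M}\<close> by (auto simp: sp)
    finally show "(\<integral>\<omega>. F w ys * ?i w ys \<omega> \<partial>D) = F w ys * (path_prob (\<lambda>zs. P (e w zs)) ys / real M)"
      by (simp add: s)
  qed
  finally show ?thesis by (simp add: sum_divide_distrib)
qed

text \<open>The schemes constructed below are deterministic, so the common randomness is a point
  mass. The law is the image under \<open>\<phi>\<close> of a uniform message with independent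
  noise. Its conditional probabilities are verified on sets of the sender's information, where both
  integrals become finite sums over words that agree by \<open>path_prob_snoc\<close>.\<close>

lemma transmission_law_exists:
  fixes P :: "'x::finite \<Rightarrow> 'y::finite pmf" and e :: "nat \<Rightarrow> 'y list \<Rightarrow> 'x" and u0 :: 'u
  assumes M: "1 \<le> M"
  shows "\<exists>\<Omega>. transmission_law P (measure_pmf (return_pmf u0)) M (\<lambda>_. e) \<Omega>"
proof -
  define PU where "PU = measure_pmf (return_pmf u0)"
  define U where "U = uniform_count_measure {1..M}"
  define D where "D = U \<Otimes>\<^sub>M noise_space P"
  interpret U: prob_space U
    unfolding U_def using M by (intro prob_space_uniform_count_measure) auto
  interpret Z: prob_space "noise_space P"
    by (intro prob_space_PiM measure_pmf.prob_space_axioms)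
  interpret UZ: pair_prob_space U "noise_space P" ..
  interpret D: prob_space D unfolding D_def by (rule UZ.prob_space_axioms)
  interpret PU: prob_space PU unfolding PU_def by (rule measure_pmf.prob_space_axioms)
  interpret PUU: pair_prob_space PU U ..
  have setsU: "sets U = sets (count_space {1..M})" by (simp add: U_def sets_uniform_count_measure)
  have sets: "sets D = sets (count_space {1..M} \<Otimes>\<^sub>M noise_space P)"
    unfolding D_def by (intro sets_pair_measure_cong) (auto simp: setsU)
  have sp: "space D = {1..M} \<times> UNIV"
    by (simp add: D_def U_def space_pair_measure space_uniform_count_measure space_PiM)
  define \<phi> :: "nat \<times> (nat \<Rightarrow> 'x \<Rightarrow> 'y) \<Rightarrow> ('u, 'y) outcome"
    where "\<phi> = (\<lambda>(w, z). (u0, w, \<lambda>n. z n (e w (outputs (e w) z n))))"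
  have mo: "(\<lambda>(w, z). outputs (e w) z n) \<in> measurable D (count_space UNIV)" for n
    unfolding measurable_cong_sets[OF sets refl] by (rule measurable_outputs)
  have m\<phi>: "\<phi> \<in> measurable D (outcome_algebra PU M)"
  proof -
    have "(\<lambda>p. last ((\<lambda>(w, z). outputs (e w) z (Suc n)) p)) \<in> measurable D (count_space UNIV)" for n
      by (rule measurable_compose[OF mo]) simp
    moreover have "(\<lambda>p. last ((\<lambda>(w, z). outputs (e w) z (Suc n)) p)) = (\<lambda>p. snd (snd (\<phi> p)) n)" for n
      by (auto simp: \<phi>_def)
    ultimately have "(\<lambda>p. snd (snd (\<phi> p)) n) \<in> measurable D (count_space UNIV)" for n by simp
    then have "(\<lambda>p. \<lambda>n. snd (snd (\<phi> p)) n) \<in> measurable D (\<Pi>\<^sub>M i\<in>UNIV. count_space UNIV)"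
      by (intro measurable_PiM_single') auto
    moreover have "fst \<in> measurable D (count_space {1..M})"
      unfolding measurable_cong_sets[OF sets refl] by simp
    ultimately have "(\<lambda>p. (u0, fst p, (\<lambda>n. snd (snd (\<phi> p)) n))) \<in> measurable D (outcome_algebra PU M)"
      unfolding outcome_algebra_def PU_def by (intro measurable_Pair) auto
    moreover have "(\<lambda>p. (u0, fst p, (\<lambda>n. snd (snd (\<phi> p)) n))) = \<phi>" by (auto simp: \<phi>_def)
    ultimately show ?thesis by simp
  qed
  define \<Omega> where "\<Omega> = distr D (outcome_algebra PU M) \<phi>"
  have sets\<Omega>: "sets \<Omega> = sets (outcome_algebra PU M)" by (simp add: \<Omega>_def)
  have sp\<Omega>: "space \<Omega> = UNIV \<times> {1..M} \<times> UNIV" by (simp add: \<Omega>_def space_outcome_algebra PU_def)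
  interpret \<Omega>: prob_space \<Omega> unfolding \<Omega>_def by (rule D.prob_space_distr[OF m\<phi>])
  have "distr \<Omega> (PU \<Otimes>\<^sub>M count_space {1..M}) (\<lambda>(u, w, y). (u, w)) = PU \<Otimes>\<^sub>M U"
  proof (rule measure_eqI)
    have "sets (PU \<Otimes>\<^sub>M count_space {1..M}) = sets (PU \<Otimes>\<^sub>M U)"
      by (intro sets_pair_measure_cong setsU[symmetric] refl)
    then show s: "sets (distr \<Omega> (PU \<Otimes>\<^sub>M count_space {1..M}) (\<lambda>(u, w, y). (u, w))) = sets (PU \<Otimes>\<^sub>M U)"
      by (simp only: sets_distr)
    fix A assume A0: "A \<in> sets (distr \<Omega> (PU \<Otimes>\<^sub>M count_space {1..M}) (\<lambda>(u, w, y). (u, w)))"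
    then have A: "A \<in> sets (PU \<Otimes>\<^sub>M count_space {1..M})" by (simp only: sets_distr)
    have A': "A \<in> sets (PU \<Otimes>\<^sub>M U)" using A0 unfolding s .
    have m2: "(\<lambda>(u, w, y). (u, w)) \<in> measurable (outcome_algebra PU M) (PU \<Otimes>\<^sub>M count_space {1..M})"
      unfolding outcome_algebra_def by measurable
    have sub: "A \<subseteq> UNIV \<times> {1..M}" using sets.sets_into_space[OF A] by (simp add: space_pair_measure PU_def)
    let ?A = "Pair u0 -` A"
    have Au: "?A \<in> sets U" unfolding setsU using sub by auto
    have "emeasure (distr \<Omega> (PU \<Otimes>\<^sub>M count_space {1..M}) (\<lambda>(u, w, y). (u, w))) A =
        emeasure D (((\<lambda>(u, w, y). (u, w)) \<circ> \<phi>) -` A \<inter> space D)"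
      unfolding \<Omega>_def by (subst distr_distr[OF m2 m\<phi>], subst emeasure_distr) (use A measurable_comp[OF m\<phi> m2] in auto)
    also have "((\<lambda>(u, w, y). (u, w)) \<circ> \<phi>) -` A \<inter> space D = ?A \<times> space (noise_space P)"
      using sub by (auto simp: sp \<phi>_def space_PiM)
    also have "emeasure D \<dots> = emeasure U ?A * emeasure (noise_space P) (space (noise_space P))"
      unfolding D_def by (intro Z.emeasure_pair_measure_Times Au sets.top)
    also have "\<dots> = emeasure U ?A" by (simp add: Z.emeasure_space_1)
    also have "\<dots> = (\<integral>\<^sup>+u. emeasure U (Pair u -` A) \<partial>PU)"
      by (simp add: PU_def nn_integral_measure_pmf_finite)
    also have "\<dots> = emeasure (PU \<Otimes>\<^sub>M U) A" by (rule U.emeasure_pair_measure_alt[OF A', symmetric])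
    finally show "emeasure (distr \<Omega> (PU \<Otimes>\<^sub>M count_space {1..M}) (\<lambda>(u, w, y). (u, w))) A = emeasure (PU \<Otimes>\<^sub>M U) A" .
  qed
  moreover have "AE \<omega> in \<Omega>. real_cond_exp \<Omega> (sender_info PU M \<Omega> n) (indicator {(u', w', y'). y' n = b}) \<omega> =
      (case \<omega> of (u, w, y) \<Rightarrow> pmf (P (e w (past y n))) b)" for n b
  proof -
    let ?F = "sender_info PU M \<Omega> n"
    let ?b = "indicator {(u' :: 'u, w' :: nat, y' :: nat \<Rightarrow> 'y). y' n = b} :: _ \<Rightarrow> real"
    let ?g = "\<lambda>(u :: 'u, w, y). pmf (P (e w (past y n))) b"
    interpret finite_measure_subalgebra \<Omega> ?F
      by standard (rule subalgebra_sender_info[OF sets\<Omega>])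
    have snd: "(\<lambda>(u, w, y). (u, w, past y n)) \<in> measurable ?F (PU \<Otimes>\<^sub>M (count_space {1..M} \<Otimes>\<^sub>M count_space UNIV))"
      unfolding sender_info_def
      by (rule measurable_vimage_algebra1) (auto simp: sp\<Omega> space_pair_measure PU_def)
    have mg: "?g \<in> borel_measurable ?F"
    proof -
      have "(\<lambda>(u, w, zs). pmf (P (e w zs)) b) \<in> borel_measurable (PU \<Otimes>\<^sub>M (count_space {1..M} \<Otimes>\<^sub>M count_space UNIV))"
      proof -
        have "(\<lambda>(w, zs). pmf (P (e w zs)) b) \<in> borel_measurable (count_space {1..M} \<Otimes>\<^sub>M count_space (UNIV :: 'y list set))"
          by (subst pair_measure_countable) (auto simp: countable_UNIV_list countable_finite)
        from measurable_compose[OF measurable_snd this] show ?thesis by (simp add: case_prod_beta')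
      qed
      from measurable_compose[OF snd this] show ?thesis by (simp add: case_prod_beta')
    qed
    have mb: "?b \<in> borel_measurable \<Omega>"
    proof -
      have "(\<lambda>(u, w, y). of_bool (y n = b) :: real) \<in> borel_measurable (outcome_algebra PU M)"
        unfolding outcome_algebra_def by measurable
      moreover have "(\<lambda>(u, w, y). of_bool (y n = b) :: real) = ?b"
        by (auto simp: fun_eq_iff indicator_def)
      ultimately show ?thesis unfolding measurable_cong_sets[OF sets\<Omega> refl] by simp
    qed
    have mg': "?g \<in> borel_measurable \<Omega>" by (rule measurable_from_subalg[OF subalg mg])
    show ?thesis
    proof (rule real_cond_exp_charact)
      show "integrable \<Omega> ?b" by (rule integrable_bounded_prob[OF \<Omega>.prob_space_axioms mb, of 1]) (auto simp: indicator_def)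
      show "integrable \<Omega> ?g"
        by (rule integrable_bounded_prob[OF \<Omega>.prob_space_axioms mg', of 1]) (auto simp: pmf_le_1)
      show "?g \<in> borel_measurable ?F" by (rule mg)
      fix A assume "A \<in> sets ?F"
      moreover have "sets ?F = {(\<lambda>(u, w, y). (u, w, past y n)) -` B \<inter> space \<Omega> | B.
          B \<in> sets (PU \<Otimes>\<^sub>M (count_space {1..M} \<Otimes>\<^sub>M count_space UNIV))}"
        unfolding sender_info_def
        by (rule sets_vimage_algebra2) (auto simp: space_pair_measure sp\<Omega> PU_def)
      ultimately obtain B where A: "A = (\<lambda>(u, w, y). (u, w, past y n)) -` B \<inter> space \<Omega>"
        by blast
      have sA: "A \<in> sets \<Omega>" using \<open>A \<in> sets ?F\<close> subalg by (auto simp: subalgebra_def)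
      have mA: "(\<lambda>x. indicator A x *\<^sub>R h x) \<in> borel_measurable \<Omega>" if "h \<in> borel_measurable \<Omega>" for h :: "_ \<Rightarrow> real"
        using sA that by measurable
      have po: "past (\<lambda>n. z n (e w (outputs (e w) z n))) n = outputs (e w) z n" for w z
        by (rule past_outputs)
      let ?B = "\<lambda>w ys. of_bool ((u0, w, ys) \<in> B) :: real"
      have "set_lebesgue_integral \<Omega> A ?b = (\<integral>p. (indicator A (\<phi> p) *\<^sub>R ?b (\<phi> p)) \<partial>D)"
        unfolding set_lebesgue_integral_def \<Omega>_def
        by (rule integral_distr[OF m\<phi>]) (use mA[OF mb] in \<open>simp add: \<Omega>_def\<close>)
      \<comment> \<open>Outputs are indexed from 0: \<open>y n\<close> is the last letter of the
        word of length \<open>Suc n\<close>, and the past known to the sender is its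
        \<open>butlast\<close>.\<close>
      also have "\<dots> = (\<integral>p. (case p of (w, z) \<Rightarrow> (\<lambda>w ys. ?B w (butlast ys) * of_bool (last ys = b)) w (outputs (e w) z (Suc n))) \<partial>D)"
        by (intro Bochner_Integration.integral_cong refl)
          (auto simp: sp A \<phi>_def po indicator_def sp\<Omega>)
      also have "\<dots> = (\<Sum>w=1..M. \<Sum>ys\<in>words (Suc n). ?B w (butlast ys) * of_bool (last ys = b) * path_prob (\<lambda>zs. P (e w zs)) ys) / real M"
        unfolding D_def U_def by (rule noise_expectation[OF M])
      also have "\<dots> = (\<Sum>w=1..M. \<Sum>ys\<in>words n. (?B w ys * pmf (P (e w ys)) b) * path_prob (\<lambda>zs. P (e w zs)) ys) / real M"
        unfolding sum_words_Suc
      proof (intro arg_cong2[where f = "(/)"] sum.cong refl)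
        fix w ys
        have "(\<Sum>y\<in>UNIV. ?B w (butlast (ys @ [y])) * of_bool (last (ys @ [y]) = b) * path_prob (\<lambda>zs. P (e w zs)) (ys @ [y])) =
          (\<Sum>y\<in>UNIV. if y = b then ?B w ys * pmf (P (e w ys)) b * path_prob (\<lambda>zs. P (e w zs)) ys else 0)"
          by (intro sum.cong refl) (auto simp: path_prob_snoc)
        then show "(\<Sum>y\<in>UNIV. ?B w (butlast (ys @ [y])) * of_bool (last (ys @ [y]) = b) * path_prob (\<lambda>zs. P (e w zs)) (ys @ [y])) =
          ?B w ys * pmf (P (e w ys)) b * path_prob (\<lambda>zs. P (e w zs)) ys"
          by simp
      qed
      also have "\<dots> = (\<integral>p. (case p of (w, z) \<Rightarrow> (\<lambda>w ys. ?B w ys * pmf (P (e w ys)) b) w (outputs (e w) z n)) \<partial>D)"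
        unfolding D_def U_def by (rule noise_expectation[OF M, symmetric])
      also have "\<dots> = (\<integral>p. (indicator A (\<phi> p) *\<^sub>R ?g (\<phi> p)) \<partial>D)"
        by (intro Bochner_Integration.integral_cong refl)
          (auto simp: sp A \<phi>_def po indicator_def sp\<Omega>)
      also have "\<dots> = set_lebesgue_integral \<Omega> A ?g"
        unfolding set_lebesgue_integral_def \<Omega>_def
        by (rule integral_distr[OF m\<phi>, symmetric]) (use mA[OF mg'] in \<open>simp add: \<Omega>_def\<close>)
      finally show "set_lebesgue_integral \<Omega> A ?b = set_lebesgue_integral \<Omega> A ?g" .
    qed
  qed
  ultimately have "transmission_law P PU M (\<lambda>_. e) \<Omega>"
    unfolding transmission_law_def U_def
    using \<Omega>.prob_space_axioms sets\<Omega> by (simp add: case_prod_beta')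
  then show ?thesis unfolding PU_def by blast
qed

section \<open>The converse for a fixed value of the common randomness\<close>

text \<open>Several messages may select the same input. Collecting the weights by input yields an
  input law \<open>r\<close> with the same mutual information.\<close>

lemma mixture_information_le_capacity:
  fixes P :: "'x::finite \<Rightarrow> 'y::finite pmf" and a :: "'i \<Rightarrow> real" and X :: "'i \<Rightarrow> 'x"
  assumes I: "finite I" and a: "\<And>i. i \<in> I \<Longrightarrow> 0 \<le> a i" "(\<Sum>i\<in>I. a i) = 1"
  shows "(\<Sum>i\<in>I. \<Sum>y\<in>UNIV. a i * pmf (P (X i)) y * log 2 (pmf (P (X i)) y / (\<Sum>j\<in>I. a j * pmf (P (X j)) y)))
    \<le> capacity P"
proof -
  define r where "r x = (\<Sum>i\<in>I. if X i = x then a i else 0)" for x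
  have r0: "0 \<le> r x" for x unfolding r_def using a by (intro sum_nonneg) auto
  have r: "(\<Sum>x\<in>UNIV. r x * G x) = (\<Sum>i\<in>I. a i * G (X i))" for G :: "'x \<Rightarrow> real"
  proof -
    have "(\<Sum>x\<in>UNIV. r x * G x) = (\<Sum>i\<in>I. \<Sum>x\<in>UNIV. if X i = x then a i * G x else 0)"
      by (subst sum.swap) (auto simp: r_def sum_distrib_right intro!: sum.cong)
    also have "\<dots> = (\<Sum>i\<in>I. a i * G (X i))" by (intro sum.cong refl) simp
    finally show ?thesis .
  qed
  define Q where "Q = embed_pmf r"
  have "(\<integral>\<^sup>+x. ennreal (r x) \<partial>count_space UNIV) = 1"
    using r[of "\<lambda>_. 1"] a(2) by (simp add: nn_integral_count_space_finite sum_ennreal r0)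
  then have Q: "pmf Q x = r x" for x unfolding Q_def using r0 by (simp add: pmf_embed_pmf)
  have "mutual_info Q P =
      (\<Sum>x\<in>UNIV. r x * (\<Sum>y\<in>UNIV. pmf (P x) y * log 2 (pmf (P x) y / (\<Sum>x'\<in>UNIV. r x' * pmf (P x') y))))"
    by (simp add: mutual_info_def Q sum_distrib_left mult.assoc)
  also have "\<dots> = (\<Sum>i\<in>I. \<Sum>y\<in>UNIV. a i * pmf (P (X i)) y * log 2 (pmf (P (X i)) y / (\<Sum>j\<in>I. a j * pmf (P (X j)) y)))"
    unfolding r by (simp add: sum_distrib_left mult.assoc)
  finally show ?thesis using mutual_info_le_capacity[of Q P] by simp
qed

text \<open>Entropy is at most cross entropy. A uniform \<open>r\<close> will give the bound by
  \<open>log 2 (real M)\<close>, and an \<open>r\<close> favouring one message will give Fano's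
  inequality.\<close>

lemma gibbs_inequality:
  fixes p r :: "'i \<Rightarrow> real"
  assumes "finite I" "\<And>i. i \<in> I \<Longrightarrow> 0 < p i" "\<And>i. i \<in> I \<Longrightarrow> 0 < r i"
    and "(\<Sum>i\<in>I. r i) \<le> (\<Sum>i\<in>I. p i)"
  shows "(\<Sum>i\<in>I. p i * log 2 (1 / p i)) \<le> (\<Sum>i\<in>I. p i * log 2 (1 / r i))"
proof -
  have "p i * log 2 (1 / p i) - p i * log 2 (1 / r i) \<le> (r i - p i) / ln 2" if "i \<in> I" for i
  proof -
    have pos: "0 < p i" "0 < r i" using assms that by auto
    have "ln (r i / p i) \<le> r i / p i - 1" using pos by (intro ln_le_minus_one) simp
    then have "p i * ln (r i / p i) \<le> p i * (r i / p i - 1)" using pos by (intro mult_left_mono) auto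
    then have "p i * ln (r i / p i) \<le> r i - p i" using pos by (simp add: right_diff_distrib)
    then have "p i * ln (r i / p i) / ln 2 \<le> (r i - p i) / ln 2" by (simp add: divide_right_mono)
    moreover have "p i * log 2 (1 / p i) - p i * log 2 (1 / r i) = p i * ln (r i / p i) / ln 2"
      using pos by (simp add: log_def ln_div diff_divide_distrib right_diff_distrib)
    ultimately show ?thesis by simp
  qed
  then have "(\<Sum>i\<in>I. p i * log 2 (1 / p i) - p i * log 2 (1 / r i)) \<le> (\<Sum>i\<in>I. (r i - p i) / ln 2)"
    by (rule sum_mono)
  also have "\<dots> = ((\<Sum>i\<in>I. r i) - (\<Sum>i\<in>I. p i)) / ln 2"
    by (simp add: sum_subtractf flip: sum_divide_distrib)
  also have "\<dots> \<le> 0" using assms(4) by (simp add: divide_nonpos_pos)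
  finally show ?thesis by (simp add: sum_subtractf)
qed

text \<open>\<open>run ys\<close> is meant to say that decoding has not stopped after
  \<open>ys\<close>. For a prefix-closed \<open>run\<close> the count is the stopping time truncated
  at \<open>n\<close>; as a count it is additive in \<open>n\<close>, and its measurability in a
  parameter is immediate.\<close>

definition stop_len :: "('y list \<Rightarrow> bool) \<Rightarrow> nat \<Rightarrow> 'y list \<Rightarrow> nat" where
  "stop_len run n ys = (\<Sum>i<n. of_bool (run (take i ys)))"

definition stopped :: "('y list \<Rightarrow> bool) \<Rightarrow> 'y list \<Rightarrow> 'y list" where
  "stopped run ys = take (stop_len run (length ys) ys) ys"

lemma stop_len_snoc:
  "stop_len run (length (ys @ [y])) (ys @ [y]) = stop_len run (length ys) ys + of_bool (run ys)"
  by (simp add: stop_len_def)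

lemma stop_len_le: "stop_len run n ys \<le> n"
proof -
  have "stop_len run n ys \<le> (\<Sum>i<n. 1)" unfolding stop_len_def by (intro sum_mono) auto
  then show ?thesis by simp
qed

lemma run_take:
  assumes "\<And>ys y. run (ys @ [y]) \<Longrightarrow> run ys" and "run ys"
  shows "run (take i ys)"
  using assms(2)
proof (induction ys rule: rev_induct)
  case (snoc y ys)
  then show ?case using assms(1)[of ys y] by (cases "i \<le> length ys") auto
qed simp

lemma stopped_snoc:
  assumes "\<And>ys y. run (ys @ [y]) \<Longrightarrow> run ys"
  shows "stopped run (ys @ [y]) = (if run ys then ys @ [y] else stopped run ys)"
proof (cases "run ys")
  case True
  then have "run (take i ys)" for i using run_take[of run ys i] assms by blast
  then have "stop_len run (length ys) ys = length ys" by (simp add: stop_len_def)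
  then show ?thesis using True unfolding stopped_def stop_len_snoc by simp
next
  case False
  then show ?thesis unfolding stopped_def stop_len_snoc
    using stop_len_le[of run "length ys" ys] by simp
qed

lemma stopped_run:
  assumes "\<And>ys y. run (ys @ [y]) \<Longrightarrow> run ys" and "run ys"
  shows "stopped run ys = ys"
proof -
  have "run (take i ys)" for i using run_take[of run ys i] assms by blast
  then show ?thesis by (simp add: stopped_def stop_len_def)
qed

text \<open>\<open>m\<close> is an unnormalised, consistent law of the output word. Each further
  letter raises the total by at most \<open>\<kappa>\<close> times the mass still running, and that
  mass is exactly the increment of the mean of \<open>stop_len\<close>; on stopped words the value
  is frozen.\<close>

lemma optional_stopping:
  fixes m :: "'y::finite list \<Rightarrow> real"
  assumes run: "\<And>ys y. run (ys @ [y]) \<Longrightarrow> run ys"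
    and m: "\<And>ys. (\<Sum>y\<in>UNIV. m (ys @ [y])) = m ys"
    and drift: "\<And>ys. run ys \<Longrightarrow> (\<Sum>y\<in>UNIV. m (ys @ [y]) * V (ys @ [y])) \<le> m ys * (V ys + \<kappa>)"
  shows "(\<Sum>ys\<in>words n. m ys * V (stopped run ys)) \<le>
    m [] * V [] + \<kappa> * (\<Sum>ys\<in>words n. m ys * real (stop_len run n ys))"
proof (induction n)
  case 0
  show ?case by (simp add: stopped_def stop_len_def)
next
  case (Suc n)
  have "(\<Sum>ys\<in>words (Suc n). m ys * V (stopped run ys)) =
      (\<Sum>ys\<in>words n. \<Sum>y\<in>UNIV. m (ys @ [y]) * V (stopped run (ys @ [y])))"
    by (rule sum_words_Suc)
  also have "\<dots> \<le> (\<Sum>ys\<in>words n. m ys * V (stopped run ys) + \<kappa> * (m ys * of_bool (run ys)))"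
  proof (intro sum_mono)
    fix ys :: "'y list"
    show "(\<Sum>y\<in>UNIV. m (ys @ [y]) * V (stopped run (ys @ [y]))) \<le>
        m ys * V (stopped run ys) + \<kappa> * (m ys * of_bool (run ys))"
    proof (cases "run ys")
      case True
      then show ?thesis using drift[of ys] stopped_run[of run ys, OF run]
        by (simp add: stopped_snoc[of run, OF run] algebra_simps)
    next
      case False
      then show ?thesis by (simp add: stopped_snoc[of run, OF run] m flip: sum_distrib_right)
    qed
  qed
  also have "\<dots> = (\<Sum>ys\<in>words n. m ys * V (stopped run ys)) + \<kappa> * (\<Sum>ys\<in>words n. m ys * of_bool (run ys))"
    by (simp only: sum.distrib sum_distrib_left)
  also have "\<dots> \<le> m [] * V [] + \<kappa> * (\<Sum>ys\<in>words n. m ys * real (stop_len run n ys)) +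
      \<kappa> * (\<Sum>ys\<in>words n. m ys * of_bool (run ys))"
    using Suc by simp
  also have "\<dots> = m [] * V [] + \<kappa> * (\<Sum>ys\<in>words n. m ys * (real (stop_len run n ys) + of_bool (run ys)))"
    by (simp only: sum.distrib distrib_left add.assoc)
  also have "(\<Sum>ys\<in>words n. m ys * (real (stop_len run n ys) + of_bool (run ys))) =
      (\<Sum>ys\<in>words (Suc n). m ys * real (stop_len run (Suc n) ys))"
    unfolding sum_words_Suc
  proof (intro sum.cong refl)
    fix ys :: "'y list" assume "ys \<in> words n"
    then have "stop_len run (Suc n) (ys @ [y]) = stop_len run n ys + of_bool (run ys)" for y
      using stop_len_snoc[of run ys y] by simp
    then show "m ys * (real (stop_len run n ys) + of_bool (run ys)) =
        (\<Sum>y\<in>UNIV. m (ys @ [y]) * real (stop_len run (Suc n) (ys @ [y])))"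
      by (simp add: m flip: sum_distrib_right)
  qed
  finally show ?case .
qed

text \<open>\<open>p\<close> is the density of \<open>a\<close> with respect to \<open>m\<close>,
  and it may be evaluated at the stopped word instead of the full one: the difference of the
  summands vanishes while running, and afterwards both laws merely distribute the mass of the
  stopped word. With \<open>lik w\<close> and \<open>mass\<close> this brings in the posterior at
  the stopping time.\<close>

lemma stopped_weights:
  fixes m a :: "'y::finite list \<Rightarrow> real"
  assumes run: "\<And>ys y. run (ys @ [y]) \<Longrightarrow> run ys"
    and m: "\<And>ys. (\<Sum>y\<in>UNIV. m (ys @ [y])) = m ys" and a: "\<And>ys. (\<Sum>y\<in>UNIV. a (ys @ [y])) = a ys"
    and p: "\<And>ys. m ys * p ys = a ys"
  shows "(\<Sum>ys\<in>words n. a ys * G (stopped run ys)) =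
    (\<Sum>ys\<in>words n. m ys * (p (stopped run ys) * G (stopped run ys) :: real))"
proof (induction n)
  case 0
  show ?case using p[of "[]"] by (simp add: stopped_def mult.assoc)
next
  case (Suc n)
  let ?d = "\<lambda>ys. a ys * G (stopped run ys) - m ys * (p (stopped run ys) * G (stopped run ys))"
  have "(\<Sum>y\<in>UNIV. ?d (ys @ [y])) = ?d ys" for ys
  proof (cases "run ys")
    case True
    then have "?d (ys @ [y]) = 0" for y using p[of "ys @ [y]", symmetric]
      by (simp add: stopped_snoc[of run, OF run])
    moreover have "?d ys = 0" using True p[of ys, symmetric] stopped_run[of run ys, OF run] by simp
    ultimately show ?thesis by (simp only: sum.neutral_const)
  next
    case False
    then show ?thesis
      by (simp add: stopped_snoc[of run, OF run] sum_subtractf m a flip: sum_distrib_right)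
  qed
  then have "(\<Sum>ys\<in>words (Suc n). ?d ys) = (\<Sum>ys\<in>words n. ?d ys)"
    by (simp add: sum_words_Suc)
  then show ?case using Suc by (simp add: sum_subtractf)
qed

text \<open>A code with the common randomness held fixed, so that the encoder is deterministic.
  \<open>\<delta>\<close> is the residual probability at which a message counts as nearly
  certain.\<close>

locale feedback_code =
  fixes P :: "'x::finite \<Rightarrow> 'y::finite pmf" and c :: real and M :: nat
    and f :: "nat \<Rightarrow> 'y list \<Rightarrow> 'x" and \<delta> :: real
  assumes C1: "C1 P = ereal c" and cap: "0 < capacity P" and M: "2 \<le> M"
    and \<delta>: "0 < \<delta>" "\<delta> < 1 / 2"
begin

section \<open>Likelihoods, posterior law and its drifts\<close>

definition supp :: "'y set" where "supp = set_pmf (P undefined)"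

definition lik :: "nat \<Rightarrow> 'y list \<Rightarrow> real" where "lik w ys = path_prob (\<lambda>zs. P (f w zs)) ys"

text \<open>This is \<open>real M\<close> times the output law. The missing normalisation is
  harmless, and identities such as \<open>mass_mult_post\<close> hold on words of probability zero
  as well.\<close>

definition mass :: "'y list \<Rightarrow> real" where "mass ys = (\<Sum>w=1..M. lik w ys)"

definition post :: "nat \<Rightarrow> 'y list \<Rightarrow> real" where "post w ys = lik w ys / mass ys"

definition entr :: "'y list \<Rightarrow> real" where "entr ys = (\<Sum>w=1..M. post w ys * log 2 (1 / post w ys))"

definition pmin :: real where "pmin = Min ((\<lambda>(x, y). pmf (P x) y) ` (UNIV \<times> supp))"

lemma set_pmf_P: "set_pmf (P x) = supp"
  unfolding supp_def by (rule set_pmf_eq_of_finite_C1[OF C1])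

lemma supp_ne: "supp \<noteq> {}" by (simp add: supp_def set_pmf_not_empty)

lemma pmf_pos_iff: "0 < pmf (P x) y \<longleftrightarrow> y \<in> supp"
  using set_pmf_P[of x] by (simp add: pmf_positive_iff)

lemma pmf_eq_0: "y \<notin> supp \<Longrightarrow> pmf (P x) y = 0"
  using set_pmf_P[of x] by (simp add: pmf_eq_0_set_pmf)

lemma pmin: "0 < pmin" "y \<in> supp \<Longrightarrow> pmin \<le> pmf (P x) y" "pmin \<le> 1"
proof -
  have ne: "(UNIV :: 'x set) \<times> supp \<noteq> {}" using supp_ne by simp
  have "pmin \<in> (\<lambda>(x, y). pmf (P x) y) ` (UNIV \<times> supp)"
    unfolding pmin_def using ne by (intro Min_in) auto
  then show "0 < pmin" "pmin \<le> 1" by (auto simp: pmf_pos_iff pmf_le_1)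
  show "pmin \<le> pmf (P x) y" if "y \<in> supp"
    unfolding pmin_def using that by (intro Min_le) (auto intro!: image_eqI[of _ _ "(x, y)"])
qed

lemma sum_supp: "(\<Sum>y\<in>UNIV. pmf (P x) y * h y) = (\<Sum>y\<in>supp. pmf (P x) y * h y)"
  by (intro sum.mono_neutral_right) (auto simp: pmf_eq_0)

lemma sum_pmf_supp: "(\<Sum>y\<in>supp. pmf (P x) y) = 1"
  using sum_supp[of x "\<lambda>_. 1"] by simp

lemma lik_Nil [simp]: "lik w [] = 1" by (simp add: lik_def)
lemma lik_snoc: "lik w (ys @ [y]) = lik w ys * pmf (P (f w ys)) y" by (simp add: lik_def path_prob_snoc)
lemma lik_nonneg [simp]: "0 \<le> lik w ys" by (simp add: lik_def)
lemma mass_nonneg [simp]: "0 \<le> mass ys" by (simp add: mass_def sum_nonneg)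
lemma mass_Nil [simp]: "mass [] = real M" by (simp add: mass_def)

lemma lik_pos_iff: "0 < lik w ys \<longleftrightarrow> set ys \<subseteq> supp"
proof (induction ys rule: rev_induct)
  case (snoc y ys)
  then show ?case using pmf_pos_iff[of "f w ys" y]
    by (auto simp: lik_snoc zero_less_mult_iff less_le[of 0 "pmf _ _"])
qed simp

lemma lik_eq_0: "\<not> set ys \<subseteq> supp \<Longrightarrow> lik w ys = 0"
  using lik_pos_iff[of w ys] lik_nonneg[of w ys] by linarith

lemma mass_pos_iff: "0 < mass ys \<longleftrightarrow> set ys \<subseteq> supp"
proof
  assume "set ys \<subseteq> supp"
  then show "0 < mass ys" unfolding mass_def using M lik_pos_iff by (intro sum_pos) auto
next
  assume "0 < mass ys"
  then show "set ys \<subseteq> supp" using lik_eq_0 by (force simp: mass_def)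
qed

text \<open>Because all inputs share one support and there are at least two messages, no possible
  output word ever excludes a message. Posterior probabilities stay below 1 and \<open>odds\<close>
  stays finite.\<close>

lemma lik_less_mass: "set ys \<subseteq> supp \<Longrightarrow> w \<in> {1..M} \<Longrightarrow> lik w ys < mass ys"
proof -
  assume ys: "set ys \<subseteq> supp" and w: "w \<in> {1..M}"
  have "mass ys = lik w ys + (\<Sum>v\<in>{1..M} - {w}. lik v ys)"
    unfolding mass_def using w by (subst sum.remove[of _ w]) auto
  moreover have "0 < (\<Sum>v\<in>{1..M} - {w}. lik v ys)"
  proof (intro sum_pos)
    have "(if w = 1 then 2 else 1) \<in> {1..M} - {w}" using M by auto
    then show "{1..M} - {w} \<noteq> {}" by blast
  qed (use ys in \<open>auto simp: lik_pos_iff\<close>)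
  ultimately show ?thesis by simp
qed

lemma sum_lik_snoc: "(\<Sum>y\<in>UNIV. lik w (ys @ [y])) = lik w ys"
  by (simp add: lik_snoc flip: sum_distrib_left)

lemma sum_mass_snoc: "(\<Sum>y\<in>UNIV. mass (ys @ [y])) = mass ys"
  unfolding mass_def by (subst sum.swap) (simp add: sum_lik_snoc)

lemma mass_snoc_le: "mass (ys @ [y]) \<le> mass ys"
  unfolding sum_mass_snoc[of ys, symmetric] by (intro member_le_sum) auto

lemma mass_mult_post: "mass ys * post w ys = lik w ys"
  using mass_pos_iff[of ys] lik_eq_0[of ys w] by (auto simp: post_def)

lemma sum_post: "set ys \<subseteq> supp \<Longrightarrow> (\<Sum>w=1..M. post w ys) = 1"
  using mass_pos_iff[of ys] by (simp add: post_def mass_def flip: sum_divide_distrib)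

lemma post_pos: "set ys \<subseteq> supp \<Longrightarrow> 0 < post w ys"
  using mass_pos_iff[of ys] lik_pos_iff[of w ys] by (simp add: post_def)

lemma mass_snoc:
  assumes "set ys \<subseteq> supp"
  shows "mass (ys @ [y]) = mass ys * (\<Sum>w=1..M. post w ys * pmf (P (f w ys)) y)"
  by (simp add: mass_def[of "ys @ [y]"] lik_snoc sum_distrib_left mass_mult_post flip: mult.assoc)

lemma sum_mass_supp: "(\<Sum>y\<in>UNIV. mass (ys @ [y]) * V y) = (\<Sum>y\<in>supp. mass (ys @ [y]) * V y)"
proof (intro sum.mono_neutral_right ballI)
  fix y assume "y \<in> UNIV - supp"
  then have "mass (ys @ [y]) = 0" using mass_pos_iff[of "ys @ [y]"] mass_nonneg[of "ys @ [y]"] by simp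
  then show "mass (ys @ [y]) * V y = 0" by simp
qed auto

text \<open>The expected loss of entropy in one use is the mutual information between the message,
  under its current posterior, and the next output. The message acts on that output only through the
  input, hence the bound by capacity.\<close>

lemma entropy_drift:
  assumes ys: "set ys \<subseteq> supp"
  shows "mass ys * (entr ys - capacity P) \<le> (\<Sum>y\<in>UNIV. mass (ys @ [y]) * entr (ys @ [y]))"
proof -
  let ?k = "\<lambda>w. pmf (P (f w ys))"
  let ?p = "\<lambda>y. \<Sum>w=1..M. post w ys * ?k w y"
  have m: "0 < mass ys" using ys mass_pos_iff by simp
  have mi: "(\<Sum>w=1..M. \<Sum>y\<in>UNIV. post w ys * ?k w y * log 2 (?k w y / ?p y)) \<le> capacity P"
    using ys post_pos[OF ys] by (intro mixture_information_le_capacity sum_post) (auto intro: less_imp_le)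
  have tm: "lik w (ys @ [y]) * log 2 (1 / post w (ys @ [y])) =
      mass ys * (post w ys * ?k w y * log 2 (1 / post w ys)
        - post w ys * ?k w y * log 2 (?k w y / ?p y))"
    if y: "y \<in> supp" and w: "w \<in> {1..M}" for w y
  proof -
    have ysy: "set (ys @ [y]) \<subseteq> supp" using ys y by simp
    have pos: "0 < lik w ys" "0 < ?k w y" "0 < mass (ys @ [y])" "0 < post w ys"
      using ys ysy y by (simp_all only: lik_pos_iff pmf_pos_iff mass_pos_iff post_pos)
    have p: "?p y = mass (ys @ [y]) / mass ys" using m by (simp add: mass_snoc[OF ys])
    have "log 2 (1 / post w (ys @ [y])) = log 2 (1 / post w ys) - log 2 (?k w y / ?p y)"
      unfolding p using pos m
      by (simp add: post_def lik_snoc log_divide log_mult)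
    moreover have "lik w (ys @ [y]) = mass ys * post w ys * ?k w y"
      by (simp add: lik_snoc mass_mult_post)
    ultimately show ?thesis
      by (simp only: right_diff_distrib mult.assoc)
  qed
  have "(\<Sum>y\<in>UNIV. mass (ys @ [y]) * entr (ys @ [y])) = (\<Sum>y\<in>supp. mass (ys @ [y]) * entr (ys @ [y]))"
    by (rule sum_mass_supp)
  also have "\<dots> = (\<Sum>y\<in>supp. \<Sum>w=1..M. lik w (ys @ [y]) * log 2 (1 / post w (ys @ [y])))"
    by (simp add: entr_def sum_distrib_left mass_mult_post flip: mult.assoc)
  also have "\<dots> = (\<Sum>y\<in>supp. \<Sum>w=1..M. mass ys * (post w ys * ?k w y * log 2 (1 / post w ys)
        - post w ys * ?k w y * log 2 (?k w y / ?p y)))"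
    using tm by (intro sum.cong refl) auto
  also have "\<dots> = (\<Sum>w=1..M. mass ys * (post w ys * log 2 (1 / post w ys) * (\<Sum>y\<in>supp. ?k w y)
      - (\<Sum>y\<in>supp. post w ys * ?k w y * log 2 (?k w y / ?p y))))"
    by (subst sum.swap) (simp add: sum_subtractf sum_distrib_left sum_distrib_right right_diff_distrib ac_simps)
  also have "\<dots> = mass ys * (entr ys - (\<Sum>w=1..M. \<Sum>y\<in>supp. post w ys * ?k w y * log 2 (?k w y / ?p y)))"
    by (simp add: sum_pmf_supp entr_def sum_subtractf flip: sum_distrib_left)
  also have "(\<Sum>w=1..M. \<Sum>y\<in>supp. post w ys * ?k w y * log 2 (?k w y / ?p y)) =
      (\<Sum>w=1..M. \<Sum>y\<in>UNIV. post w ys * ?k w y * log 2 (?k w y / ?p y))"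
    by (intro sum.cong sum.mono_neutral_left) (auto simp: pmf_eq_0)
  finally show ?thesis
    using mi m by (simp add: mult_left_mono)
qed

text \<open>The numerator is the whole \<open>mass ys\<close> rather than the share of
  \<open>w\<close>: this keeps the quantity nonnegative and makes its expected increment exactly a
  divergence.\<close>

definition odds :: "nat \<Rightarrow> 'y list \<Rightarrow> real" where "odds w ys = log 2 (mass ys / (mass ys - lik w ys))"

text \<open>The increment is \<open>log 2 (?p y / q y)\<close>, with \<open>?p\<close> the law of
  the next output and \<open>q\<close> its law given that the message is not \<open>w\<close>. Its
  mean under \<open>?p\<close> is a divergence between mixtures of channel rows, so at most
  \<open>c\<close>.\<close>

lemma odds_drift:
  assumes ys: "set ys \<subseteq> supp" and w: "w \<in> {1..M}"
  shows "(\<Sum>y\<in>UNIV. mass (ys @ [y]) * odds w (ys @ [y])) \<le> mass ys * (odds w ys + c)"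
proof -
  let ?p = "\<lambda>y. \<Sum>v=1..M. post v ys * pmf (P (f v ys)) y"
  define b where "b v = lik v ys / (mass ys - lik w ys)" for v
  define q where "q y = (\<Sum>v\<in>{1..M} - {w}. b v * pmf (P (f v ys)) y)" for y
  have m: "0 < mass ys" using ys mass_pos_iff by simp
  have mw: "0 < mass ys - lik w ys" using lik_less_mass[OF ys w] by simp
  have rest: "(\<Sum>v\<in>{1..M} - {w}. lik v zs) = mass zs - lik w zs" for zs
    unfolding mass_def using w by (simp add: sum_diff1)
  have D: "(\<Sum>y\<in>UNIV. ?p y * log 2 (?p y / q y)) \<le> c"
    unfolding q_def
  proof (rule mixture_divergence_le_C1[OF C1])
    show "(\<Sum>v\<in>{1..M} - {w}. b v) = 1"
      using mw rest[of ys] by (simp add: b_def flip: sum_divide_distrib)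
    show "0 \<le> b v" for v using mw by (simp add: b_def)
    show "0 \<le> post v ys" for v using post_pos[OF ys, of v] by simp
    show "(\<Sum>v=1..M. post v ys) = 1" by (rule sum_post[OF ys])
  qed auto
  have "mass (ys @ [y]) * odds w (ys @ [y]) =
      mass (ys @ [y]) * odds w ys + mass ys * (?p y * log 2 (?p y / q y))" if y: "y \<in> supp" for y
  proof -
    have ysy: "set (ys @ [y]) \<subseteq> supp" using ys y by simp
    have m': "0 < mass (ys @ [y])" using ysy mass_pos_iff by blast
    have mw': "0 < mass (ys @ [y]) - lik w (ys @ [y])" using lik_less_mass[OF ysy w] by simp
    have p: "?p y = mass (ys @ [y]) / mass ys" using m by (simp add: mass_snoc[OF ys])
    have q: "q y = (mass (ys @ [y]) - lik w (ys @ [y])) / (mass ys - lik w ys)"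
      unfolding rest[symmetric, of "ys @ [y]"] by (simp add: q_def b_def lik_snoc sum_divide_distrib)
    have "odds w (ys @ [y]) = odds w ys + log 2 (?p y / q y)"
      unfolding p q odds_def using m mw m' mw' by (simp add: log_divide log_mult)
    then show ?thesis by (simp only: mass_snoc[OF ys] distrib_left mult.assoc)
  qed
  then have "(\<Sum>y\<in>supp. mass (ys @ [y]) * odds w (ys @ [y])) =
      (\<Sum>y\<in>supp. mass (ys @ [y]) * odds w ys + mass ys * (?p y * log 2 (?p y / q y)))"
    by (rule sum.cong[OF refl])
  also have "\<dots> = (\<Sum>y\<in>supp. mass (ys @ [y])) * odds w ys + mass ys * (\<Sum>y\<in>supp. ?p y * log 2 (?p y / q y))"
    by (simp add: sum.distrib sum_distrib_left sum_distrib_right)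
  also have "(\<Sum>y\<in>supp. mass (ys @ [y])) = mass ys"
    using sum_mass_supp[of ys "\<lambda>_. 1"] sum_mass_snoc[of ys] by simp
  also have "(\<Sum>y\<in>supp. ?p y * log 2 (?p y / q y)) = (\<Sum>y\<in>UNIV. ?p y * log 2 (?p y / q y))"
    by (intro sum.mono_neutral_left) (auto simp: pmf_eq_0)
  finally show ?thesis
    using D m by (simp add: sum_mass_supp distrib_left mult_left_mono)
qed

section \<open>The leading message and the potential of the converse\<close>

definition conf :: "'y list \<Rightarrow> nat \<Rightarrow> bool" where
  "conf ys w \<longleftrightarrow> w \<in> {1..M} \<and> (1 - \<delta>) * mass ys \<le> lik w ys"

text \<open>On a word of positive mass at most one message qualifies, since \<delta> is below 1/2;
  on a word of mass zero every message does, whence the choice.\<close>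

definition pick :: "'y list \<Rightarrow> nat option" where
  "pick ys = (if \<exists>w. conf ys w then Some (SOME w. conf ys w) else None)"

text \<open>
  \<open>lead ys\<close> is the first message whose posterior probability has reached \<open>1 - \<delta>\<close> along \<open>ys\<close>; it is
  kept from then on. The recursion is on the reversed list because the latest output is the last
  element.
\<close>
primrec lead_rev :: "'y list \<Rightarrow> nat option" where
  "lead_rev [] = pick []"
| "lead_rev (y # ys) = (case lead_rev ys of None \<Rightarrow> pick (rev (y # ys)) | Some w \<Rightarrow> Some w)"

definition lead :: "'y list \<Rightarrow> nat option" where "lead ys = lead_rev (rev ys)"

lemma lead_snoc: "lead (ys @ [y]) = (case lead ys of None \<Rightarrow> pick (ys @ [y]) | Some w \<Rightarrow> Some w)"
  by (simp add: lead_def split: option.split)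

lemma pick_SomeD: "pick ys = Some w \<Longrightarrow> conf ys w"
  by (auto simp: pick_def intro: someI split: if_splits)

lemma pick_None_iff: "pick ys = None \<longleftrightarrow> (\<forall>w. \<not> conf ys w)"
  by (auto simp: pick_def)

lemma lead_None_imp: "lead ys = None \<Longrightarrow> \<not> conf ys w"
  by (cases ys rule: rev_cases) (auto simp: lead_snoc pick_None_iff lead_def split: option.splits)

lemma lead_range: "lead ys = Some w \<Longrightarrow> w \<in> {1..M}"
proof (induction ys rule: rev_induct)
  case Nil
  then show ?case using pick_SomeD[of "[]" w] by (simp add: lead_def conf_def)
next
  case (snoc y ys)
  then show ?case using pick_SomeD[of "ys @ [y]" w] by (auto simp: lead_snoc conf_def split: option.splits)
qed

text \<open>The prior probability \<open>1 / real M\<close> is at most 1/2 and so below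
  \<open>1 - \<delta>\<close>: the potential starts in its first phase.\<close>

lemma lead_Nil [simp]: "lead [] = None"
proof -
  have "1 < (1 - \<delta>) * real M"
  proof -
    have "1 < (1 - \<delta>) * 2" using \<delta> by simp
    also have "\<dots> \<le> (1 - \<delta>) * real M" using M \<delta> by (intro mult_left_mono) auto
    finally show ?thesis .
  qed
  then show ?thesis by (auto simp: lead_def pick_None_iff conf_def)
qed

lemma entr_le_log_M:
  assumes "set ys \<subseteq> supp"
  shows "entr ys \<le> log 2 (real M)"
proof -
  have "entr ys \<le> (\<Sum>w=1..M. post w ys * log 2 (1 / (1 / real M)))"
    unfolding entr_def using M sum_post[OF assms] post_pos[OF assms]
    by (intro gibbs_inequality) auto
  also have "\<dots> = (\<Sum>w=1..M. post w ys) * log 2 (real M)"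
    by (simp add: sum_distrib_right)
  finally show ?thesis using sum_post[OF assms] by simp
qed

text \<open>Fano's inequality, from the cross entropy with the law \<open>r\<close> that gives 1/2
  to \<open>w\<close> and spreads the rest evenly.\<close>

lemma entr_le_conf:
  assumes ys: "set ys \<subseteq> supp" and conf: "conf ys w"
  shows "entr ys \<le> 1 + \<delta> * log 2 (real M)"
proof -
  have w: "w \<in> {1..M}" and ge: "1 - \<delta> \<le> post w ys"
    using conf mass_pos_iff[of ys] ys by (auto simp: conf_def post_def field_simps)
  define r where "r v = (if v = w then 1 / 2 else 1 / (2 * (real M - 1)))" for v
  have M1: "1 \<le> real M - 1" using M by simp
  have rest: "(\<Sum>v\<in>{1..M} - {w}. post v ys) = 1 - post w ys"
    using sum_post[OF ys] w by (simp add: sum_diff1)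
  have "(\<Sum>v=1..M. r v) = 1 / 2 + (\<Sum>v\<in>{1..M} - {w}. 1 / (2 * (real M - 1)))"
    using w by (subst sum.remove[of _ w]) (auto simp: r_def intro!: sum.cong)
  also have "\<dots> = 1" using w M1 M by (simp add: of_nat_diff field_simps)
  finally have "entr ys \<le> (\<Sum>v=1..M. post v ys * log 2 (1 / r v))"
    unfolding entr_def using sum_post[OF ys] post_pos[OF ys] M1 M
    by (intro gibbs_inequality) (auto simp: r_def)
  also have "\<dots> = post w ys * log 2 (1 / r w) + (\<Sum>v\<in>{1..M} - {w}. post v ys * log 2 (1 / r v))"
    using w by (subst sum.remove[of _ w]) auto
  also have "(\<Sum>v\<in>{1..M} - {w}. post v ys * log 2 (1 / r v)) =
      (\<Sum>v\<in>{1..M} - {w}. post v ys) * (1 + log 2 (real M - 1))"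
    unfolding sum_distrib_right
  proof (intro sum.cong refl)
    fix v assume "v \<in> {1..M} - {w}"
    then have "1 / r v = 2 * (real M - 1)" by (simp add: r_def)
    then show "post v ys * log 2 (1 / r v) = post v ys * (1 + log 2 (real M - 1))"
      using M1 log_mult[of 2 "real M - 1" 2] by (simp add: mult.commute)
  qed
  also have "post w ys * log 2 (1 / r w) + \<dots> = 1 + (1 - post w ys) * log 2 (real M - 1)"
    unfolding rest by (simp add: r_def algebra_simps)
  also have "(1 - post w ys) * log 2 (real M - 1) \<le> \<delta> * log 2 (real M)"
  proof (intro mult_mono)
    show "log 2 (real M - 1) \<le> log 2 (real M)" using M1 by (subst log_le_cancel_iff) auto
  qed (use ge \<delta> M1 in auto)
  finally show ?thesis by simp
qed

definition jump :: real where "jump = log 2 (1 / (pmin * \<delta>))"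

lemma jump_nonneg: "0 \<le> jump"
proof -
  have "pmin * \<delta> \<le> 1 * 1" using pmin(1,3) \<delta> by (intro mult_mono) auto
  then show ?thesis using pmin(1) \<delta> by (simp add: jump_def)
qed

text \<open>Without a leader, the messages other than \<open>w\<close> hold at least the fraction
  \<delta> of the mass. One more letter multiplies each of their likelihoods by at least
  \<open>pmin\<close>, while the total mass cannot grow. This limits the overshoot at the moment of
  selection.\<close>

lemma odds_le_jump:
  assumes ys: "set ys \<subseteq> supp" and y: "y \<in> supp" and nl: "lead ys = None" and w: "w \<in> {1..M}"
  shows "odds w (ys @ [y]) \<le> jump"
proof -
  have ysy: "set (ys @ [y]) \<subseteq> supp" using ys y by simp
  have m: "0 < mass ys" "0 < mass (ys @ [y])" using ys ysy mass_pos_iff by blast+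
  have rest: "(\<Sum>v\<in>{1..M} - {w}. lik v zs) = mass zs - lik w zs" for zs
    unfolding mass_def using w by (simp add: sum_diff1)
  have "\<delta> * mass ys \<le> mass ys - lik w ys"
    using lead_None_imp[OF nl, of w] w by (simp add: conf_def algebra_simps)
  moreover have "pmin * \<delta> * mass (ys @ [y]) \<le> pmin * (\<delta> * mass ys)"
    using mass_snoc_le[of ys y] pmin(1) \<delta> by simp
  ultimately have "pmin * \<delta> * mass (ys @ [y]) \<le> pmin * (mass ys - lik w ys)"
    using pmin(1) by (meson less_imp_le mult_left_mono order_trans)
  also have "pmin * (mass ys - lik w ys) = (\<Sum>v\<in>{1..M} - {w}. lik v ys * pmin)"
    unfolding rest[symmetric] by (simp add: sum_distrib_left mult.commute)
  also have "\<dots> \<le> (\<Sum>v\<in>{1..M} - {w}. lik v (ys @ [y]))"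
    unfolding lik_snoc using y pmin(2) by (intro sum_mono mult_left_mono) auto
  finally have le: "pmin * \<delta> * mass (ys @ [y]) \<le> mass (ys @ [y]) - lik w (ys @ [y])"
    unfolding rest by simp
  have pd: "0 < pmin * \<delta>" using pmin(1) \<delta> by simp
  then have "0 < pmin * \<delta> * mass (ys @ [y])" using m by simp
  then have "mass (ys @ [y]) / (mass (ys @ [y]) - lik w (ys @ [y])) \<le> mass (ys @ [y]) / (pmin * \<delta> * mass (ys @ [y]))"
    using le m by (intro divide_left_mono) auto
  also have "\<dots> = 1 / (pmin * \<delta>)" using m by simp
  finally show ?thesis
    unfolding odds_def jump_def using m pd lik_less_mass[OF ysy w] by (subst log_le_cancel_iff) auto
qed

lemma c_pos: "0 < c"
  using capacity_le_C1[OF C1] cap by simp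

text \<open>
  The potential of the converse. In units of channel uses, it counts the resolved entropy (at
  capacity) until some message is nearly certain, and afterwards the log odds of that message
  (at rate \<open>C1\<close>). The constant \<open>jump\<close> pays for the overshoot at the transition.
\<close>
definition pot :: "'y list \<Rightarrow> real" where
  "pot ys = (case lead ys of
      None \<Rightarrow> (log 2 (real M) - entr ys) / capacity P + jump / c
    | Some w \<Rightarrow> (log 2 (real M) - (1 + \<delta> * log 2 (real M))) / capacity P + odds w ys / c)"

text \<open>When a leader appears, \<open>entr_le_conf\<close> and \<open>odds_le_jump\<close> show
  that the second form of the potential is at most the first. The first form thus dominates
  throughout the step and grows by at most 1 by \<open>entropy_drift\<close>; with a leader present,
  \<open>odds_drift\<close> divided by \<open>c\<close> does the same.\<close>

lemma pot_drift: "(\<Sum>y\<in>UNIV. mass (ys @ [y]) * pot (ys @ [y])) \<le> mass ys * (pot ys + 1)"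
proof (cases "set ys \<subseteq> supp")
  case False
  then have "mass ys = 0" "mass (ys @ [y]) = 0" for y
    using mass_pos_iff[of ys] mass_pos_iff[of "ys @ [y]"] mass_nonneg[of ys] mass_nonneg[of "ys @ [y]"]
    by (auto simp: less_le)
  then show ?thesis by simp
next
  case ys: True
  show ?thesis
  proof (cases "lead ys")
    case None
    let ?V = "\<lambda>zs. (log 2 (real M) - entr zs) / capacity P + jump / c"
    have "pot (ys @ [y]) \<le> ?V (ys @ [y])" if y: "y \<in> supp" for y
    proof (cases "lead (ys @ [y])")
      case (Some w)
      have conf: "conf (ys @ [y]) w" using Some None by (simp add: lead_snoc pick_SomeD)
      have ysy: "set (ys @ [y]) \<subseteq> supp" using ys y by simp
      have "odds w (ys @ [y]) \<le> jump" using conf by (intro odds_le_jump ys y None) (simp add: conf_def)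
      then have "odds w (ys @ [y]) / c \<le> jump / c" using c_pos by (simp add: divide_right_mono)
      moreover have "(log 2 (real M) - (1 + \<delta> * log 2 (real M))) / capacity P \<le>
          (log 2 (real M) - entr (ys @ [y])) / capacity P"
        using entr_le_conf[OF ysy conf] cap by (intro divide_right_mono) auto
      ultimately show ?thesis by (simp add: pot_def Some)
    qed (simp add: pot_def)
    then have "(\<Sum>y\<in>UNIV. mass (ys @ [y]) * pot (ys @ [y])) \<le> (\<Sum>y\<in>UNIV. mass (ys @ [y]) * ?V (ys @ [y]))"
      unfolding sum_mass_supp by (intro sum_mono mult_left_mono) auto
    also have "\<dots> = (\<Sum>y\<in>UNIV. mass (ys @ [y])) * (log 2 (real M) / capacity P + jump / c)
        - (\<Sum>y\<in>UNIV. mass (ys @ [y]) * entr (ys @ [y])) / capacity P"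
      by (simp add: sum_distrib_right sum_divide_distrib sum_subtractf sum.distrib distrib_left right_diff_distrib diff_divide_distrib)
    also have "\<dots> \<le> mass ys * (log 2 (real M) / capacity P + jump / c) - mass ys * (entr ys - capacity P) / capacity P"
      unfolding sum_mass_snoc using entropy_drift[OF ys] cap by (intro diff_left_mono divide_right_mono) auto
    also have "\<dots> = mass ys * (pot ys + 1)"
      using cap by (simp add: pot_def None field_simps)
    finally show ?thesis .
  next
    case (Some w)
    then have pot: "pot (ys @ [y]) = (log 2 (real M) - (1 + \<delta> * log 2 (real M))) / capacity P + odds w (ys @ [y]) / c" for y
      by (simp add: pot_def lead_snoc)
    have "(\<Sum>y\<in>UNIV. mass (ys @ [y]) * pot (ys @ [y])) =
        (\<Sum>y\<in>UNIV. mass (ys @ [y])) * ((log 2 (real M) - (1 + \<delta> * log 2 (real M))) / capacity P)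
        + (\<Sum>y\<in>UNIV. mass (ys @ [y]) * odds w (ys @ [y])) / c"
      unfolding pot by (simp add: sum_distrib_right sum_divide_distrib sum.distrib distrib_left)
    also have "\<dots> \<le> mass ys * ((log 2 (real M) - (1 + \<delta> * log 2 (real M))) / capacity P) + mass ys * (odds w ys + c) / c"
      unfolding sum_mass_snoc using odds_drift[OF ys lead_range[OF Some]] c_pos
      by (intro add_left_mono divide_right_mono) auto
    also have "\<dots> = mass ys * (pot ys + 1)"
      using c_pos by (simp add: pot_def Some field_simps)
    finally show ?thesis .
  qed
qed

text \<open>The conditional probability that the leader is wrong; before a selection the constant
  \<delta> stands in, which is what the selection rule guarantees. The result is a supermartingale
  starting at \<delta>.\<close>

definition doubt :: "'y list \<Rightarrow> real" where
  "doubt ys = (case lead ys of None \<Rightarrow> \<delta> | Some w \<Rightarrow> 1 - post w ys)"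

text \<open>At selection the value can only fall below \<delta>, and afterwards it is a martingale.
  The summand \<open>0\<close> is the \<kappa> of \<open>optional_stopping\<close>.\<close>

lemma doubt_drift: "(\<Sum>y\<in>UNIV. mass (ys @ [y]) * doubt (ys @ [y])) \<le> mass ys * (doubt ys + 0)"
proof (cases "lead ys")
  case None
  have "mass (ys @ [y]) * doubt (ys @ [y]) \<le> mass (ys @ [y]) * \<delta>" for y
  proof (cases "lead (ys @ [y])")
    case (Some w)
    then have "conf (ys @ [y]) w" using None by (simp add: lead_snoc pick_SomeD)
    then show ?thesis
      using Some mass_mult_post[of "ys @ [y]" w] by (simp add: doubt_def conf_def algebra_simps)
  qed (simp add: doubt_def)
  then have "(\<Sum>y\<in>UNIV. mass (ys @ [y]) * doubt (ys @ [y])) \<le> (\<Sum>y\<in>UNIV. mass (ys @ [y]) * \<delta>)"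
    by (rule sum_mono)
  then show ?thesis using None by (simp add: doubt_def sum_mass_snoc flip: sum_distrib_right)
next
  case (Some w)
  then have "(\<Sum>y\<in>UNIV. mass (ys @ [y]) * doubt (ys @ [y])) = (\<Sum>y\<in>UNIV. mass (ys @ [y]) - lik w (ys @ [y]))"
    by (simp add: doubt_def lead_snoc right_diff_distrib mass_mult_post)
  also have "\<dots> = mass ys * doubt ys"
    using Some by (simp add: sum_subtractf sum_mass_snoc sum_lik_snoc doubt_def right_diff_distrib mass_mult_post)
  finally show ?thesis by simp
qed

text \<open>
  The tangent bound \<open>ln (1 / t) \<ge> ln (1 / \<epsilon>) - t / \<epsilon>\<close> keeps the estimate linear in the error
  probability, so that it can later be averaged over the common randomness.
\<close>
lemma pot_lower:
  assumes ys: "set ys \<subseteq> supp" and g: "g \<in> {1..M}" and \<epsilon>: "0 < \<epsilon>" "\<epsilon> \<le> 1"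
    and A: "1 \<le> (1 - \<delta>) * log 2 (real M)"
  defines "e \<equiv> 1 - post g ys"
  shows "((1 - \<delta>) * log 2 (real M) - 1) / capacity P * (1 - e / \<delta>) +
      (log 2 (1 / \<epsilon>) * (1 - e / \<delta> - doubt ys - e) - e / (\<epsilon> * ln 2)) / c \<le> pot ys"
proof -
  let ?A = "((1 - \<delta>) * log 2 (real M) - 1) / capacity P" and ?L = "log 2 (1 / \<epsilon>)"
  have A0: "0 \<le> ?A" using A cap by simp
  have L0: "0 \<le> ?L" using \<epsilon> by simp
  have m: "0 < mass ys" using ys mass_pos_iff by simp
  have p1: "post w ys < 1" if "w \<in> {1..M}" for w
    using lik_less_mass[OF ys that] m by (simp add: post_def)
  have e0: "0 < e" using p1[OF g] by (simp add: e_def)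
  have odds: "odds w ys = log 2 (1 / (1 - post w ys))" for w
    using m by (simp add: odds_def post_def diff_divide_distrib[symmetric] field_simps)
  have edge: "0 \<le> e / (\<epsilon> * ln 2)" using e0 \<epsilon> by simp
  \<comment> \<open>The subtracted terms neutralise the bad cases. Without a leader the decision has
    \<open>e > \<delta>\<close>, so \<open>1 - e / \<delta>\<close> is negative. If the leader
    differs from \<open>g\<close>, their posteriors sum to at most 1, so
    \<open>doubt ys + e \<ge> 1\<close>. Only for leader \<open>g\<close> is the odds term really
    used, with the tangent bound.\<close>
  show ?thesis
  proof (cases "lead ys")
    case None
    then have "\<not> conf ys g" by (rule lead_None_imp)
    then have "\<delta> < e" using g m by (simp add: conf_def e_def post_def field_simps)
    then have ed: "1 - e / \<delta> \<le> 0" using \<delta> by (simp add: field_simps)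
    have "?A * (1 - e / \<delta>) \<le> 0" using A0 ed by (rule mult_nonneg_nonpos)
    moreover have "?L * (1 - e / \<delta> - doubt ys - e) \<le> 0"
    proof (rule mult_nonneg_nonpos[OF L0])
      show "1 - e / \<delta> - doubt ys - e \<le> 0" proof -
        have "doubt ys = \<delta>" using None by (simp add: doubt_def)
        then show ?thesis using ed e0 \<delta>(1) by linarith
      qed
    qed
    then have "(?L * (1 - e / \<delta> - doubt ys - e) - e / (\<epsilon> * ln 2)) / c \<le> 0"
      using edge c_pos by (intro divide_nonpos_pos) auto
    moreover have "0 \<le> pot ys"
      using None entr_le_log_M[OF ys] cap c_pos jump_nonneg by (simp add: pot_def)
    ultimately show ?thesis by simp
  next
    case (Some w)
    have w: "w \<in> {1..M}" by (rule lead_range[OF Some])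
    have d: "doubt ys = 1 - post w ys" by (simp add: doubt_def Some)
    have ed0: "0 \<le> e / \<delta>" using e0 \<delta> by simp
    have "?A * (1 - e / \<delta>) \<le> ?A * 1" using A0 ed0 by (intro mult_left_mono) auto
    moreover have "?L * (1 - e / \<delta> - doubt ys - e) - e / (\<epsilon> * ln 2) \<le> odds w ys"
    proof (cases "w = g")
      case True
      then have de: "doubt ys = e" by (simp add: d e_def)
      have "?L * (1 - e / \<delta> - doubt ys - e) \<le> ?L * 1"
        using L0 ed0 e0 by (intro mult_left_mono) (auto simp: de)
      moreover have "ln (e / \<epsilon>) \<le> e / \<epsilon>" using e0 \<epsilon> ln_le_minus_one[of "e / \<epsilon>"] by simp
      then have "ln (e / \<epsilon>) / ln 2 \<le> e / \<epsilon> / ln 2" by (intro divide_right_mono) auto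
      then have "?L - e / (\<epsilon> * ln 2) \<le> log 2 (1 / e)"
        using e0 \<epsilon> by (simp add: log_def ln_div diff_divide_distrib)
      ultimately show ?thesis using True by (simp add: odds e_def)
    next
      case False
      have "post w ys + post g ys = (\<Sum>v\<in>{w, g}. post v ys)" using False by simp
      also have "\<dots> \<le> (\<Sum>v=1..M. post v ys)"
        using w g post_pos[OF ys] by (intro sum_mono2) (auto intro: less_imp_le)
      finally have "post w ys + post g ys \<le> 1" using sum_post[OF ys] by simp
      then have "?L * (1 - e / \<delta> - doubt ys - e) \<le> 0"
        using L0 ed0 by (intro mult_nonneg_nonpos) (auto simp: d e_def)
      moreover have "0 \<le> odds w ys"
        using p1[OF w] post_pos[OF ys, of w] by (simp add: odds)
      ultimately show ?thesis using edge by simp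
    qed
    then have "(?L * (1 - e / \<delta> - doubt ys - e) - e / (\<epsilon> * ln 2)) / c \<le> odds w ys / c"
      using c_pos by (simp add: divide_right_mono)
    ultimately show ?thesis by (simp add: pot_def Some algebra_simps)
  qed
qed

text \<open>\<open>pot_lower\<close> at the stopped word is averaged and compared with optional
  stopping of \<open>pot\<close>. Here \<epsilon> is a free parameter, the point of tangency: it
  will be the error bound of the whole code, whereas \<open>pe\<close> is the error for this value
  of the common randomness.\<close>

lemma converse_bound:
  fixes g :: "'y list \<Rightarrow> nat" and n :: nat
  assumes run: "\<And>ys y. run (ys @ [y]) \<Longrightarrow> run ys"
    and g: "\<And>ys. g ys \<in> {1..M}" and \<epsilon>: "0 < \<epsilon>" "\<epsilon> \<le> 1"
    and A: "1 \<le> (1 - \<delta>) * log 2 (real M)"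
  defines "pe \<equiv> (\<Sum>w=1..M. \<Sum>ys\<in>words n. of_bool (g (stopped run ys) \<noteq> w) * path_prob (\<lambda>zs. P (f w zs)) ys) / real M"
    and "len \<equiv> (\<Sum>w=1..M. \<Sum>ys\<in>words n. real (stop_len run n ys) * path_prob (\<lambda>zs. P (f w zs)) ys) / real M"
  shows "((1 - \<delta>) * log 2 (real M) - 1) / capacity P * (1 - pe / \<delta>) +
      (log 2 (1 / \<epsilon>) * (1 - pe / \<delta> - \<delta> - pe) - pe / (\<epsilon> * ln 2)) / c \<le> jump / c + len"
proof -
  let ?A = "((1 - \<delta>) * log 2 (real M) - 1) / capacity P" and ?L = "log 2 (1 / \<epsilon>)"
  define Z where "Z F = (\<Sum>ys\<in>words n. mass ys * F ys) / real M" for F :: "'y list \<Rightarrow> real"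
  define e where "e ys = 1 - post (g (stopped run ys)) (stopped run ys)" for ys
  have M0: "0 < real M" using M by simp
  have Zadd: "Z (\<lambda>ys. F ys + G ys) = Z F + Z G" and Zdiff: "Z (\<lambda>ys. F ys - G ys) = Z F - Z G"
    and Zc: "Z (\<lambda>ys. t * F ys) = t * Z F" for F G t
    by (simp_all add: Z_def distrib_left right_diff_distrib sum.distrib sum_subtractf add_divide_distrib
        diff_divide_distrib sum_distrib_left mult.left_commute)
  have Zdiv: "Z (\<lambda>ys. F ys / t) = Z F / t" for F t
    using Zc[of "1 / t" F] by simp
  have sum_mass: "(\<Sum>ys\<in>words n. mass ys) = real M"
    unfolding mass_def lik_def by (subst sum.swap) simp
  have Z1: "Z (\<lambda>_. 1) = 1" using M0 by (simp add: Z_def sum_mass)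
  have Zt: "Z (\<lambda>_. t) = t" for t using Zc[of t "\<lambda>_. 1"] by (simp add: Z1)
  have len: "len = Z (\<lambda>ys. real (stop_len run n ys))"
    unfolding len_def Z_def mass_def lik_def
    by (subst sum.swap) (simp add: sum_distrib_left mult.commute)
  have pe: "pe = Z e"
  proof -
    have "(\<Sum>w=1..M. \<Sum>ys\<in>words n. of_bool (g (stopped run ys) \<noteq> w) * path_prob (\<lambda>zs. P (f w zs)) ys) =
        (\<Sum>w=1..M. \<Sum>ys\<in>words n. lik w ys * of_bool (g (stopped run ys) \<noteq> w))"
      by (simp add: lik_def mult.commute)
    also have "\<dots> = (\<Sum>w=1..M. \<Sum>ys\<in>words n. mass ys * (post w (stopped run ys) * of_bool (g (stopped run ys) \<noteq> w)))"
      by (intro sum.cong refl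
          stopped_weights[of run mass "lik w" "post w" "\<lambda>z. of_bool (g z \<noteq> w)" n for w, OF run sum_mass_snoc sum_lik_snoc mass_mult_post])
    also have "\<dots> = (\<Sum>ys\<in>words n. mass ys * (\<Sum>w=1..M. post w (stopped run ys) * of_bool (g (stopped run ys) \<noteq> w)))"
      unfolding sum_distrib_left by (rule sum.swap)
    also have "\<dots> = (\<Sum>ys\<in>words n. mass ys * e ys)"
    proof (intro sum.cong refl)
      fix ys :: "'y list"
      show "mass ys * (\<Sum>w=1..M. post w (stopped run ys) * of_bool (g (stopped run ys) \<noteq> w)) = mass ys * e ys"
      proof (cases "set ys \<subseteq> supp")
        case True
        then have s: "set (stopped run ys) \<subseteq> supp"
          unfolding stopped_def using set_take_subset by fastforce
        let ?z = "stopped run ys"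
        have "(\<Sum>w=1..M. post w ?z * of_bool (g ?z \<noteq> w)) = (\<Sum>w\<in>{1..M} - {g ?z}. post w ?z)"
          using g[of ?z] by (subst sum.remove[of _ "g ?z"]) (auto intro!: sum.cong)
        also have "\<dots> = e ys" using sum_post[OF s] g[of ?z] by (simp add: sum_diff1 e_def)
        finally show ?thesis by simp
      next
        case False
        then show ?thesis using mass_pos_iff[of ys] mass_nonneg[of ys] by simp
      qed
    qed
    finally show ?thesis by (simp add: pe_def Z_def)
  qed
  \<comment> \<open>The uniform prior has entropy \<open>log 2 (real M)\<close>, so the entropy term
    starts at 0.\<close>
  have pot_Nil: "pot [] = jump / c"
    using M0 by (simp add: pot_def entr_def post_def)
  have "Z (\<lambda>ys. pot (stopped run ys)) \<le> (mass [] * pot [] + 1 * (\<Sum>ys\<in>words n. mass ys * real (stop_len run n ys))) / real M"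
    unfolding Z_def using M0 optional_stopping[of run mass pot 1 n, OF run sum_mass_snoc pot_drift]
    by (intro divide_right_mono) auto
  also have "\<dots> = jump / c + len"
    using M0 by (simp add: len Z_def pot_Nil add_divide_distrib)
  finally have up: "Z (\<lambda>ys. pot (stopped run ys)) \<le> jump / c + len" .
  have "Z (\<lambda>ys. doubt (stopped run ys)) \<le> (mass [] * doubt [] + 0 * (\<Sum>ys\<in>words n. mass ys * real (stop_len run n ys))) / real M"
    unfolding Z_def using M0 optional_stopping[of run mass doubt 0 n, OF run sum_mass_snoc doubt_drift]
    by (intro divide_right_mono) auto
  also have "\<dots> = \<delta>" using M0 by (simp add: doubt_def)
  finally have doubt: "Z (\<lambda>ys. doubt (stopped run ys)) \<le> \<delta>" .
  \<comment> \<open>The mean doubt is multiplied by \<open>?L \<ge> 0\<close> and subtracted, so it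
    may be replaced by its upper bound \<delta>.\<close>
  have "?A * (1 - pe / \<delta>) + (?L * (1 - pe / \<delta> - \<delta> - pe) - pe / (\<epsilon> * ln 2)) / c \<le>
      ?A * (1 - pe / \<delta>) + (?L * (1 - pe / \<delta> - Z (\<lambda>ys. doubt (stopped run ys)) - pe) - pe / (\<epsilon> * ln 2)) / c"
    using doubt \<epsilon> c_pos by (intro add_left_mono divide_right_mono diff_right_mono mult_left_mono) auto
  also have "\<dots> = Z (\<lambda>ys. ?A * (1 - e ys / \<delta>) + (?L * (1 - e ys / \<delta> - doubt (stopped run ys) - e ys) - e ys / (\<epsilon> * ln 2)) / c)"
    unfolding pe Zadd Zdiff Zdiv Zc Zt ..
  also have "\<dots> \<le> Z (\<lambda>ys. pot (stopped run ys))"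
    unfolding Z_def
  proof (intro divide_right_mono sum_mono)
    fix ys :: "'y list"
    show "mass ys * (?A * (1 - e ys / \<delta>) + (?L * (1 - e ys / \<delta> - doubt (stopped run ys) - e ys) - e ys / (\<epsilon> * ln 2)) / c)
        \<le> mass ys * pot (stopped run ys)"
    proof (cases "set ys \<subseteq> supp")
      case True
      then have s: "set (stopped run ys) \<subseteq> supp"
        unfolding stopped_def using set_take_subset by fastforce
      show ?thesis unfolding e_def by (intro mult_left_mono pot_lower s g \<epsilon> A) simp
    next
      case False
      then have "mass ys = 0" using mass_pos_iff[of ys] mass_nonneg[of ys] by simp
      then show ?thesis by simp
    qed
  qed simp
  also note up
  finally show ?thesis .
qed

end

section \<open>The converse for codes\<close>

text \<open>For each \<open>u\<close> the code is an instance of \<open>feedback_code\<close>,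
  truncated at time \<open>N = K * l\<close>. The resulting inequalities are affine in
  \<open>pe u\<close> and \<open>len u\<close>, so integrating over \<open>u\<close> leaves only the
  overall error probability and expected length.\<close>

lemma converse_code:
  fixes P :: "'x::finite \<Rightarrow> 'y::finite pmf" and \<Omega> :: "('u, 'y) outcome measure"
  assumes C1: "C1 P = ereal c" and cap: "0 < capacity P"
    and code: "aflf_code P l M \<gamma> K \<epsilon> PU f g \<Omega> \<tau>"
    and late: "\<P>(\<omega> in \<Omega>. \<tau> \<omega> > l) \<le> \<eta>"
    and M: "2 \<le> M" and \<delta>: "0 < \<delta>" "\<delta> < 1 / 2"
    and A: "1 \<le> (1 - \<delta>) * log 2 (real M)"
  shows "((1 - \<delta>) * log 2 (real M) - 1) / capacity P * (1 - \<epsilon> / \<delta>) +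
      (log 2 (1 / \<epsilon>) * (1 - \<epsilon> / \<delta> - \<delta> - \<epsilon>) - 1 / ln 2) / c \<le>
    feedback_code.jump P \<delta> / c + real l + real (K * l) * \<eta>"
proof -
  define N where "N = K * l"
  have M1: "1 \<le> M" using M by simp
  have \<epsilon>: "0 < \<epsilon>" "\<epsilon> < 1" and PU: "prob_space PU" and law: "transmission_law P PU M f \<Omega>"
    and f: "\<And>w ys. w \<in> {1..M} \<Longrightarrow> (\<lambda>u. f u w ys) \<in> measurable PU (count_space UNIV)"
    and g: "\<And>ys. (\<lambda>u. g u ys) \<in> measurable PU (count_space {1..M})"
    and st: "stopping_time (receiver_info PU \<Omega>) \<tau>" and AE: "AE \<omega> in \<Omega>. \<tau> \<omega> \<le> N"
    and err: "\<P>(\<omega> in \<Omega>. case \<omega> of (u, w, y) \<Rightarrow> g u (past y (\<tau> \<omega>)) \<noteq> w) \<le> \<epsilon>"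
    using code by (auto simp: aflf_code_def N_def)
  interpret PU: prob_space PU by (rule PU)
  interpret \<Omega>: prob_space \<Omega> using law by (simp add: transmission_law_def)
  have sets: "sets \<Omega> = sets (outcome_algebra PU M)" using law by (simp add: transmission_law_def)
  have sp: "space \<Omega> = space PU \<times> {1..M} \<times> UNIV"
    using sets_eq_imp_space_eq[OF sets] by (simp add: space_outcome_algebra)
  have exB: "\<exists>B. B \<in> sets (PU \<Otimes>\<^sub>M count_space (UNIV :: 'y list set)) \<and>
      {\<omega> \<in> space \<Omega>. \<tau> \<omega> \<le> n} = (\<lambda>(u, w, y). (u, past y n)) -` B \<inter> space \<Omega>" for n
  proof -
    have "{\<omega> \<in> space \<Omega>. \<tau> \<omega> \<le> n} \<in> sets (receiver_info PU \<Omega> n)"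
      using stopping_timeD[OF st, of n] by (simp add: pred_def receiver_info_def)
    moreover have "sets (receiver_info PU \<Omega> n) = {(\<lambda>(u, w, y). (u, past y n)) -` B \<inter> space \<Omega> | B.
        B \<in> sets (PU \<Otimes>\<^sub>M count_space UNIV)}"
      unfolding receiver_info_def by (rule sets_vimage_algebra2) (auto simp: sp space_pair_measure)
    ultimately show ?thesis by blast
  qed
  \<comment> \<open>Membership in the receiver's information yields, for each \<open>n\<close>, a
    measurable set of pairs of \<open>u\<close> and the first \<open>n\<close> outputs. One such set
    is fixed per \<open>n\<close>, so that stopping becomes a predicate on finite words.\<close>
  define B where "B n = (SOME B. B \<in> sets (PU \<Otimes>\<^sub>M count_space (UNIV :: 'y list set)) \<and>
      {\<omega> \<in> space \<Omega>. \<tau> \<omega> \<le> n} = (\<lambda>(u, w, y). (u, past y n)) -` B \<inter> space \<Omega>)" for n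
  have B: "B n \<in> sets (PU \<Otimes>\<^sub>M count_space (UNIV :: 'y list set))"
    and \<tau>B: "{\<omega> \<in> space \<Omega>. \<tau> \<omega> \<le> n} = (\<lambda>(u, w, y). (u, past y n)) -` B n \<inter> space \<Omega>" for n
    using someI_ex[OF exB[of n]] unfolding B_def by (rule conjunct1, rule conjunct2)
  have \<tau>le: "\<tau> (u, w, y) \<le> n \<longleftrightarrow> (u, past y n) \<in> B n" if "u \<in> space PU" "w \<in> {1..M}" for u w y n
    using \<tau>B[of n] that by (auto simp: sp set_eq_iff)
  define run where "run u ys \<longleftrightarrow> (u, ys) \<notin> B (length ys)" for u ys
  have run: "run u (past y n) \<longleftrightarrow> n < \<tau> (u, w, y)" if "u \<in> space PU" "w \<in> {1..M}" for u w y n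
    using \<tau>le[OF that, of y n] by (auto simp: run_def)
  have closed: "run u ys" if u: "u \<in> space PU" and r: "run u (ys @ [y])" for u ys y
  proof -
    \<comment> \<open>The word is extended to an infinite sequence, with arbitrary values of
      \<open>!\<close> beyond its end, so that the stopping time can be evaluated; message 1
      completes the outcome.\<close>
    define z where "z i = (ys @ [y]) ! i" for i
    have z1: "past z (Suc (length ys)) = ys @ [y]" and z0: "past z (length ys) = ys"
      by (auto simp: past_eq_iff z_def nth_append)
    have "Suc (length ys) < \<tau> (u, 1, z)" using run[OF u, of 1 z "Suc (length ys)"] r M1 z1 by simp
    then show ?thesis using run[OF u, of 1 z "length ys"] M1 z0 by simp
  qed
  have mrun [measurable]: "Measurable.pred PU (\<lambda>u. run u ys)" for ys
  proof -
    have "(\<lambda>u. (u, ys)) \<in> measurable PU (PU \<Otimes>\<^sub>M count_space UNIV)" by simp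
    from measurable_sets[OF this B[of "length ys"]]
    have "(\<lambda>u. (u, ys)) -` B (length ys) \<inter> space PU \<in> sets PU" .
    then have "Measurable.pred PU (\<lambda>u. (u, ys) \<in> B (length ys))"
      by (simp add: pred_def vimage_def Int_def conj_commute)
    then show ?thesis unfolding run_def by measurable
  qed
  have mlen [measurable]: "(\<lambda>u. stop_len (run u) n ys) \<in> measurable PU (count_space UNIV)" for n ys
    unfolding stop_len_def of_bool_def by measurable
  have mg: "(\<lambda>u. g u (stopped (run u) ys)) \<in> measurable PU (count_space {1..M})" for ys
    unfolding stopped_def
    by (rule measurable_compose_countable[where f = "\<lambda>i u. g u (take i ys)", OF g mlen])
  have slen: "stop_len (run u) n (past y n) = min (\<tau> (u, w, y)) n"
    if "u \<in> space PU" "w \<in> {1..M}" for u w y n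
  proof -
    have "stop_len (run u) n (past y n) = (\<Sum>i<n. of_bool (i < \<tau> (u, w, y)))"
      unfolding stop_len_def by (intro sum.cong refl) (simp add: take_past run[OF that])
    also have "\<dots> = card ({..<n} \<inter> {i. i < \<tau> (u, w, y)})" by simp
    also have "{..<n} \<inter> {i. i < \<tau> (u, w, y)} = {..<min (\<tau> (u, w, y)) n}" by auto
    finally show ?thesis by simp
  qed
  define pe where "pe u = (\<Sum>w=1..M. \<Sum>ys\<in>words N. of_bool (g u (stopped (run u) ys) \<noteq> w) *
    path_prob (\<lambda>zs. P (f u w zs)) ys) / real M" for u
  define len where "len u = (\<Sum>w=1..M. \<Sum>ys\<in>words N. real (stop_len (run u) N ys) *
    path_prob (\<lambda>zs. P (f u w zs)) ys) / real M" for u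
  have mg' [measurable]: "(\<lambda>u. of_bool (g u (stopped (run u) ys) \<noteq> w) :: real) \<in> borel_measurable PU" for w ys
    by (rule measurable_compose[OF mg, of "\<lambda>v. of_bool (v \<noteq> w)"]) simp
  have m\<tau>: "{\<omega> \<in> space \<Omega>. \<tau> \<omega> \<le> n} \<in> sets \<Omega>" for n
  proof -
    have "(\<lambda>(u, w, y). (u, past y n)) \<in> measurable \<Omega> (PU \<Otimes>\<^sub>M count_space (UNIV :: 'y list set))"
      unfolding measurable_cong_sets[OF sets refl] by (rule measurable_receiver)
    from measurable_sets[OF this B[of n]] show ?thesis unfolding \<tau>B .
  qed
  have m\<tau>gt: "{\<omega> \<in> space \<Omega>. n < \<tau> \<omega>} \<in> sets \<Omega>" for n
  proof -
    have "{\<omega> \<in> space \<Omega>. n < \<tau> \<omega>} = space \<Omega> - {\<omega> \<in> space \<Omega>. \<tau> \<omega> \<le> n}" by auto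
    then show ?thesis using m\<tau>[of n] by auto
  qed
  have \<tau>m: "\<tau> \<in> measurable \<Omega> (count_space UNIV)"
  proof -
    have "\<tau> \<in> borel_measurable \<Omega>" by (rule borel_measurableI_le) (rule m\<tau>)
    then show ?thesis by (simp add: measurable_cong_sets[OF refl sets_borel_eq_count_space])
  qed
  define Er where "Er = {\<omega> \<in> space \<Omega>. case \<omega> of (u, w, y) \<Rightarrow> g u (past y (\<tau> \<omega>)) \<noteq> w}"
  have mEr: "Er \<in> sets \<Omega>"
  proof -
    have m1: "fst \<in> measurable \<Omega> PU" "(\<lambda>\<omega>. fst (snd \<omega>)) \<in> measurable \<Omega> (count_space {1..M})"
      "(\<lambda>\<omega>. past (snd (snd \<omega>)) n) \<in> measurable \<Omega> (count_space UNIV)" for n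
      unfolding measurable_cong_sets[OF sets refl] outcome_algebra_def by measurable
    have "(\<lambda>\<omega>. past (snd (snd \<omega>)) (\<tau> \<omega>)) \<in> measurable \<Omega> (count_space UNIV)"
      by (rule measurable_compose_countable[where f = "\<lambda>n \<omega>. past (snd (snd \<omega>)) n", OF m1(3) \<tau>m])
    then have "(\<lambda>\<omega>. g (fst \<omega>) (past (snd (snd \<omega>)) (\<tau> \<omega>))) \<in> measurable \<Omega> (count_space {1..M})"
      by (rule measurable_compose_countable'[where f = "\<lambda>ys \<omega>. g (fst \<omega>) ys" and I = UNIV, rotated])
        (rule countable_UNIV_list, rule measurable_compose[OF m1(1) g])
    from measurable_compose[OF this, of real borel] measurable_compose[OF m1(2), of real borel]
    have [measurable]: "(\<lambda>\<omega>. real (g (fst \<omega>) (past (snd (snd \<omega>)) (\<tau> \<omega>)))) \<in> borel_measurable \<Omega>"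
      "(\<lambda>\<omega>. real (fst (snd \<omega>))) \<in> borel_measurable \<Omega>" by simp_all
    have "{\<omega> \<in> space \<Omega>. real (g (fst \<omega>) (past (snd (snd \<omega>)) (\<tau> \<omega>))) \<noteq> real (fst (snd \<omega>))} \<in> sets \<Omega>"
      by measurable
    then show ?thesis by (simp add: Er_def case_prod_beta')
  qed
  have ind: "integrable \<Omega> (indicator A :: _ \<Rightarrow> real)" "(\<integral>\<omega>. indicator A \<omega> \<partial>\<Omega>) = measure \<Omega> A"
    if "A \<in> sets \<Omega>" for A
    using that by (auto simp: \<Omega>.emeasure_finite less_top[symmetric] sets.Int_space_eq2)
  have "(\<integral>u. pe u \<partial>PU) = (\<integral>\<omega>. (case \<omega> of (u, w, y) \<Rightarrow> of_bool (g u (stopped (run u) (past y N)) \<noteq> w)) \<partial>\<Omega>)"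
    unfolding pe_def
    by (rule transmission_law_expectation[OF law PU f, where B = 1, symmetric]) (auto intro: mg')
  \<comment> \<open>The bound on the stopping time holds only almost surely. Where it fails the
    truncated decision may differ, which costs an event of probability zero.\<close>
  also have "\<dots> \<le> (\<integral>\<omega>. indicator Er \<omega> + indicator {\<omega> \<in> space \<Omega>. N < \<tau> \<omega>} \<omega> \<partial>\<Omega>)"
  proof (rule integral_mono')
    show "integrable \<Omega> (\<lambda>\<omega>. indicator Er \<omega> + indicator {\<omega> \<in> space \<Omega>. N < \<tau> \<omega>} \<omega> :: real)"
      by (intro Bochner_Integration.integrable_add ind mEr m\<tau>gt)
    fix \<omega> assume \<omega>: "\<omega> \<in> space \<Omega>"
    then obtain u w y where \<omega>': "\<omega> = (u, w, y)" and u: "u \<in> space PU" "w \<in> {1..M}" by (auto simp: sp)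
    have "stopped (run u) (past y N) = past y (\<tau> \<omega>)" if "\<tau> \<omega> \<le> N"
      using that slen[OF u, of N y] by (simp add: stopped_def take_past \<omega>')
    then show "(case \<omega> of (u, w, y) \<Rightarrow> of_bool (g u (stopped (run u) (past y N)) \<noteq> w)) \<le>
        (indicator Er \<omega> + indicator {\<omega> \<in> space \<Omega>. N < \<tau> \<omega>} \<omega> :: real)"
      using \<omega> by (cases "\<tau> \<omega> \<le> N") (auto simp: \<omega>' Er_def indicator_def)
  qed auto
  also have "\<dots> = measure \<Omega> Er + measure \<Omega> {\<omega> \<in> space \<Omega>. N < \<tau> \<omega>}"
    by (subst Bochner_Integration.integral_add) (simp_all only: ind[OF mEr] ind[OF m\<tau>gt])
  also have "measure \<Omega> {\<omega> \<in> space \<Omega>. N < \<tau> \<omega>} = 0"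
    using AE by (intro \<Omega>.prob_eq_0_AE) (auto elim!: eventually_mono)
  also have "measure \<Omega> Er + 0 \<le> \<epsilon>" using err by (simp add: Er_def)
  finally have pe: "(\<integral>u. pe u \<partial>PU) \<le> \<epsilon>" .
  have "(\<integral>u. len u \<partial>PU) = (\<integral>\<omega>. (case \<omega> of (u, w, y) \<Rightarrow> real (stop_len (run u) N (past y N))) \<partial>\<Omega>)"
    unfolding len_def
  proof (rule transmission_law_expectation[OF law PU f, where B = "real N", symmetric])
    show "(\<lambda>u. real (stop_len (run u) N ys)) \<in> borel_measurable PU" for ys
      by (rule measurable_compose[OF mlen, of real]) simp
  qed (auto simp: stop_len_le)
  \<comment> \<open>A stopping time beyond \<open>l\<close> still contributes at most
    \<open>N\<close>, the one place where \<open>K\<close> affects the converse.\<close>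
  also have "\<dots> \<le> (\<integral>\<omega>. real l + real N * indicator {\<omega> \<in> space \<Omega>. l < \<tau> \<omega>} \<omega> \<partial>\<Omega>)"
  proof (rule integral_mono')
    show "integrable \<Omega> (\<lambda>\<omega>. real l + real N * indicator {\<omega> \<in> space \<Omega>. l < \<tau> \<omega>} \<omega>)"
      by (intro Bochner_Integration.integrable_add integrable_mult_right ind m\<tau>gt) simp
    fix \<omega> assume \<omega>: "\<omega> \<in> space \<Omega>"
    then obtain u w y where \<omega>': "\<omega> = (u, w, y)" and u: "u \<in> space PU" "w \<in> {1..M}" by (auto simp: sp)
    show "(case \<omega> of (u, w, y) \<Rightarrow> real (stop_len (run u) N (past y N))) \<le>
        real l + real N * indicator {\<omega> \<in> space \<Omega>. l < \<tau> \<omega>} \<omega>"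
      using \<omega> slen[OF u, of N y] by (auto simp: \<omega>' indicator_def min_def)
  qed (auto simp: indicator_def)
  also have "\<dots> = real l + real N * measure \<Omega> {\<omega> \<in> space \<Omega>. l < \<tau> \<omega>}"
    using ind[OF m\<tau>gt, of l]
    by (subst Bochner_Integration.integral_add) (auto simp: \<Omega>.prob_space simp del: integral_indicator)
  also have "\<dots> \<le> real l + real N * \<eta>"
    using late by (intro add_left_mono mult_left_mono) auto
  finally have len: "(\<integral>u. len u \<partial>PU) \<le> real l + real N * \<eta>" .
  let ?A = "((1 - \<delta>) * log 2 (real M) - 1) / capacity P" and ?L = "log 2 (1 / \<epsilon>)"
  let ?J = "feedback_code.jump P \<delta>"
  \<comment> \<open>The left-hand side of the bound, as a function of the error probability
    \<open>t\<close>, is \<open>\<alpha> - \<beta> * t\<close>. The sign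
    \<open>0 \<le> \<beta>\<close> later allows the mean error to be replaced by \<epsilon>.\<close>
  define \<alpha> where "\<alpha> = ?A + ?L * (1 - \<delta>) / c"
  define \<beta> where "\<beta> = ?A / \<delta> + (?L * (1 / \<delta> + 1) + 1 / (\<epsilon> * ln 2)) / c"
  have c: "0 < c" using capacity_le_C1[OF C1] cap by simp
  have \<beta>: "0 \<le> \<beta>" unfolding \<beta>_def using A cap c \<delta> \<epsilon> by simp
  have lin: "?A * (1 - t / \<delta>) + (?L * (1 - t / \<delta> - \<delta> - t) - t / (\<epsilon> * ln 2)) / c = \<alpha> - \<beta> * t" for t
  proof -
    have "a * (1 - t / \<delta>) + (b * (1 - t / \<delta> - \<delta> - t) - t / d) / c =
        a + b * (1 - \<delta>) / c - (a / \<delta> + (b * (1 / \<delta> + 1) + 1 / d) / c) * t" for a b d :: real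
      by (simp add: divide_inverse algebra_simps)
    then show ?thesis unfolding \<alpha>_def \<beta>_def .
  qed
  have pt: "\<alpha> \<le> len u + \<beta> * pe u + ?J / c" if u: "u \<in> space PU" for u
  proof -
    interpret feedback_code P c M "f u" \<delta>
      by unfold_locales (use C1 cap M \<delta> in auto)
    have gr: "g u ys \<in> {1..M}" for ys using measurable_space[OF g u, of ys] by simp
    have "?A * (1 - pe u / \<delta>) + (?L * (1 - pe u / \<delta> - \<delta> - pe u) - pe u / (\<epsilon> * ln 2)) / c \<le> ?J / c + len u"
      unfolding pe_def len_def
      by (rule converse_bound) (use closed[OF u] gr \<epsilon> A in auto)
    then show ?thesis unfolding lin by simp
  qed
  have mlen': "(\<lambda>u. real (stop_len (run u) n ys)) \<in> borel_measurable PU" for n ys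
    by (rule measurable_compose[OF mlen, of real]) simp
  have mpe: "pe \<in> borel_measurable PU" and mle: "len \<in> borel_measurable PU"
    unfolding pe_def len_def
    by (intro borel_measurable_divide borel_measurable_sum borel_measurable_times
        borel_measurable_const mg' mlen' measurable_path_prob f; assumption)+
  have one: "(\<Sum>w=1..M. \<Sum>ys\<in>words N. path_prob (\<lambda>zs. P (f u w zs)) ys) = real M" for u by simp
  have bpe: "\<bar>pe u\<bar> \<le> 1" and ble: "\<bar>len u\<bar> \<le> real N" for u
  proof -
    have "(\<Sum>w=1..M. \<Sum>ys\<in>words N. of_bool (g u (stopped (run u) ys) \<noteq> w) * path_prob (\<lambda>zs. P (f u w zs)) ys)
        \<le> (\<Sum>w=1..M. \<Sum>ys\<in>words N. path_prob (\<lambda>zs. P (f u w zs)) ys)"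
      by (intro sum_mono) auto
    then show "\<bar>pe u\<bar> \<le> 1" unfolding pe_def one using M by (simp add: sum_nonneg)
    have "(\<Sum>w=1..M. \<Sum>ys\<in>words N. real (stop_len (run u) N ys) * path_prob (\<lambda>zs. P (f u w zs)) ys)
        \<le> (\<Sum>w=1..M. \<Sum>ys\<in>words N. real N * path_prob (\<lambda>zs. P (f u w zs)) ys)"
      by (intro sum_mono mult_right_mono) (auto simp: stop_len_le)
    also have "\<dots> = real N * real M" by (simp flip: sum_distrib_left)
    finally show "\<bar>len u\<bar> \<le> real N" unfolding len_def using M
      by (simp add: sum_nonneg divide_le_eq)
  qed
  have ipe: "integrable PU pe" by (rule integrable_bounded_prob[OF PU mpe bpe])
  have ile: "integrable PU len" by (rule integrable_bounded_prob[OF PU mle ble])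
  have "\<alpha> \<le> (\<integral>u. len u + \<beta> * pe u + ?J / c \<partial>PU)"
    using ipe ile pt by (intro PU.integral_ge_const) auto
  also have "\<dots> = (\<integral>u. len u \<partial>PU) + \<beta> * (\<integral>u. pe u \<partial>PU) + ?J / c"
    using ipe ile by (simp add: PU.prob_space)
  also have "\<dots> \<le> real l + real N * \<eta> + \<beta> * \<epsilon> + ?J / c"
    using pe len \<beta> by (intro add_mono mult_left_mono) auto
  finally have "\<alpha> - \<beta> * \<epsilon> \<le> ?J / c + real l + real N * \<eta>" by simp
  then show ?thesis
    unfolding lin[symmetric] N_def using \<epsilon> by simp
qed

section \<open>The two-phase scheme with a fallback block\<close>

lemma prob_deterministic_code:
  fixes P :: "'x::finite \<Rightarrow> 'y::finite pmf" and \<Omega> :: "('u, 'y) outcome measure"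
  assumes law: "transmission_law P (measure_pmf (return_pmf u0)) M (\<lambda>_. e) \<Omega>"
  shows "\<P>(\<omega> in \<Omega>. case \<omega> of (u, w, y) \<Rightarrow> Q w (past y n)) =
    (\<Sum>w=1..M. \<Sum>ys\<in>words n. of_bool (Q w ys) * path_prob (\<lambda>zs. P (e w zs)) ys) / real M"
proof -
  let ?E = "{\<omega> \<in> space \<Omega>. case \<omega> of (u, w, y) \<Rightarrow> Q w (past y n)}"
  have "measure \<Omega> ?E = (\<integral>\<omega>. indicator ?E \<omega> \<partial>\<Omega>)"
    by (simp add: Int_absorb2 subsetI)
  also have "\<dots> = (\<integral>\<omega>. (case \<omega> of (u, w, y) \<Rightarrow> of_bool (Q w (past y n))) \<partial>\<Omega>)"
    by (intro Bochner_Integration.integral_cong refl) (auto simp: indicator_def)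
  also have "\<dots> = (\<integral>u. (\<Sum>w=1..M. \<Sum>ys\<in>words n. of_bool (Q w ys) * path_prob (\<lambda>zs. P (e w zs)) ys) / real M
      \<partial>measure_pmf (return_pmf u0))"
    by (rule transmission_law_expectation[OF law measure_pmf.prob_space_axioms, where B = 1]) auto
  finally show ?thesis by simp
qed

text \<open>The error of the first block and a mistaken rejection (\<open>e1\<close> and
  \<open>\<alpha>\<close>) only delay the decision. They need to vanish but carry no exponent, so
  the first block may run close to capacity and leave most of the first \<open>l\<close> uses to the
  confirmation.\<close>

lemma yamamoto_itoh_code:
  fixes P :: "'x::finite \<Rightarrow> 'y::finite pmf"
  assumes l: "1 \<le> l" "l = l1 + l2" and K: "2 \<le> K" and M: "1 \<le> M"
    and d1: "\<And>ys. d1 ys \<in> {1..M}" and d3: "\<And>ys. d3 ys \<in> {1..M}"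
    and e1: "(\<Sum>w=1..M. \<Sum>ys\<in>words l1. if d1 ys \<noteq> w then path_prob (\<lambda>zs. P (c1 w (length zs))) ys else 0) \<le> real M * e1"
    and e3: "(\<Sum>w=1..M. \<Sum>ys\<in>words ((K - 1) * l). if d3 ys \<noteq> w then path_prob (\<lambda>zs. P (c3 w (length zs))) ys else 0) \<le> real M * e3"
    and \<alpha>: "(\<Sum>ys\<in>words l2 - A. path_prob (\<lambda>_. P x) ys) \<le> \<alpha>"
    and \<beta>: "(\<Sum>ys\<in>words l2 \<inter> A. path_prob (\<lambda>_. P x') ys) \<le> \<beta>"
    and \<epsilon>: "0 < \<epsilon>" "\<epsilon> < 1" "\<beta> + e3 \<le> \<epsilon>"
  shows "\<exists>(PU :: 'u measure) f g \<Omega> \<tau>. aflf_code P l M 0 K \<epsilon> PU f g \<Omega> \<tau> \<and> \<P>(\<omega> in \<Omega>. \<tau> \<omega> > l) \<le> e1 + \<alpha>"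
proof -
  \<comment> \<open>Feedback lets the sender evaluate \<open>d1\<close> itself: \<open>x\<close>
    confirms the tentative decision and \<open>x'\<close> rejects it.\<close>
  define e where "e w ys = (if length ys < l1 then c1 w (length ys)
      else if length ys < l then (if d1 (take l1 ys) = w then x else x') else c3 w (length ys - l))" for w ys
  define acc where "acc ys \<longleftrightarrow> drop l1 (take l ys) \<in> A" for ys
  define \<tau> :: "('u, 'y) outcome \<Rightarrow> nat" where "\<tau> = (\<lambda>(u, w, y). if acc (past y l) then l else K * l)"
  \<comment> \<open>The length of the word tells the decoder which decision is due; this is
    unambiguous as \<open>l < K * l\<close>.\<close>
  define g :: "'u \<Rightarrow> 'y list \<Rightarrow> nat" where "g u ys = (if length ys = l then d1 (take l1 ys) else d3 (drop l ys))" for u ys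
  define u0 :: 'u where "u0 = undefined"
  define PU where "PU = measure_pmf (return_pmf u0)"
  obtain \<Omega> where law: "transmission_law P PU M (\<lambda>_. e) \<Omega>"
    unfolding PU_def using transmission_law_exists[OF M, of P u0 e] by blast
  interpret \<Omega>: prob_space \<Omega> using law by (simp add: transmission_law_def)
  have sp: "space \<Omega> = UNIV \<times> {1..M} \<times> UNIV"
    using law sets_eq_imp_space_eq[of \<Omega> "outcome_algebra PU M"]
    by (simp add: transmission_law_def space_outcome_algebra PU_def)
  have Kl: "K * l = l + (K - 1) * l" using K by (cases K) auto
  moreover have "0 < (K - 1) * l" using l(1) K by simp
  ultimately have Klgt: "l < K * l" by linarith
  note prob = prob_deterministic_code[OF law[unfolded PU_def]]
  let ?pp = "\<lambda>w. path_prob (\<lambda>zs. P (e w zs))"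
  let ?c = "\<lambda>w. path_prob (\<lambda>zs. P (c1 w (length zs)))" and ?t = "\<lambda>w. path_prob (\<lambda>zs. P (c3 w (length zs)))"
    and ?q = "path_prob (\<lambda>_. P x)" and ?q' = "path_prob (\<lambda>_. P x')" and ?W = "words ((K - 1) * l) :: 'y list set"
  \<comment> \<open>For each message: a wrong tentative decision that is accepted, a rejection of
    whatever kind, and an error of the fallback block.\<close>
  let ?F1 = "\<lambda>w. \<Sum>us\<in>words l1. \<Sum>vs\<in>words l2. of_bool (d1 us \<noteq> w \<and> vs \<in> A) * ?pp w (us @ vs)"
    and ?L1 = "\<lambda>w. \<Sum>us\<in>words l1. \<Sum>vs\<in>words l2. of_bool (vs \<notin> A) * ?pp w (us @ vs)"
    and ?F3 = "\<lambda>w. \<Sum>us\<in>words l. \<Sum>vs\<in>?W. of_bool (d3 vs \<noteq> w) * ?pp w (us @ vs)"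
  have M0: "0 < real M" using M by simp
  have first: "?pp w (us @ vs) = ?c w us *
      path_prob (\<lambda>_. P (if d1 us = w then x else x')) vs"
    if "us \<in> words l1" "vs \<in> words l2" for w us vs
    unfolding path_prob_append
    by (intro arg_cong2[where f = "(*)"] path_prob_cong) (use that l in \<open>auto simp: e_def\<close>)
  have last: "?pp w (us @ vs) = ?pp w us * ?t w vs"
    if "us \<in> words l" for w us vs
    unfolding path_prob_append
    by (intro arg_cong2[where f = "(*)"] path_prob_cong) (use that l in \<open>auto simp: e_def\<close>)
  have fail1: "(\<Sum>w=1..M. ?F1 w) \<le> real M * \<beta>"
  proof -
    \<comment> \<open>Only the misread rejection counts here; the probability of the wrong tentative
      decision is bounded by 1.\<close>
    have "?F1 w \<le> \<beta>" for w
    proof -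
      have "?F1 w \<le>
          (\<Sum>us\<in>words l1. ?c w us * (\<Sum>vs\<in>words l2 \<inter> A. ?q' vs))"
      proof (intro sum_mono)
        fix us :: "'y list" assume us: "us \<in> words l1"
        have "(\<Sum>vs\<in>words l2. of_bool (d1 us \<noteq> w \<and> vs \<in> A) * ?pp w (us @ vs)) =
            (\<Sum>vs\<in>words l2. if vs \<in> A then of_bool (d1 us \<noteq> w) * (?c w us * ?q' vs) else 0)"
          using us by (intro sum.cong refl) (auto simp: first)
        also have "\<dots> = of_bool (d1 us \<noteq> w) * (?c w us * (\<Sum>vs\<in>words l2 \<inter> A. ?q' vs))"
          unfolding sum_distrib_left by (rule sum.inter_restrict[symmetric]) simp
        also have "\<dots> \<le> ?c w us * (\<Sum>vs\<in>words l2 \<inter> A. ?q' vs)"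
          by (auto intro!: mult_nonneg_nonneg sum_nonneg)
        finally show "(\<Sum>vs\<in>words l2. of_bool (d1 us \<noteq> w \<and> vs \<in> A) * ?pp w (us @ vs)) \<le> \<dots>" .
      qed
      also have "\<dots> = (\<Sum>vs\<in>words l2 \<inter> A. ?q' vs)"
        by (simp flip: sum_distrib_right)
      finally show ?thesis using \<beta> by simp
    qed
    then have "(\<Sum>w=1..M. ?F1 w) \<le> (\<Sum>w=1..M. \<beta>)"
      by (intro sum_mono)
    then show ?thesis by simp
  qed
  have late1: "(\<Sum>w=1..M. ?L1 w) \<le> real M * (e1 + \<alpha>)"
  proof -
    \<comment> \<open>Either the tentative decision is wrong, or it is right and its confirmation is
      misread.\<close>
    have "?L1 w \<le>
        (\<Sum>us\<in>words l1. if d1 us \<noteq> w then ?c w us else 0) + \<alpha>" for w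
    proof -
      have "(\<Sum>vs\<in>words l2. of_bool (vs \<notin> A) * ?pp w (us @ vs)) \<le> (if d1 us \<noteq> w then ?c w us else 0) + ?c w us * \<alpha>"
        if us: "us \<in> words l1" for us
      proof (cases "d1 us = w")
        case True
        have "(\<Sum>vs\<in>words l2. of_bool (vs \<notin> A) * ?pp w (us @ vs)) = (\<Sum>vs\<in>words l2. if vs \<in> - A then ?c w us * ?q vs else 0)"
          using us True by (intro sum.cong refl) (auto simp: first)
        also have "\<dots> = ?c w us * (\<Sum>vs\<in>words l2 - A. ?q vs)"
          unfolding sum_distrib_left Diff_eq by (rule sum.inter_restrict[symmetric]) simp
        also have "\<dots> \<le> ?c w us * \<alpha>" using \<alpha> by (intro mult_left_mono) auto
        finally show ?thesis using True by simp
      next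
        case False
        have "(\<Sum>vs\<in>words l2. of_bool (vs \<notin> A) * ?pp w (us @ vs)) \<le> (\<Sum>vs\<in>words l2. ?c w us * ?q' vs)"
          using us False by (intro sum_mono) (auto simp: first)
        also have "\<dots> = ?c w us" by (simp flip: sum_distrib_left)
        also have "0 \<le> \<alpha>" using \<alpha> sum_nonneg[of "words l2 - A" "?q"] by simp
        then have "?c w us \<le> ?c w us + ?c w us * \<alpha>" by simp
        finally show ?thesis using False by simp
      qed
      then have "?L1 w \<le>
          (\<Sum>us\<in>words l1. (if d1 us \<noteq> w then ?c w us else 0) + ?c w us * \<alpha>)"
        by (intro sum_mono)
      also have "\<dots> = (\<Sum>us\<in>words l1. if d1 us \<noteq> w then ?c w us else 0) + \<alpha>"
        by (simp only: sum.distrib sum_distrib_right[symmetric] sum_path_prob mult_1)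
      finally show ?thesis .
    qed
    then have "(\<Sum>w=1..M. ?L1 w) \<le>
        (\<Sum>w=1..M. (\<Sum>us\<in>words l1. if d1 us \<noteq> w then ?c w us else 0) + \<alpha>)"
      by (intro sum_mono)
    also have "\<dots> \<le> real M * e1 + real M * \<alpha>" using e1 by (simp add: sum.distrib)
    finally show ?thesis by (simp add: distrib_left)
  qed
  have fail3: "(\<Sum>w=1..M. ?F3 w) \<le> real M * e3"
  proof -
    have "?F3 w =
        (\<Sum>ys\<in>?W. if d3 ys \<noteq> w then ?t w ys else 0)" for w
    proof -
      have "?F3 w =
          (\<Sum>us\<in>words l. ?pp w us * (\<Sum>ys\<in>?W. if d3 ys \<noteq> w then ?t w ys else 0))"
        unfolding sum_distrib_left by (intro sum.cong refl) (auto simp: last)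
      then show ?thesis by (simp only: sum_distrib_right[symmetric] sum_path_prob mult_1)
    qed
    then show ?thesis using e3 by simp
  qed
  have late: "\<P>(\<omega> in \<Omega>. \<tau> \<omega> > l) \<le> e1 + \<alpha>"
  proof -
    have "{\<omega> \<in> space \<Omega>. \<tau> \<omega> > l} = {\<omega> \<in> space \<Omega>. case \<omega> of (u, w, y) \<Rightarrow> \<not> acc (past y l)}"
      using Klgt by (auto simp: \<tau>_def split: if_splits)
    then have "\<P>(\<omega> in \<Omega>. \<tau> \<omega> > l) = (\<Sum>w=1..M. \<Sum>ys\<in>words (l1 + l2). of_bool (\<not> acc ys) * ?pp w ys) / real M"
      using prob[of "\<lambda>_ ys. \<not> acc ys" l] l by simp
    also have "(\<Sum>w=1..M. \<Sum>ys\<in>words (l1 + l2). of_bool (\<not> acc ys) * ?pp w ys) =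
        (\<Sum>w=1..M. ?L1 w)"
      unfolding sum_words_add using l by (intro sum.cong refl) (auto simp: acc_def)
    also have "\<dots> / real M \<le> real M * (e1 + \<alpha>) / real M"
      using late1 by (rule divide_right_mono) simp
    finally show ?thesis using M0 by simp
  qed
  have error: "\<P>(\<omega> in \<Omega>. case \<omega> of (u, w, y) \<Rightarrow> g u (past y (\<tau> \<omega>)) \<noteq> w) \<le> \<epsilon>"
  proof -
    define Q where "Q w ys \<longleftrightarrow> (if acc ys then d1 (take l1 ys) \<noteq> w else d3 (drop l ys) \<noteq> w)" for w ys
    have "{\<omega> \<in> space \<Omega>. case \<omega> of (u, w, y) \<Rightarrow> g u (past y (\<tau> \<omega>)) \<noteq> w} =
        {\<omega> \<in> space \<Omega>. case \<omega> of (u, w, y) \<Rightarrow> Q w (past y (K * l))}"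
    proof (intro Collect_cong conj_cong refl)
      fix \<omega> :: "('u, 'y) outcome"
      obtain u w y where \<omega>: "\<omega> = (u, w, y)" by (cases \<omega>)
      have a: "acc (past y (K * l)) = acc (past y l)" using Klgt by (simp add: acc_def take_past)
      then show "(case \<omega> of (u, w, y) \<Rightarrow> g u (past y (\<tau> \<omega>)) \<noteq> w) = (case \<omega> of (u, w, y) \<Rightarrow> Q w (past y (K * l)))"
      proof -
        have l1: "l1 \<le> l" using l(2) by simp
        then have "l1 \<le> K * l" using Klgt by linarith
        with l1 Klgt a show ?thesis by (simp add: \<omega> g_def \<tau>_def Q_def take_past)
      qed
    qed
    then have "\<P>(\<omega> in \<Omega>. case \<omega> of (u, w, y) \<Rightarrow> g u (past y (\<tau> \<omega>)) \<noteq> w) =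
        (\<Sum>w=1..M. \<Sum>ys\<in>words (K * l). of_bool (Q w ys) * ?pp w ys) / real M"
      using prob[of Q "K * l"] by simp
    \<comment> \<open>Union bound: the fallback error is counted whether or not the fallback is
      used, so that it reduces to the plain error of a block code.\<close>
    also have "(\<Sum>w=1..M. \<Sum>ys\<in>words (K * l). of_bool (Q w ys) * ?pp w ys) \<le>
        (\<Sum>w=1..M. ?F1 w +
          ?F3 w)"
    proof (intro sum_mono)
      fix w
      have "(\<Sum>ys\<in>words (K * l). of_bool (Q w ys) * ?pp w ys) \<le>
          (\<Sum>us\<in>words l. \<Sum>vs\<in>?W. of_bool (d1 (take l1 us) \<noteq> w \<and> drop l1 us \<in> A) * ?pp w (us @ vs)
            + of_bool (d3 vs \<noteq> w) * ?pp w (us @ vs))"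
        unfolding Kl sum_words_add using l by (intro sum_mono) (auto simp: Q_def acc_def)
      also have "\<dots> = (\<Sum>us\<in>words l. of_bool (d1 (take l1 us) \<noteq> w \<and> drop l1 us \<in> A) * ?pp w us) +
          ?F3 w"
      proof -
        have "(\<Sum>vs\<in>?W. t * ?pp w (us @ vs)) = t * ?pp w us" if "us \<in> words l" for us t
        proof -
          have "(\<Sum>vs\<in>?W. t * ?pp w (us @ vs)) =
              t * ?pp w us * (\<Sum>vs\<in>?W. ?t w vs)"
            unfolding sum_distrib_left using that by (intro sum.cong refl) (simp add: last)
          then show ?thesis by (simp only: sum_path_prob mult_1_right)
        qed
        then have "(\<Sum>us\<in>words l. \<Sum>vs\<in>?W. of_bool (d1 (take l1 us) \<noteq> w \<and> drop l1 us \<in> A) * ?pp w (us @ vs)) =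
            (\<Sum>us\<in>words l. of_bool (d1 (take l1 us) \<noteq> w \<and> drop l1 us \<in> A) * ?pp w us)"
          by (rule sum.cong[OF refl])
        then show ?thesis by (simp only: sum.distrib)
      qed
      also have "(\<Sum>us\<in>words l. of_bool (d1 (take l1 us) \<noteq> w \<and> drop l1 us \<in> A) * ?pp w us) =
          ?F1 w"
        unfolding l(2) sum_words_add by (intro sum.cong refl) auto
      finally show "(\<Sum>ys\<in>words (K * l). of_bool (Q w ys) * ?pp w ys) \<le>
        ?F1 w +
          ?F3 w" .
    qed
    also have "\<dots> \<le> real M * \<beta> + real M * e3"
      unfolding sum.distrib using fail1 fail3 by (rule add_mono)
    also have "\<dots> / real M \<le> \<epsilon>" using \<epsilon>(3) M0 by (simp add: add_divide_distrib)
    finally show ?thesis using M0 by (simp add: divide_right_mono)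
  qed
  have st: "stopping_time (receiver_info PU \<Omega>) \<tau>"
  proof (rule stopping_timeI)
    fix n
    define B where "B ys \<longleftrightarrow> (l \<le> n \<and> acc ys) \<or> K * l \<le> n" for ys
    have "(\<lambda>(u, w, y). (u, past y n)) \<in> measurable (receiver_info PU \<Omega> n) (PU \<Otimes>\<^sub>M count_space (UNIV :: 'y list set))"
      unfolding receiver_info_def
      by (rule measurable_vimage_algebra1) (auto simp: sp space_pair_measure PU_def)
    moreover have "Measurable.pred (PU \<Otimes>\<^sub>M count_space UNIV) (\<lambda>p. B (snd p))"
      by (rule measurable_compose[OF measurable_snd]) simp
    ultimately have "Measurable.pred (receiver_info PU \<Omega> n) (\<lambda>\<omega>. B (snd ((\<lambda>(u, w, y). (u, past y n)) \<omega>)))"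
      by (rule measurable_compose)
    moreover have "B (snd ((\<lambda>(u, w, y). (u, past y n)) \<omega>)) \<longleftrightarrow> \<tau> \<omega> \<le> n" for \<omega> :: "('u, 'y) outcome"
    proof -
      obtain u w y where \<omega>: "\<omega> = (u, w, y)" by (cases \<omega>)
      have "l \<le> n \<Longrightarrow> acc (past y n) = acc (past y l)" by (simp add: acc_def take_past)
      moreover have "K * l \<le> n \<Longrightarrow> l \<le> n" using Klgt by linarith
      ultimately show ?thesis by (auto simp: B_def \<omega> \<tau>_def)
    qed
    ultimately show "Measurable.pred (receiver_info PU \<Omega> n) (\<lambda>\<omega>. \<tau> \<omega> \<le> n)" by simp
  qed
  have "aflf_code P l M 0 K \<epsilon> PU (\<lambda>_. e) g \<Omega> \<tau>"
    unfolding aflf_code_def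
  proof (intro conjI)
    show "prob_space PU" unfolding PU_def by (rule measure_pmf.prob_space_axioms)
    show "\<forall>ys. (\<lambda>u. g u ys) \<in> PU \<rightarrow>\<^sub>M count_space {1..M}"
      using d1 d3 by (auto simp: PU_def g_def)
    show "AE \<omega> in \<Omega>. \<tau> \<omega> \<le> K * l" using Klgt by (intro AE_I2) (auto simp: \<tau>_def)
    show "\<forall>\<omega>\<in>space \<Omega>. 1 \<le> \<tau> \<omega>" using l Klgt by (auto simp: \<tau>_def)
  qed (use l K M \<epsilon> law st error in \<open>auto simp: PU_def\<close>)
  with late show ?thesis by blast
qed

text \<open>Announcing message 1 after a single use errs with probability
  \<open>1 - 1 / real M\<close>. This gives exponent 0 for every \<open>K\<close>, in particular for
  \<open>K = 1\<close>, where no fallback block fits.\<close>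

lemma trivial_code:
  fixes P :: "'x::finite \<Rightarrow> 'y::finite pmf"
  assumes l: "1 \<le> l" and K: "1 \<le> K" and M: "1 \<le> M"
    and \<epsilon>: "1 - 1 / real M \<le> \<epsilon>" "0 < \<epsilon>" "\<epsilon> < 1"
  shows "\<exists>(PU :: 'u measure) f g \<Omega> \<tau>. aflf_code P l M 0 K \<epsilon> PU f g \<Omega> \<tau> \<and> \<P>(\<omega> in \<Omega>. \<tau> \<omega> > l) = 0"
proof -
  define u0 :: 'u where "u0 = undefined"
  define PU where "PU = measure_pmf (return_pmf u0)"
  define \<tau> :: "('u, 'y) outcome \<Rightarrow> nat" where "\<tau> = (\<lambda>_. 1)"
  obtain \<Omega> where law: "transmission_law P PU M (\<lambda>_ _ _. undefined) \<Omega>"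
    unfolding PU_def using transmission_law_exists[OF M, of P u0 "\<lambda>_ _. undefined"] by blast
  interpret \<Omega>: prob_space \<Omega> using law by (simp add: transmission_law_def)
  have "\<P>(\<omega> in \<Omega>. case \<omega> of (u, w, y) \<Rightarrow> 1 \<noteq> w) =
      (\<Sum>w=1..M. \<Sum>ys\<in>words 0. of_bool (1 \<noteq> w) * path_prob (\<lambda>zs. P undefined) (ys :: 'y list)) / real M"
    using prob_deterministic_code[OF law[unfolded PU_def], of "\<lambda>w _. 1 \<noteq> w" 0] .
  also have "(\<Sum>w=1..M. \<Sum>ys\<in>words 0. of_bool (1 \<noteq> w) * path_prob (\<lambda>zs. P undefined) (ys :: 'y list)) =
      real (card {2..M})"
  proof -
    have "{1..M} \<inter> {w. 1 \<noteq> w} = {2..M}" by auto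
    then show ?thesis by simp
  qed
  also have "\<dots> / real M \<le> \<epsilon>" using \<epsilon>(1) M by (simp add: of_nat_diff diff_divide_distrib)
  finally have error: "\<P>(\<omega> in \<Omega>. case \<omega> of (u, w, y) \<Rightarrow> 1 \<noteq> w) \<le> \<epsilon>" .
  have "aflf_code P l M 0 K \<epsilon> PU (\<lambda>_ _ _. undefined) (\<lambda>_ _. 1) \<Omega> \<tau>"
    unfolding aflf_code_def
  proof (intro conjI)
    show "prob_space PU" unfolding PU_def by (rule measure_pmf.prob_space_axioms)
    show "stopping_time (receiver_info PU \<Omega>) \<tau>" unfolding \<tau>_def by (rule stopping_time_const)
    show "AE \<omega> in \<Omega>. \<tau> \<omega> \<le> K * l" using l K by (intro AE_I2) (auto simp: \<tau>_def)
  qed (use l K M \<epsilon> law error in \<open>auto simp: PU_def \<tau>_def\<close>)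
  moreover have "\<P>(\<omega> in \<Omega>. \<tau> \<omega> > l) = 0" using l by (simp add: \<tau>_def)
  ultimately show ?thesis by blast
qed

section \<open>The exponent\<close>

lemma C1_nonneg: "0 \<le> C1 P" for P :: "'x::finite \<Rightarrow> 'y::finite pmf"
proof -
  have "pmf p a * log 2 (pmf p a / pmf p a) = 0" for p :: "'y pmf" and a
    by (cases "pmf p a = 0") auto
  then have "kl_div p p = 0" for p :: "'y pmf" unfolding kl_div_eq_sum by (simp only: sum.neutral_const) simp
  then show ?thesis using kl_div_le_C1[of P undefined undefined] by simp
qed

lemma powr_linear_tendsto_0:
  fixes a d :: real
  assumes "0 < d"
  shows "(\<lambda>l. 2 powr (a - real l * d)) \<longlonglongrightarrow> 0"
proof -
  have "(2 :: real) powr (- d) < 1" using assms powr_less_mono[of "- d" 0 2] by simp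
  then have "(\<lambda>l. 2 powr a * (2 powr (- d)) ^ l) \<longlonglongrightarrow> 2 powr a * 0"
    by (intro tendsto_mult_left LIMSEQ_realpow_zero) auto
  moreover have "2 powr (a - real l * d) = 2 powr a * (2 powr (- d)) ^ l" for l
    by (simp add: powr_realpow[symmetric] powr_powr powr_add[symmetric] mult.commute)
  ultimately show ?thesis by simp
qed

lemma achievable_zero:
  fixes P :: "'x::finite \<Rightarrow> 'y::finite pmf"
  assumes "0 \<le> R" "1 \<le> K"
  shows "achievable TYPE('u) P R 0 K 0"
  unfolding achievable_def
proof (rule allI, rule impI, rule exI[of _ 1], rule allI, rule impI)
  fix \<delta> :: real and l :: nat assume \<delta>: "0 < \<delta>" and l: "1 \<le> l"
  define M where "M = nat \<lceil>2 powr (real l * R)\<rceil>"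
  have M: "2 powr (real l * R) \<le> real M" by (simp add: M_def real_nat_ceiling_ge)
  moreover have "0 < 2 powr (real l * R)" by simp
  ultimately have "0 < real M" by linarith
  then have M1: "1 \<le> M" by simp
  \<comment> \<open>The factor 2 keeps \<epsilon> strictly between 0 and 1 even for
    \<open>M = 1\<close>.\<close>
  have \<epsilon>: "1 - 1 / real M \<le> 1 - 1 / (2 * real M)" "0 < 1 - 1 / (2 * real M)" "1 - 1 / (2 * real M) < 1"
    using M1 by (auto simp: field_simps)
  from trivial_code[OF l assms(2) M1 \<epsilon>, of P]
  obtain PU :: "'u measure" and f g \<Omega> \<tau> where
    code: "aflf_code P l M 0 K (1 - 1 / (2 * real M)) PU f g \<Omega> \<tau>"
    and late: "\<P>(\<omega> in \<Omega>. \<tau> \<omega> > l) = 0"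
    by blast
  have "1 \<le> 2 powr (- real l * (0 - \<delta>))"
    using \<delta> by (simp add: ge_one_powr_ge_zero)
  then have \<epsilon>le: "1 - 1 / (2 * real M) \<le> 2 powr (- real l * (0 - \<delta>))" using \<epsilon>(3) by linarith
  have "\<P>(\<omega> in \<Omega>. \<tau> \<omega> > l) \<le> \<delta>" using late \<delta> by linarith
  with code M \<epsilon>le show "\<exists>M \<epsilon> (PU :: 'u measure) f g \<Omega> \<tau>.
      aflf_code P l M 0 K \<epsilon> PU f g \<Omega> \<tau> \<and> real M \<ge> 2 powr (real l * R) \<and>
      \<epsilon> \<le> 2 powr (- real l * (0 - \<delta>)) \<and> \<P>(\<omega> in \<Omega>. \<tau> \<omega> > l) \<le> \<delta>"
    by blast
qed

text \<open>Strict inequalities leave room for every parameter: the test exponent \<open>c\<close>,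
  the fraction \<open>s\<close> of the first block, and near-optimal pairs for the two block
  codes.\<close>

lemma achievable_below_min:
  fixes P :: "'x::finite \<Rightarrow> 'y::finite pmf"
  assumes R: "0 \<le> R" "R < capacity P" and K: "2 \<le> K" and E: "0 < E"
    and E1: "ereal E < C1 P * ereal (1 - R / capacity P)"
    and E2: "E < (real K - 1) * Er P (R / (real K - 1))"
  shows "achievable TYPE('u) P R 0 K E"
proof -
  let ?C = "capacity P"
  have C: "0 < ?C" using R by linarith
  have RC: "0 < 1 - R / ?C" "0 \<le> R / ?C" using R C by (auto simp: field_simps)
  have "ereal (E / (1 - R / ?C)) < C1 P"
    using E1 RC E C1_nonneg[of P] by (cases "C1 P") (auto simp: field_simps)
  \<comment> \<open>\<open>C1 P\<close> may be infinite, so a real \<open>c\<close> below it is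
    used.\<close>
  then obtain c where c: "E / (1 - R / ?C) < c" "ereal c < C1 P"
    using ereal_dense2[of "ereal (E / (1 - R / ?C))" "C1 P"] by auto
  have Ec: "E < c * (1 - R / ?C)" using c(1) RC(1) by (simp add: field_simps)
  have c0: "0 < c" using c(1) E RC(1) by (meson divide_pos_pos less_trans)
  \<comment> \<open>Above \<open>R / ?C\<close>, the first block has rate \<open>R / s\<close> below
    capacity; below \<open>1 - E / c\<close>, the remaining uses give the confirmation an exponent
    above \<open>E\<close>.\<close>
  obtain s where s: "R / ?C < s" "s < 1 - E / c"
  proof -
    have "E / c < 1 - R / ?C" using Ec c0 by (simp add: pos_divide_less_eq mult.commute)
    then have "R / ?C < 1 - E / c" by linarith
    then show ?thesis using dense that by blast
  qed
  have s01: "0 < s" "s < 1" using s RC(2) divide_pos_pos[OF E c0] by linarith+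
  have sE: "E < (1 - s) * c" using s(2) c0 by (simp add: field_simps)
  have "R / s < ?C" using s(1) s01 C by (simp add: field_simps)
  then obtain \<rho>1 Q1 where \<rho>1: "0 \<le> \<rho>1" "\<rho>1 \<le> 1" "\<rho>1 * (R / s) < E0 P \<rho>1 Q1"
    using E0_exceeds by blast
  define a where "a = E0 P \<rho>1 Q1 - \<rho>1 * (R / s)"
  have a: "0 < a" using \<rho>1 by (simp add: a_def)
  have K1: "0 < real K - 1" using K by simp
  have "E / (real K - 1) < Er P (R / (real K - 1))" using E2 K1 by (simp add: field_simps)
  from less_Er[OF this] obtain \<rho> Q where \<rho>: "0 \<le> \<rho>" "\<rho> \<le> 1"
    and EQ: "E / (real K - 1) < E0 P \<rho> Q - \<rho> * (R / (real K - 1))" by blast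
  \<comment> \<open>The fallback block has length \<open>(K - 1) * l\<close> and rate
    \<open>R / (real K - 1)\<close>; \<open>b\<close> is its exponent per unit of
    \<open>l\<close>.\<close>
  define b where "b = (real K - 1) * E0 P \<rho> Q - \<rho> * R"
  have b: "E < b"
  proof -
    have "b = (E0 P \<rho> Q - \<rho> * (R / (real K - 1))) * (real K - 1)"
      using K1 unfolding left_diff_distrib by (simp add: b_def mult.commute)
    then show ?thesis using EQ K1 by (simp add: pos_divide_less_eq)
  qed
  from stein_test[OF c(2)] obtain x x' \<beta> where \<beta>: "0 \<le> \<beta>" "\<beta> < 1" and
    test: "\<And>n. \<exists>A. (\<Sum>ys\<in>words n - A. path_prob (\<lambda>_. P x) ys) \<le> \<beta> ^ n \<and>
      (\<Sum>ys\<in>words n \<inter> A. path_prob (\<lambda>_. P x') ys) \<le> 2 powr (- real n * c)" by blast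
  \<comment> \<open>Rounding up preserves the rate of the first block and costs the confirmation at
    most one use, which is the additive \<open>c\<close> in the exponents below.\<close>
  define l1 where "l1 l = nat \<lceil>s * real l\<rceil>" for l
  define l2 where "l2 l = l - l1 l" for l
  have l1: "s * real l \<le> real (l1 l)" for l by (simp add: l1_def real_nat_ceiling_ge)
  have l1_le: "l1 l \<le> l" for l
  proof -
    have "s * real l \<le> real l" using s01 by (simp add: mult_left_le_one_le)
    then show ?thesis unfolding l1_def by linarith
  qed
  have l2: "(1 - s) * real l - 1 \<le> real (l2 l)" for l
  proof -
    have "real (l1 l) \<le> s * real l + 1"
      using s01 unfolding l1_def by (simp add: of_nat_nat)
    then show ?thesis using l1_le[of l] by (simp add: l2_def of_nat_diff algebra_simps)
  qed
  have "filterlim l2 at_top sequentially"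
  proof -
    have "filterlim (\<lambda>l. - 1 + (1 - s) * real l) at_top sequentially"
      using s01 by (intro filterlim_tendsto_add_at_top[OF tendsto_const] filterlim_tendsto_pos_mult_at_top[OF tendsto_const] filterlim_real_sequentially) auto
    then have "filterlim (\<lambda>l. real (l2 l)) at_top sequentially"
      by (rule filterlim_at_top_mono) (use l2 in \<open>auto simp: algebra_simps\<close>)
    then show ?thesis by (simp add: filterlim_sequentially_iff_filterlim_real)
  qed
  then have lim\<beta>: "(\<lambda>l. \<beta> ^ l2 l) \<longlonglongrightarrow> 0"
    using \<beta> by (intro filterlim_compose[OF LIMSEQ_realpow_zero]) auto
  show ?thesis
    unfolding achievable_def
  proof (intro allI impI)
    fix \<delta> :: real assume \<delta>: "0 < \<delta>"
    have "(\<lambda>l. 2 powr (0 - real l * (s * a)) + \<beta> ^ l2 l) \<longlonglongrightarrow> 0 + 0"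
      using s01 a by (intro tendsto_add lim\<beta> powr_linear_tendsto_0) simp
    then have ev1: "eventually (\<lambda>l. 2 powr (0 - real l * (s * a)) + \<beta> ^ l2 l < \<delta>) sequentially"
      using \<delta> by (intro order_tendstoD) auto
    have "(\<lambda>l. 2 powr (c - real l * ((1 - s) * c - E)) + 2 powr (0 - real l * (b - E))) \<longlonglongrightarrow> 0 + 0"
      using sE b by (intro tendsto_add powr_linear_tendsto_0) auto
    then have ev2: "eventually (\<lambda>l. 2 powr (c - real l * ((1 - s) * c - E)) + 2 powr (0 - real l * (b - E)) < 1) sequentially"
      by (intro order_tendstoD) auto
    from eventually_conj[OF ev1 eventually_conj[OF ev2 eventually_ge_at_top[of 1]]]
    obtain l0 where l0: "\<And>l. l0 \<le> l \<Longrightarrow> 2 powr (0 - real l * (s * a)) + \<beta> ^ l2 l < \<delta> \<and>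
        2 powr (c - real l * ((1 - s) * c - E)) + 2 powr (0 - real l * (b - E)) < 1 \<and> 1 \<le> l"
      unfolding eventually_sequentially by blast
    show "\<exists>l0. \<forall>l\<ge>l0. \<exists>M \<epsilon> (PU :: 'u measure) f g \<Omega> \<tau>.
        aflf_code P l M 0 K \<epsilon> PU f g \<Omega> \<tau> \<and> real M \<ge> 2 powr (real l * R) \<and>
        \<epsilon> \<le> 2 powr (- real l * (E - \<delta>)) \<and> \<P>(\<omega> in \<Omega>. \<tau> \<omega> > l) \<le> \<delta>"
    proof (rule exI[of _ l0], intro allI impI)
      fix l assume "l0 \<le> l"
      note ll = l0[OF this]
      have l: "1 \<le> l" using ll by simp
      define M where "M = nat \<lceil>2 powr (real l * R)\<rceil>"
      have M: "2 powr (real l * R) \<le> real M" by (simp add: M_def real_nat_ceiling_ge)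
      have "0 < 2 powr (real l * R)" by simp
      with M have "0 < real M" by linarith
      then have M1: "1 \<le> M" by simp
      \<comment> \<open>Gallager's bound contains \<open>M - 1\<close>, so rounding the number of
        messages up costs nothing.\<close>
      have Mle: "real (M - 1) \<le> 2 powr (real l * R)"
      proof -
        have "real M \<le> 2 powr (real l * R) + 1" unfolding M_def by (simp add: of_nat_nat)
        then show ?thesis using M1 by (simp add: of_nat_diff)
      qed
      have Mpow: "real (M - 1) powr r \<le> 2 powr (real l * R * r)" if "0 \<le> r" for r
        using powr_mono2[OF that _ Mle] by (simp add: powr_powr)
      obtain c1 d1 where d1: "\<And>ys. d1 ys \<in> {1..M}" and
        e1: "(\<Sum>w=1..M. \<Sum>ys\<in>words (l1 l). if d1 ys \<noteq> w then path_prob (\<lambda>zs. P (c1 w (length zs))) ys else 0) \<le>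
          real M * (real (M - 1) powr \<rho>1 * 2 powr (- real (l1 l) * E0 P \<rho>1 Q1))"
        using block_code_exists[OF M1 \<rho>1(1,2), where n = "l1 l" and P = P and Q = Q1] by blast
      obtain c3 d3 where d3: "\<And>ys. d3 ys \<in> {1..M}" and
        e3: "(\<Sum>w=1..M. \<Sum>ys\<in>words ((K - 1) * l). if d3 ys \<noteq> w then path_prob (\<lambda>zs. P (c3 w (length zs))) ys else 0) \<le>
          real M * (real (M - 1) powr \<rho> * 2 powr (- real ((K - 1) * l) * E0 P \<rho> Q))"
        using block_code_exists[OF M1 \<rho>, where n = "(K - 1) * l" and P = P and Q = Q] by blast
      obtain A where A: "(\<Sum>ys\<in>words (l2 l) - A. path_prob (\<lambda>_. P x) ys) \<le> \<beta> ^ l2 l"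
        "(\<Sum>ys\<in>words (l2 l) \<inter> A. path_prob (\<lambda>_. P x') ys) \<le> 2 powr (- real (l2 l) * c)"
        using test by blast
      have first: "real (M - 1) powr \<rho>1 * 2 powr (- real (l1 l) * E0 P \<rho>1 Q1) \<le> 2 powr (0 - real l * (s * a))"
      proof -
        have "real (M - 1) powr \<rho>1 * 2 powr (- real (l1 l) * E0 P \<rho>1 Q1) \<le>
            2 powr (real l * R * \<rho>1) * 2 powr (- real (l1 l) * E0 P \<rho>1 Q1)"
          using Mpow[OF \<rho>1(1)] by (intro mult_right_mono) auto
        also have "\<dots> = 2 powr (real l * R * \<rho>1 - real (l1 l) * E0 P \<rho>1 Q1)"
          by (simp flip: powr_add)
        also have "\<dots> \<le> 2 powr (0 - real l * (s * a))"
        proof (intro powr_mono)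
          have E0: "0 \<le> E0 P \<rho>1 Q1" using \<rho>1 R s01 by (smt (verit) divide_nonneg_pos mult_nonneg_nonneg)
          have "s * real l * E0 P \<rho>1 Q1 \<le> real (l1 l) * E0 P \<rho>1 Q1"
            using l1[of l] E0 by (intro mult_right_mono)
          moreover have "s * real l * E0 P \<rho>1 Q1 - real l * R * \<rho>1 = real l * (s * a)"
            using s01 by (simp add: a_def field_simps)
          ultimately show "real l * R * \<rho>1 - real (l1 l) * E0 P \<rho>1 Q1 \<le> 0 - real l * (s * a)" by linarith
        qed simp
        finally show ?thesis .
      qed
      have third: "real (M - 1) powr \<rho> * 2 powr (- real ((K - 1) * l) * E0 P \<rho> Q) \<le> 2 powr (- real l * b)"
      proof -
        have "real (M - 1) powr \<rho> * 2 powr (- real ((K - 1) * l) * E0 P \<rho> Q) \<le>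
            2 powr (real l * R * \<rho>) * 2 powr (- real ((K - 1) * l) * E0 P \<rho> Q)"
          using Mpow[OF \<rho>(1)] by (intro mult_right_mono) auto
        also have "\<dots> = 2 powr (real l * R * \<rho> - real ((K - 1) * l) * E0 P \<rho> Q)"
          by (simp flip: powr_add)
        also have "real l * R * \<rho> - real ((K - 1) * l) * E0 P \<rho> Q = - real l * b"
          using K by (simp add: b_def of_nat_diff algebra_simps)
        finally show ?thesis .
      qed
      have second: "2 powr (- real (l2 l) * c) \<le> 2 powr (c - real l * ((1 - s) * c))"
      proof (intro powr_mono)
        have "((1 - s) * real l - 1) * c \<le> real (l2 l) * c" using l2[of l] c0 by (intro mult_right_mono) auto
        then show "- real (l2 l) * c \<le> c - real l * ((1 - s) * c)" by (simp add: algebra_simps)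
      qed simp
      \<comment> \<open>The target error itself serves as \<epsilon>; it is below 1 because
        \<open>E\<close> is positive.\<close>
      have \<epsilon>: "0 < 2 powr (- real l * E)" "2 powr (- real l * E) < 1"
        using l E powr_less_mono[of "- real l * E" 0 2] by auto
      have sum: "2 powr (- real (l2 l) * c) + real (M - 1) powr \<rho> * 2 powr (- real ((K - 1) * l) * E0 P \<rho> Q)
          \<le> 2 powr (- real l * E)"
      proof -
        have "2 powr (- real (l2 l) * c) + real (M - 1) powr \<rho> * 2 powr (- real ((K - 1) * l) * E0 P \<rho> Q) \<le>
            2 powr (c - real l * ((1 - s) * c)) + 2 powr (- real l * b)"
          using second third by (rule add_mono)
        also have "\<dots> = 2 powr (- real l * E) *
            (2 powr (c - real l * ((1 - s) * c - E)) + 2 powr (0 - real l * (b - E)))"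
          by (simp add: distrib_left algebra_simps flip: powr_add)
        also have "\<dots> \<le> 2 powr (- real l * E) * 1" using ll by (intro mult_left_mono) auto
        finally show ?thesis by simp
      qed
      have "l = l1 l + l2 l" using l1_le[of l] by (simp add: l2_def)
      from yamamoto_itoh_code[OF l this K M1 d1 d3 e1 e3 A \<epsilon> sum]
      obtain PU :: "'u measure" and f g \<Omega> \<tau> where
        code: "aflf_code P l M 0 K (2 powr (- real l * E)) PU f g \<Omega> \<tau>" and
        late: "\<P>(\<omega> in \<Omega>. \<tau> \<omega> > l) \<le> real (M - 1) powr \<rho>1 * 2 powr (- real (l1 l) * E0 P \<rho>1 Q1) + \<beta> ^ l2 l"
        by blast
      have "\<P>(\<omega> in \<Omega>. \<tau> \<omega> > l) \<le> \<delta>" using late first ll by linarith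
      moreover have "2 powr (- real l * E) \<le> 2 powr (- real l * (E - \<delta>))"
        using \<delta> l by (intro powr_mono) (auto simp: mult_left_mono)
      ultimately show "\<exists>M \<epsilon> (PU :: 'u measure) f g \<Omega> \<tau>.
          aflf_code P l M 0 K \<epsilon> PU f g \<Omega> \<tau> \<and> real M \<ge> 2 powr (real l * R) \<and>
          \<epsilon> \<le> 2 powr (- real l * (E - \<delta>)) \<and> \<P>(\<omega> in \<Omega>. \<tau> \<omega> > l) \<le> \<delta>"
        using code M by blast
    qed
  qed
qed

text \<open>The bound for codes is divided by \<open>l\<close>; first \<open>l\<close> tends to
  infinity with \<delta> fixed, then \<delta> tends to 0, leaving
  \<open>R / C + E / c \<le> 1\<close>.\<close>

lemma achievable_converse:
  fixes P :: "'x::finite \<Rightarrow> 'y::finite pmf"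
  assumes C1: "C1 P = ereal c" and R: "0 < R" "R < capacity P"
    and ach: "achievable TYPE('u) P R 0 K E"
  shows "E \<le> c * (1 - R / capacity P)"
proof (rule ccontr)
  assume neg: "\<not> ?thesis"
  let ?C = "capacity P"
  have C: "0 < ?C" using R by linarith
  have c: "0 < c" using capacity_le_C1[OF C1] C by simp
  have "0 \<le> c * (1 - R / ?C)" using c R C by (simp add: field_simps)
  with neg have E: "0 < E" by linarith
  \<comment> \<open>One \<delta> plays three parts: confidence level of the leader, slack of the
    exponent, and bound on the probability of late stopping. The zeros are the limits of the terms
    in \<open>r l\<close>.\<close>
  have step: "(1 - \<delta>) * R / ?C * (1 - 0 / \<delta>) + (E - \<delta>) * (1 - 0 / \<delta> - \<delta> - 0) / c \<le> 1 + real K * \<delta>"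
    if \<delta>: "0 < \<delta>" "\<delta> < 1 / 2" "\<delta> < E" for \<delta>
  proof -
    define J where "J = feedback_code.jump P \<delta>"
    obtain l0 where l0: "\<And>l. l0 \<le> l \<Longrightarrow> \<exists>M \<epsilon> (PU :: 'u measure) f g \<Omega> \<tau>.
        aflf_code P l M 0 K \<epsilon> PU f g \<Omega> \<tau> \<and> real M \<ge> 2 powr (real l * R) \<and>
        \<epsilon> \<le> 2 powr (- real l * (E - \<delta>)) \<and> \<P>(\<omega> in \<Omega>. \<tau> \<omega> > l) \<le> \<delta>"
      using ach \<delta>(1) unfolding achievable_def by blast
    \<comment> \<open>The codes provide only an upper bound on their \<epsilon>. Replacing
      \<epsilon> by the explicit \<open>r l\<close> weakens the inequality, provided that the
      factors involved are nonnegative; \<open>ev1\<close> and \<open>ev2\<close> ensure this for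
      large \<open>l\<close>.\<close>
    define r where "r l = 2 powr (0 - real l * (E - \<delta>))" for l
    have r: "r \<longlonglongrightarrow> 0" unfolding r_def using \<delta> by (intro powr_linear_tendsto_0) simp
    have lim: "(\<lambda>l. 1 - r l / \<delta> - \<delta> - r l) \<longlonglongrightarrow> 1 - 0 / \<delta> - \<delta> - 0"
      using r \<delta> by (intro tendsto_intros) auto
    have ev1: "eventually (\<lambda>l. 0 < 1 - r l / \<delta> - \<delta> - r l) sequentially"
      by (rule order_tendstoD(1)[OF lim]) (use \<delta> in simp)
    have "filterlim (\<lambda>l. (1 - \<delta>) * R * real l) at_top sequentially"
      using R \<delta> by (intro filterlim_tendsto_pos_mult_at_top[OF tendsto_const] filterlim_real_sequentially) auto
    then have ev2: "eventually (\<lambda>l. 1 \<le> (1 - \<delta>) * R * real l) sequentially"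
      by (simp add: filterlim_at_top)
    have "eventually (\<lambda>l. ((1 - \<delta>) * R - 1 / real l) / ?C * (1 - r l / \<delta>) +
        ((E - \<delta>) * (1 - r l / \<delta> - \<delta> - r l) - 1 / ln 2 * (1 / real l)) / c \<le>
        J / c * (1 / real l) + 1 + real K * \<delta>) sequentially"
      using ev1 ev2 eventually_ge_at_top[of "max 1 l0"]
    proof eventually_elim
      case (elim l)
      have l: "1 \<le> l" "0 < real l" using elim by auto
      obtain M \<epsilon> and PU :: "'u measure" and f g \<Omega> \<tau> where
        code: "aflf_code P l M 0 K \<epsilon> PU f g \<Omega> \<tau>" and M: "real M \<ge> 2 powr (real l * R)" and
        \<epsilon>r: "\<epsilon> \<le> 2 powr (- real l * (E - \<delta>))" and late: "\<P>(\<omega> in \<Omega>. \<tau> \<omega> > l) \<le> \<delta>"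
        using l0[of l] elim by auto
      have \<epsilon>: "0 < \<epsilon>" "\<epsilon> < 1" using code by (auto simp: aflf_code_def)
      have \<epsilon>r': "\<epsilon> \<le> r l" using \<epsilon>r by (simp add: r_def)
      have "1 < 2 powr (real l * R)" using l R powr_less_mono[of 0 "real l * R" 2] by simp
      then have M2: "2 \<le> M" using M by linarith
      have logM: "real l * R \<le> log 2 (real M)"
        using M M2 by (subst le_log_iff) auto
      have lE: "real l * (E - \<delta>) \<le> log 2 (1 / \<epsilon>)"
      proof -
        have "log 2 \<epsilon> \<le> - real l * (E - \<delta>)" using \<epsilon>r \<epsilon> by (subst log_le_iff) auto
        then show ?thesis using \<epsilon> by (simp add: log_divide)
      qed
      have lR: "(1 - \<delta>) * (real l * R) \<le> (1 - \<delta>) * log 2 (real M)"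
        using logM \<delta> by (intro mult_left_mono) auto
      have ge1: "1 \<le> (1 - \<delta>) * (real l * R)" using elim(2) by (simp add: ac_simps)
      have bnd: "((1 - \<delta>) * log 2 (real M) - 1) / ?C * (1 - \<epsilon> / \<delta>) +
          (log 2 (1 / \<epsilon>) * (1 - \<epsilon> / \<delta> - \<delta> - \<epsilon>) - 1 / ln 2) / c \<le>
          J / c + real l + real (K * l) * \<delta>"
        unfolding J_def
        by (rule converse_code[OF C1 C code late M2 \<delta>(1,2)]) (use lR ge1 in linarith)
      have rd: "\<epsilon> / \<delta> \<le> r l / \<delta>" "0 \<le> r l / \<delta>" using \<epsilon>r' \<delta> \<epsilon> by (auto intro!: divide_right_mono)
      have r0: "0 \<le> r l" by (simp add: r_def)
      have f1: "((1 - \<delta>) * (real l * R) - 1) / ?C * (1 - r l / \<delta>) \<le> ((1 - \<delta>) * log 2 (real M) - 1) / ?C * (1 - \<epsilon> / \<delta>)"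
      proof (intro mult_mono divide_right_mono)
        show "0 \<le> ((1 - \<delta>) * log 2 (real M) - 1) / ?C" using lR ge1 C by simp
        show "0 \<le> 1 - r l / \<delta>" using elim(1) \<delta> r0 by linarith
      qed (use lR rd C in auto)
      have f2: "real l * (E - \<delta>) * (1 - r l / \<delta> - \<delta> - r l) \<le> log 2 (1 / \<epsilon>) * (1 - \<epsilon> / \<delta> - \<delta> - \<epsilon>)"
      proof (intro mult_mono)
        show "1 - r l / \<delta> - \<delta> - r l \<le> 1 - \<epsilon> / \<delta> - \<delta> - \<epsilon>" using rd \<epsilon>r' by linarith
        show "0 \<le> 1 - r l / \<delta> - \<delta> - r l" using elim(1) by linarith
        show "0 \<le> log 2 (1 / \<epsilon>)" using \<epsilon> by simp
      qed (rule lE)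
      have "((1 - \<delta>) * (real l * R) - 1) / ?C * (1 - r l / \<delta>) +
          (real l * (E - \<delta>) * (1 - r l / \<delta> - \<delta> - r l) - 1 / ln 2) / c \<le>
          J / c + real l + real (K * l) * \<delta>"
      proof -
        have "(real l * (E - \<delta>) * (1 - r l / \<delta> - \<delta> - r l) - 1 / ln 2) / c \<le>
            (log 2 (1 / \<epsilon>) * (1 - \<epsilon> / \<delta> - \<delta> - \<epsilon>) - 1 / ln 2) / c"
          using f2 c by (intro divide_right_mono) auto
        with f1 bnd show ?thesis by linarith
      qed
      then have "(((1 - \<delta>) * (real l * R) - 1) / ?C * (1 - r l / \<delta>) +
          (real l * (E - \<delta>) * (1 - r l / \<delta> - \<delta> - r l) - 1 / ln 2) / c) / real l \<le>
          (J / c + real l + real (K * l) * \<delta>) / real l"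
        using l by (intro divide_right_mono) auto
      moreover have "(((1 - \<delta>) * (real l * R) - 1) / ?C * (1 - r l / \<delta>) +
          (real l * (E - \<delta>) * (1 - r l / \<delta> - \<delta> - r l) - 1 / ln 2) / c) / real l =
          ((1 - \<delta>) * R - 1 / real l) / ?C * (1 - r l / \<delta>) +
        ((E - \<delta>) * (1 - r l / \<delta> - \<delta> - r l) - 1 / ln 2 * (1 / real l)) / c"
      proof -
        have "((p * real l - 1) / ?C * q + (real l * t - u) / c) / real l = (p - 1 / real l) / ?C * q + (t - u * (1 / real l)) / c"
          for p q t u :: real
          using l by (simp add: divide_inverse algebra_simps)
        from this[of "(1 - \<delta>) * R" "1 - r l / \<delta>" "(E - \<delta>) * (1 - r l / \<delta> - \<delta> - r l)" "1 / ln 2"]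
        show ?thesis by (simp only: ac_simps)
      qed
      moreover have "(J / c + real l + real (K * l) * \<delta>) / real l = J / c * (1 / real l) + 1 + real K * \<delta>"
        using l by (simp add: add_divide_distrib)
      ultimately show ?case by simp
    qed
    moreover have "(\<lambda>l. ((1 - \<delta>) * R - 1 / real l) / ?C * (1 - r l / \<delta>) +
        ((E - \<delta>) * (1 - r l / \<delta> - \<delta> - r l) - 1 / ln 2 * (1 / real l)) / c)
      \<longlonglongrightarrow> ((1 - \<delta>) * R - 0) / ?C * (1 - 0 / \<delta>) + ((E - \<delta>) * (1 - 0 / \<delta> - \<delta> - 0) - 1 / ln 2 * 0) / c"
      using C c \<delta> r by (intro tendsto_intros lim_1_over_n) auto
    moreover have "(\<lambda>l. J / c * (1 / real l) + 1 + real K * \<delta>) \<longlonglongrightarrow> J / c * 0 + 1 + real K * \<delta>"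
      by (intro tendsto_intros lim_1_over_n)
    ultimately have "((1 - \<delta>) * R - 0) / ?C * (1 - 0 / \<delta>) + ((E - \<delta>) * (1 - 0 / \<delta> - \<delta> - 0) - 1 / ln 2 * 0) / c
        \<le> J / c * 0 + 1 + real K * \<delta>"
      by (intro tendsto_le[OF sequentially_bot]) auto
    then show ?thesis by simp
  qed
  have "eventually (\<lambda>\<delta>. \<delta> < 1 / 2 \<and> \<delta> < E) (at_right 0)"
    using E by (intro eventually_conj order_tendstoD(2)[OF tendsto_ident_at]) auto
  then have ev: "eventually (\<lambda>\<delta>. (1 - \<delta>) * R / ?C + (E - \<delta>) * (1 - \<delta>) / c \<le> 1 + real K * \<delta>) (at_right 0)"
    using eventually_at_right_less[of "0::real"] by eventually_elim (use step in simp)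
  have "((\<lambda>\<delta>. (1 - \<delta>) * R / ?C + (E - \<delta>) * (1 - \<delta>) / c) \<longlongrightarrow> (1 - 0) * R / ?C + (E - 0) * (1 - 0) / c) (at_right 0)"
    using C c by (intro tendsto_intros) auto
  moreover have "((\<lambda>\<delta>. 1 + real K * \<delta>) \<longlongrightarrow> 1 + real K * 0) (at_right 0)"
    by (intro tendsto_intros)
  ultimately have "(1 - 0) * R / ?C + (E - 0) * (1 - 0) / c \<le> 1 + real K * 0"
    using ev by (intro tendsto_le[of "at_right (0::real)"]) auto
  then have "E / c \<le> 1 - R / ?C" by simp
  then have "E \<le> c * (1 - R / ?C)" using c by (simp add: field_simps)
  with neg show False by simp
qed

text \<open>It suffices to reach every value below the minimum. Values up to 0 are covered by
  exponent 0; a positive one excludes \<open>K = 1\<close>, where the second entry is 0.\<close>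

lemma aflf_exponent_ge_min:
  fixes P :: "'x::finite \<Rightarrow> 'y::finite pmf"
  assumes R: "0 \<le> R" "R < capacity P" and K: "1 \<le> K"
  shows "min (C1 P * ereal (1 - R / capacity P))
      (ereal (if K = 1 then 0 else (real K - 1) * Er P (R / (real K - 1)))) \<le> aflf_exponent TYPE('u) P R 0 K"
    (is "?m \<le> _")
proof (rule dense_le)
  fix z assume z: "z < ?m"
  have 0: "ereal 0 \<le> aflf_exponent TYPE('u) P R 0 K"
    unfolding aflf_exponent_def using achievable_zero[OF R(1) K, where 'u = 'u] by (intro Sup_upper) blast
  show "z \<le> aflf_exponent TYPE('u) P R 0 K"
  proof (cases "z \<le> 0")
    case True
    then show ?thesis using 0 by (simp add: zero_ereal_def)
  next
    case False
    with z have K2: "2 \<le> K" using K by (cases "K = 1") (auto simp: zero_ereal_def)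
    obtain E where E: "z = ereal E" using False z by (cases z) auto
    have "achievable TYPE('u) P R 0 K E"
      using False z E K2 by (intro achievable_below_min R) auto
    then show ?thesis unfolding aflf_exponent_def E by (intro Sup_upper) blast
  qed
qed

theorem theorem1:
  fixes P :: "'x::finite \<Rightarrow> 'y::finite pmf" and R :: real
  assumes "infinite (UNIV :: 'u set)"
    and "0 \<le> R" and "R < capacity P"
  shows "(\<forall>K::nat. 1 \<le> K \<longrightarrow>
            aflf_exponent TYPE('u) P R 0 K \<ge>
              min (C1 P * ereal (1 - R / capacity P))
                  (ereal (if K = 1 then 0 else (real K - 1) * Er P (R / (real K - 1))))) \<and>
         (0 < R \<longrightarrow> (\<forall>K::nat. 1 \<le> K \<and> ereal (real K) \<ge> 1 + C1 P / ereal (Er P 0) \<longrightarrow>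
            aflf_exponent TYPE('u) P R 0 K = C1 P * ereal (1 - R / capacity P)))"
proof (intro conjI allI impI)
  note R = assms(2,3)
  fix K :: nat assume "1 \<le> K"
  then show "aflf_exponent TYPE('u) P R 0 K \<ge>
              min (C1 P * ereal (1 - R / capacity P))
                  (ereal (if K = 1 then 0 else (real K - 1) * Er P (R / (real K - 1))))"
    by (rule aflf_exponent_ge_min[OF R])
next
  note R = assms(2,3)
  fix K :: nat
  assume R0: "0 < R" and K: "1 \<le> K \<and> ereal (real K) \<ge> 1 + C1 P / ereal (Er P 0)"
  have C: "0 < capacity P" using R by linarith
  have Er0: "0 \<le> Er P 0" using E0_le_Er[of 0 P _ 0] by simp
  have C1pos: "0 < C1 P"
  proof (cases "C1 P")
    case (real c)
    then show ?thesis using capacity_le_C1[OF real] C by simp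
  next
    case MInf
    then show ?thesis using C1_nonneg[of P] by simp
  qed simp
  have Er_pos: "0 < Er P 0"
  proof (rule ccontr)
    assume "\<not> ?thesis"
    \<comment> \<open>Dividing a positive extended real by 0 gives infinity, a threshold that no
      natural number reaches. The assumption on \<open>K\<close> thus implies
      \<open>0 < Er P 0\<close>.\<close>
    then have "C1 P / ereal (Er P 0) = \<infinity>" using Er0 C1pos by (simp add: divide_ereal_def)
    then show False using K by simp
  qed
  \<comment> \<open>In the same way the threshold excludes an infinite \<open>C1 P\<close>.\<close>
  obtain c where c: "C1 P = ereal c"
    using K C1pos Er_pos by (cases "C1 P") auto
  have c_ge: "capacity P \<le> c" by (rule capacity_le_C1[OF c])
  have Kc: "1 + c / Er P 0 \<le> real K" using K Er_pos by (simp add: c)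
  moreover have "0 < c / Er P 0" using c_ge C Er_pos by simp
  ultimately have K1: "0 < real K - 1" "K \<noteq> 1" by auto
  have "c \<le> (real K - 1) * Er P 0" using Kc Er_pos by (simp add: field_simps)
  then have "c - R \<le> (real K - 1) * (Er P 0 - R / (real K - 1))" using K1 by (simp add: right_diff_distrib)
  also have "\<dots> \<le> (real K - 1) * Er P (R / (real K - 1))"
    using Er_lower_line[of "R / (real K - 1)" P] R K1 by (intro mult_left_mono) auto
  finally have "c - R \<le> (real K - 1) * Er P (R / (real K - 1))" .
  \<comment> \<open>The value \<open>c - R\<close> separates the two entries of the minimum: the
    fallback exponent lies above it, and \<open>c * (1 - R / capacity P)\<close> below it because
    \<open>capacity P \<le> c\<close>.\<close>
  moreover have "R * capacity P \<le> R * c" using c_ge R by (intro mult_left_mono) auto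
  then have "c * (1 - R / capacity P) \<le> c - R" using C by (simp add: field_simps)
  ultimately have "C1 P * ereal (1 - R / capacity P) = min (C1 P * ereal (1 - R / capacity P))
      (ereal (if K = 1 then 0 else (real K - 1) * Er P (R / (real K - 1))))"
    using K1 by (simp add: c min_def)
  also have "\<dots> \<le> aflf_exponent TYPE('u) P R 0 K"
    using K by (intro aflf_exponent_ge_min R) simp
  finally have "C1 P * ereal (1 - R / capacity P) \<le> aflf_exponent TYPE('u) P R 0 K" .
  moreover have "aflf_exponent TYPE('u) P R 0 K \<le> C1 P * ereal (1 - R / capacity P)"
    unfolding aflf_exponent_def using achievable_converse[OF c R0 R(2), where 'u = 'u]
    by (intro Sup_least) (auto simp: c)
  ultimately show "aflf_exponent TYPE('u) P R 0 K = C1 P * ereal (1 - R / capacity P)"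
    by (rule antisym[rotated])
qed

end
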